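(* Let $\mathcal{S}$ be a category with products. DF monoids on $\mathbf{Set_f}$ in $\mathcal{S}$ coincide with commutative monoids in $\mathcal{S}$. Explicitly: for every DF monoid $F$ on $\mathbf{Set_f}$ in $\mathcal{S}$, with associated functors $F_!:\mathbf{Set_f}\to\mathcal{S}$ and $F^*:\mathbf{Set_f}^{\mathrm{op}}\to\mathcal{S}$, the object $F1$ is a commutative monoid in $\mathcal{S}$, with multiplication $F1\times F1\cong F2\to F1$ and unit $F0\to F1$ given by the values of $F_!$ on the unique mappings $2\to 1$ and $0\to 1$ (here $n$ denotes an $n$-element set, $F2\cong F1\times F1$ is induced by $F^*$ of the two injections $1\to 2$, and $F0$ is terminal); and every commutative monoid in $\mathcal{S}$ arises in this way from a DF monoid on $\mathbf{Set_f}$ in $\mathcal{S}$ which is unique up to isomorphism.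
   Context: $\mathbf{Set_f}$ is the category of finite sets and mappings. A (pseudo) double category $\mathbb{A}$ has a category $A_0$ of objects and horizontal arrows, a category $A_1$ of vertical arrows and cells, source and target functors $s,t:A_1\to A_0$, and a vertical composition. Functors between double categories are lax; $F_h:A_0\to B_0$ and $F_v:A_1\to B_1$ denote the horizontal and vertical components. $\mathbb{A}^{\mathrm{op}}$ is the horizontal opposite ($A_0$, $A_1$ replaced by $A_0^{\mathrm{op}}$, $A_1^{\mathrm{op}}$, with $s$, $t$ not exchanged). $\mathbb{S}\mathrm{q}\,\mathcal{S}$ is the double category of commutative squares in $\mathcal{S}$; $\mathbb{P}\mathrm{b}\,\mathcal{C}$ is the double category whose horizontal and vertical arrows are the arrows of $\mathcal{C}$ and whose cells are the pullback squares in $\mathcal{C}$. A functor of double categories preserves products if both $F_h$ and $F_v$ do. For an extensive category $\mathcal{C}$ with pullbacks and a category $\mathcal{S}$ with products, a DF monoid on $\mathcal{C}$ in $\mathcal{S}$ is a product-preserving functor $F:(\mathbb{P}\mathrm{b}\,\mathcal{C})^{\mathrm{op}}\to\mathbb{S}\mathrm{q}\,\mathcal{S}$. Equivalently, it consists of functors $F_!:\mathcal{C}\to\mathcal{S}$ (given by $F_v$ on vertical arrows) and $F^*:\mathcal{C}^{\mathrm{op}}\to\mathcal{S}$ (given by $F_h$), coinciding on objects, with $F^*$ preserving products, such that for every pullback square in $\mathcal{C}$ with $k:I\to L$, $g:L\to K$, $f:I\to J$, $l:J\to K$, $gk=lf$, one has $F_!f\circ F^*k=F^*l\circ F_!g$.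 An isomorphism of DF monoids $F\to G$ is a family of isomorphisms $FI\to GI$ in $\mathcal{S}$, natural with respect to both $F_!,G_!$ and $F^*,G^*$. A commutative monoid in $\mathcal{S}$ is a commutative monoid object with respect to the cartesian product of $\mathcal{S}$. *)

theory Defs
  imports Main "HOL-Library.FuncSet"
begin

section \<open>Categories and functors\<close>

record ('o, 'm) cat =
  Obj :: "'o set"
  Arr :: "'m set"
  Dom :: "'m \<Rightarrow> 'o"
  Cod :: "'m \<Rightarrow> 'o"
  Ident :: "'o \<Rightarrow> 'm"
  Comp :: "'m \<Rightarrow> 'm \<Rightarrow> 'm"  \<comment> \<open>\<open>Comp C g f\<close> is \<open>g \<circ> f\<close>\<close>

definition hom :: "('o, 'm) cat \<Rightarrow> 'o \<Rightarrow> 'o \<Rightarrow> 'm set" where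
  "hom C a b = {f \<in> Arr C. Dom C f = a \<and> Cod C f = b}"

locale category =
  fixes C :: "('o, 'm) cat"
  assumes Dom_Obj: "f \<in> Arr C \<Longrightarrow> Dom C f \<in> Obj C"
    and Cod_Obj: "f \<in> Arr C \<Longrightarrow> Cod C f \<in> Obj C"
    and Ident_hom: "a \<in> Obj C \<Longrightarrow> Ident C a \<in> hom C a a"
    and Comp_hom: "\<lbrakk>f \<in> hom C a b; g \<in> hom C b c\<rbrakk> \<Longrightarrow> Comp C g f \<in> hom C a c"
    and Comp_Ident: "f \<in> hom C a b \<Longrightarrow> Comp C f (Ident C a) = f"
    and Ident_Comp: "f \<in> hom C a b \<Longrightarrow> Comp C (Ident C b) f = f"
    and Comp_assoc: "\<lbrakk>f \<in> hom C a b; g \<in> hom C b c; h \<in> hom C c d\<rbrakk>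
      \<Longrightarrow> Comp C h (Comp C g f) = Comp C (Comp C h g) f"

definition op_cat :: "('o, 'm) cat \<Rightarrow> ('o, 'm) cat" where
  "op_cat C = \<lparr>Obj = Obj C, Arr = Arr C, Dom = Cod C, Cod = Dom C, Ident = Ident C,
     Comp = (\<lambda>g f. Comp C f g)\<rparr>"

definition inverse_pair :: "('o, 'm) cat \<Rightarrow> 'm \<Rightarrow> 'm \<Rightarrow> bool" where
  "inverse_pair C f g \<longleftrightarrow> f \<in> Arr C \<and> g \<in> hom C (Cod C f) (Dom C f)
     \<and> Comp C g f = Ident C (Dom C f) \<and> Comp C f g = Ident C (Cod C f)"

definition iso :: "('o, 'm) cat \<Rightarrow> 'm \<Rightarrow> bool" where
  "iso C f \<longleftrightarrow> (\<exists>g. inverse_pair C f g)"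

definition inv_arr :: "('o, 'm) cat \<Rightarrow> 'm \<Rightarrow> 'm" where
  "inv_arr C f = (THE g. inverse_pair C f g)"

record ('o, 'm, 'p, 'n) ftor =
  ObM :: "'o \<Rightarrow> 'p"
  ArM :: "'m \<Rightarrow> 'n"

locale functor_between = A: category A + B: category B
  for A :: "('o, 'm) cat" and B :: "('p, 'n) cat" +
  fixes F :: "('o, 'm, 'p, 'n) ftor"
  assumes ObM_Obj: "a \<in> Obj A \<Longrightarrow> ObM F a \<in> Obj B"
    and ArM_hom: "f \<in> hom A a b \<Longrightarrow> ArM F f \<in> hom B (ObM F a) (ObM F b)"
    and ArM_Ident: "a \<in> Obj A \<Longrightarrow> ArM F (Ident A a) = Ident B (ObM F a)"
    and ArM_Comp: "\<lbrakk>f \<in> hom A a b; g \<in> hom A b c\<rbrakk>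
      \<Longrightarrow> ArM F (Comp A g f) = Comp B (ArM F g) (ArM F f)"


section \<open>Products\<close>

definition terminal :: "('o, 'm) cat \<Rightarrow> 'o \<Rightarrow> bool" where
  "terminal C t \<longleftrightarrow> t \<in> Obj C \<and> (\<forall>a \<in> Obj C. \<exists>!f. f \<in> hom C a t)"

definition product_cone ::
  "('o, 'm) cat \<Rightarrow> 'i set \<Rightarrow> ('i \<Rightarrow> 'o) \<Rightarrow> 'o \<Rightarrow> ('i \<Rightarrow> 'm) \<Rightarrow> bool" where
  "product_cone C I X p \<pi> \<longleftrightarrow> p \<in> Obj C \<and> (\<forall>i \<in> I. \<pi> i \<in> hom C p (X i)) \<and>
     (\<forall>a \<in> Obj C. \<forall>f. (\<forall>i \<in> I. f i \<in> hom C a (X i)) \<longrightarrow>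
        (\<exists>!h. h \<in> hom C a p \<and> (\<forall>i \<in> I. Comp C (\<pi> i) h = f i)))"

definition has_finite_products :: "('o, 'm) cat \<Rightarrow> bool" where
  "has_finite_products C \<longleftrightarrow> (\<forall>(I :: nat set) X. finite I \<and> (\<forall>i \<in> I. X i \<in> Obj C) \<longrightarrow>
     (\<exists>p \<pi>. product_cone C I X p \<pi>))"

definition preserves_finite_products ::
  "('o, 'm) cat \<Rightarrow> ('p, 'n) cat \<Rightarrow> ('o, 'm, 'p, 'n) ftor \<Rightarrow> bool" where
  "preserves_finite_products A B F \<longleftrightarrow> (\<forall>(I :: nat set) X p \<pi>.
     finite I \<and> (\<forall>i \<in> I. X i \<in> Obj A) \<and> product_cone A I X p \<pi> \<longrightarrow>
     product_cone B I (\<lambda>i. ObM F (X i)) (ObM F p) (\<lambda>i. ArM F (\<pi> i)))"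

abbreviation two :: "'b \<Rightarrow> 'b \<Rightarrow> bool \<Rightarrow> 'b" where
  "two a b \<equiv> (\<lambda>i. if i then a else b)"

text \<open>A choice of a terminal object and of binary products, in a category that has them.\<close>

definition one :: "('o, 'm) cat \<Rightarrow> 'o" where
  "one C = (SOME t. terminal C t)"

definition bang :: "('o, 'm) cat \<Rightarrow> 'o \<Rightarrow> 'o \<Rightarrow> 'm" where
  "bang C a t = (THE f. f \<in> hom C a t)"

definition chosen_product :: "('o, 'm) cat \<Rightarrow> 'o \<Rightarrow> 'o \<Rightarrow> 'o \<times> 'm \<times> 'm" where
  "chosen_product C a b =
     (SOME (p, p1, p2). product_cone C UNIV (two a b) p (two p1 p2))"

definition prod_obj :: "('o, 'm) cat \<Rightarrow> 'o \<Rightarrow> 'o \<Rightarrow> 'o" where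
  "prod_obj C a b = fst (chosen_product C a b)"

definition proj1 :: "('o, 'm) cat \<Rightarrow> 'o \<Rightarrow> 'o \<Rightarrow> 'm" where
  "proj1 C a b = fst (snd (chosen_product C a b))"

definition proj2 :: "('o, 'm) cat \<Rightarrow> 'o \<Rightarrow> 'o \<Rightarrow> 'm" where
  "proj2 C a b = snd (snd (chosen_product C a b))"

definition pairing :: "('o, 'm) cat \<Rightarrow> 'm \<Rightarrow> 'm \<Rightarrow> 'm" where
  "pairing C f g = (THE h. h \<in> hom C (Dom C f) (prod_obj C (Cod C f) (Cod C g)) \<and>
     Comp C (proj1 C (Cod C f) (Cod C g)) h = f \<and>
     Comp C (proj2 C (Cod C f) (Cod C g)) h = g)"

definition prod_arr :: "('o, 'm) cat \<Rightarrow> 'm \<Rightarrow> 'm \<Rightarrow> 'm" where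
  "prod_arr C f g = pairing C
     (Comp C f (proj1 C (Dom C f) (Dom C g))) (Comp C g (proj2 C (Dom C f) (Dom C g)))"

text \<open>The canonical isomorphism from \<open>(a \<times> b) \<times> c\<close> to \<open>a \<times> (b \<times> c)\<close>.\<close>

definition prod_assoc :: "('o, 'm) cat \<Rightarrow> 'o \<Rightarrow> 'o \<Rightarrow> 'o \<Rightarrow> 'm" where
  "prod_assoc C a b c =
     (let q = proj1 C (prod_obj C a b) c in
      pairing C (Comp C (proj1 C a b) q)
        (pairing C (Comp C (proj2 C a b) q) (proj2 C (prod_obj C a b) c)))"

definition prod_swap :: "('o, 'm) cat \<Rightarrow> 'o \<Rightarrow> 'o \<Rightarrow> 'm" where
  "prod_swap C a b = pairing C (proj2 C a b) (proj1 C a b)"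


section \<open>Commutative monoid objects\<close>

definition comm_monoid_object :: "('o, 'm) cat \<Rightarrow> 'o \<Rightarrow> 'm \<Rightarrow> 'm \<Rightarrow> bool" where
  "comm_monoid_object C a \<mu> \<eta> \<longleftrightarrow>
     a \<in> Obj C \<and> \<mu> \<in> hom C (prod_obj C a a) a \<and> \<eta> \<in> hom C (one C) a \<and>
     Comp C \<mu> (prod_arr C \<mu> (Ident C a)) =
       Comp C \<mu> (Comp C (prod_arr C (Ident C a) \<mu>) (prod_assoc C a a a)) \<and>
     Comp C \<mu> (prod_arr C \<eta> (Ident C a)) = proj2 C (one C) a \<and>
     Comp C \<mu> (prod_arr C (Ident C a) \<eta>) = proj1 C a (one C) \<and>
     Comp C \<mu> (prod_swap C a a) = \<mu>"

definition monoid_object_iso ::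
  "('o, 'm) cat \<Rightarrow> 'o \<times> 'm \<times> 'm \<Rightarrow> 'o \<times> 'm \<times> 'm \<Rightarrow> bool" where
  "monoid_object_iso C = (\<lambda>(a, \<mu>, \<eta>) (a', \<mu>', \<eta>').
     \<exists>\<phi> \<in> hom C a a'. iso C \<phi> \<and>
       Comp C \<phi> \<mu> = Comp C \<mu>' (prod_arr C \<phi> \<phi>) \<and> Comp C \<phi> \<eta> = \<eta>')"


section \<open>Pseudo double categories\<close>

text \<open>
  \<open>HC\<close> is the category of objects and horizontal arrows, \<open>VC\<close> that of vertical arrows and cells
  (composed horizontally). Vertical composition \<open>VComp\<close> takes its arguments in diagrammatic order.
\<close>

record ('o, 'h, 'v, 'c) dblcat =
  HC :: "('o, 'h) cat"
  VC :: "('v, 'c) cat"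
  Src :: "('v, 'c, 'o, 'h) ftor"
  Tgt :: "('v, 'c, 'o, 'h) ftor"
  VId :: "('o, 'h, 'v, 'c) ftor"
  VComp :: "('v \<times> 'v, 'c \<times> 'c, 'v, 'c) ftor"
  Assoc :: "'v \<Rightarrow> 'v \<Rightarrow> 'v \<Rightarrow> 'c"
  LUnit :: "'v \<Rightarrow> 'c"
  RUnit :: "'v \<Rightarrow> 'c"

text \<open>The category of vertically composable pairs, i.e. the pullback of \<open>Tgt\<close> along \<open>Src\<close>.\<close>

definition VPairs :: "('o, 'h, 'v, 'c) dblcat \<Rightarrow> ('v \<times> 'v, 'c \<times> 'c) cat" where
  "VPairs D = \<lparr>
     Obj = {(u, v). u \<in> Obj (VC D) \<and> v \<in> Obj (VC D) \<and> ObM (Tgt D) u = ObM (Src D) v},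
     Arr = {(\<alpha>, \<beta>). \<alpha> \<in> Arr (VC D) \<and> \<beta> \<in> Arr (VC D) \<and> ArM (Tgt D) \<alpha> = ArM (Src D) \<beta>},
     Dom = (\<lambda>(\<alpha>, \<beta>). (Dom (VC D) \<alpha>, Dom (VC D) \<beta>)),
     Cod = (\<lambda>(\<alpha>, \<beta>). (Cod (VC D) \<alpha>, Cod (VC D) \<beta>)),
     Ident = (\<lambda>(u, v). (Ident (VC D) u, Ident (VC D) v)),
     Comp = (\<lambda>(\<alpha>', \<beta>') (\<alpha>, \<beta>). (Comp (VC D) \<alpha>' \<alpha>, Comp (VC D) \<beta>' \<beta>))\<rparr>"

abbreviation vcomp :: "('o, 'h, 'v, 'c) dblcat \<Rightarrow> 'v \<Rightarrow> 'v \<Rightarrow> 'v" where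
  "vcomp D u v \<equiv> ObM (VComp D) (u, v)"

abbreviation vcomp_cell :: "('o, 'h, 'v, 'c) dblcat \<Rightarrow> 'c \<Rightarrow> 'c \<Rightarrow> 'c" where
  "vcomp_cell D \<alpha> \<beta> \<equiv> ArM (VComp D) (\<alpha>, \<beta>)"

abbreviation vcomposable :: "('o, 'h, 'v, 'c) dblcat \<Rightarrow> 'v \<Rightarrow> 'v \<Rightarrow> bool" where
  "vcomposable D u v \<equiv> (u, v) \<in> Obj (VPairs D)"

text \<open>Special cells: those whose horizontal source and target are identities.\<close>

definition special :: "('o, 'h, 'v, 'c) dblcat \<Rightarrow> 'v \<Rightarrow> 'v \<Rightarrow> 'c set" where
  "special D u v = {\<alpha> \<in> hom (VC D) u v. ArM (Src D) \<alpha> = Ident (HC D) (ObM (Src D) u) \<and>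
     ArM (Tgt D) \<alpha> = Ident (HC D) (ObM (Tgt D) u)}"

definition special_iso :: "('o, 'h, 'v, 'c) dblcat \<Rightarrow> 'v \<Rightarrow> 'v \<Rightarrow> 'c set" where
  "special_iso D u v = {\<alpha> \<in> special D u v. iso (VC D) \<alpha>}"

locale double_category =
  fixes D :: "('o, 'h, 'v, 'c) dblcat"
  assumes Src_functor: "functor_between (VC D) (HC D) (Src D)"
    and Tgt_functor: "functor_between (VC D) (HC D) (Tgt D)"
    and VId_functor: "functor_between (HC D) (VC D) (VId D)"
    and VComp_functor: "functor_between (VPairs D) (VC D) (VComp D)"
    and Src_VId: "x \<in> Obj (HC D) \<Longrightarrow> ObM (Src D) (ObM (VId D) x) = x"
    and Tgt_VId: "x \<in> Obj (HC D) \<Longrightarrow> ObM (Tgt D) (ObM (VId D) x) = x"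
    and Src_VId_arr: "h \<in> Arr (HC D) \<Longrightarrow> ArM (Src D) (ArM (VId D) h) = h"
    and Tgt_VId_arr: "h \<in> Arr (HC D) \<Longrightarrow> ArM (Tgt D) (ArM (VId D) h) = h"
    and Src_vcomp: "vcomposable D u v \<Longrightarrow> ObM (Src D) (vcomp D u v) = ObM (Src D) u"
    and Tgt_vcomp: "vcomposable D u v \<Longrightarrow> ObM (Tgt D) (vcomp D u v) = ObM (Tgt D) v"
    and Src_vcomp_cell: "(\<alpha>, \<beta>) \<in> Arr (VPairs D) \<Longrightarrow>
      ArM (Src D) (vcomp_cell D \<alpha> \<beta>) = ArM (Src D) \<alpha>"
    and Tgt_vcomp_cell: "(\<alpha>, \<beta>) \<in> Arr (VPairs D) \<Longrightarrow>
      ArM (Tgt D) (vcomp_cell D \<alpha> \<beta>) = ArM (Tgt D) \<beta>"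
    and Assoc_special: "\<lbrakk>vcomposable D u v; vcomposable D v w\<rbrakk> \<Longrightarrow>
      Assoc D u v w \<in> special_iso D (vcomp D u (vcomp D v w)) (vcomp D (vcomp D u v) w)"
    and LUnit_special: "u \<in> Obj (VC D) \<Longrightarrow>
      LUnit D u \<in> special_iso D (vcomp D (ObM (VId D) (ObM (Src D) u)) u) u"
    and RUnit_special: "u \<in> Obj (VC D) \<Longrightarrow>
      RUnit D u \<in> special_iso D (vcomp D u (ObM (VId D) (ObM (Tgt D) u))) u"
    and Assoc_natural:
      "\<lbrakk>(\<alpha>, \<beta>) \<in> hom (VPairs D) (u, v) (u', v'); (\<beta>, \<gamma>) \<in> hom (VPairs D) (v, w) (v', w')\<rbrakk> \<Longrightarrow>
       Comp (VC D) (Assoc D u' v' w') (vcomp_cell D \<alpha> (vcomp_cell D \<beta> \<gamma>)) =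
       Comp (VC D) (vcomp_cell D (vcomp_cell D \<alpha> \<beta>) \<gamma>) (Assoc D u v w)"
    and LUnit_natural: "\<alpha> \<in> hom (VC D) u u' \<Longrightarrow>
      Comp (VC D) (LUnit D u') (vcomp_cell D (ArM (VId D) (ArM (Src D) \<alpha>)) \<alpha>) =
      Comp (VC D) \<alpha> (LUnit D u)"
    and RUnit_natural: "\<alpha> \<in> hom (VC D) u u' \<Longrightarrow>
      Comp (VC D) (RUnit D u') (vcomp_cell D \<alpha> (ArM (VId D) (ArM (Tgt D) \<alpha>))) =
      Comp (VC D) \<alpha> (RUnit D u)"
    and pentagon: "\<lbrakk>vcomposable D u v; vcomposable D v w; vcomposable D w z\<rbrakk> \<Longrightarrow>
      Comp (VC D) (Assoc D (vcomp D u v) w z) (Assoc D u v (vcomp D w z)) =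
      Comp (VC D) (vcomp_cell D (Assoc D u v w) (Ident (VC D) z))
        (Comp (VC D) (Assoc D u (vcomp D v w) z)
          (vcomp_cell D (Ident (VC D) u) (Assoc D v w z)))"
    and triangle: "vcomposable D u v \<Longrightarrow>
      Comp (VC D) (vcomp_cell D (RUnit D u) (Ident (VC D) v))
        (Assoc D u (ObM (VId D) (ObM (Tgt D) u)) v) =
      vcomp_cell D (Ident (VC D) u) (LUnit D v)"

text \<open>The horizontal opposite.\<close>

definition op_dbl :: "('o, 'h, 'v, 'c) dblcat \<Rightarrow> ('o, 'h, 'v, 'c) dblcat" where
  "op_dbl D = D\<lparr>HC := op_cat (HC D), VC := op_cat (VC D),
     Assoc := (\<lambda>u v w. inv_arr (VC D) (Assoc D u v w)),
     LUnit := (\<lambda>u. inv_arr (VC D) (LUnit D u)),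
     RUnit := (\<lambda>u. inv_arr (VC D) (RUnit D u))\<rparr>"

text \<open>
  In a functor \<open>F\<close> of double categories, \<open>FUnit F x\<close> is the comparison from the vertical
  identity of \<open>F x\<close> to the image of the vertical identity of \<open>x\<close>, and \<open>FComp F u v\<close> the one from
  the vertical composite of \<open>F u\<close> and \<open>F v\<close> to the image of the vertical composite of \<open>u\<close> and \<open>v\<close>.
\<close>

record ('o, 'h, 'v, 'c, 'p, 'k, 'w, 'd) dblftor =
  Fh :: "('o, 'h, 'p, 'k) ftor"
  Fv :: "('v, 'c, 'w, 'd) ftor"
  FUnit :: "'o \<Rightarrow> 'd"
  FComp :: "'v \<Rightarrow> 'v \<Rightarrow> 'd"

locale lax_double_functor = D: double_category D + E: double_category E
  for D :: "('o, 'h, 'v, 'c) dblcat" and E :: "('p, 'k, 'w, 'd) dblcat" +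
  fixes F :: "('o, 'h, 'v, 'c, 'p, 'k, 'w, 'd) dblftor"
  assumes Fh_functor: "functor_between (HC D) (HC E) (Fh F)"
    and Fv_functor: "functor_between (VC D) (VC E) (Fv F)"
    and Src_Fv: "u \<in> Obj (VC D) \<Longrightarrow> ObM (Src E) (ObM (Fv F) u) = ObM (Fh F) (ObM (Src D) u)"
    and Tgt_Fv: "u \<in> Obj (VC D) \<Longrightarrow> ObM (Tgt E) (ObM (Fv F) u) = ObM (Fh F) (ObM (Tgt D) u)"
    and Src_Fv_cell: "\<alpha> \<in> Arr (VC D) \<Longrightarrow>
      ArM (Src E) (ArM (Fv F) \<alpha>) = ArM (Fh F) (ArM (Src D) \<alpha>)"
    and Tgt_Fv_cell: "\<alpha> \<in> Arr (VC D) \<Longrightarrow>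
      ArM (Tgt E) (ArM (Fv F) \<alpha>) = ArM (Fh F) (ArM (Tgt D) \<alpha>)"
    and FUnit_special: "x \<in> Obj (HC D) \<Longrightarrow>
      FUnit F x \<in> special E (ObM (VId E) (ObM (Fh F) x)) (ObM (Fv F) (ObM (VId D) x))"
    and FComp_special: "vcomposable D u v \<Longrightarrow>
      FComp F u v \<in> special E (vcomp E (ObM (Fv F) u) (ObM (Fv F) v)) (ObM (Fv F) (vcomp D u v))"
    and FUnit_natural: "h \<in> hom (HC D) x y \<Longrightarrow>
      Comp (VC E) (FUnit F y) (ArM (VId E) (ArM (Fh F) h)) =
      Comp (VC E) (ArM (Fv F) (ArM (VId D) h)) (FUnit F x)"
    and FComp_natural: "(\<alpha>, \<beta>) \<in> hom (VPairs D) (u, v) (u', v') \<Longrightarrow>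
      Comp (VC E) (FComp F u' v') (vcomp_cell E (ArM (Fv F) \<alpha>) (ArM (Fv F) \<beta>)) =
      Comp (VC E) (ArM (Fv F) (vcomp_cell D \<alpha> \<beta>)) (FComp F u v)"
    and FComp_Assoc: "\<lbrakk>vcomposable D u v; vcomposable D v w\<rbrakk> \<Longrightarrow>
      Comp (VC E) (ArM (Fv F) (Assoc D u v w))
        (Comp (VC E) (FComp F u (vcomp D v w))
          (vcomp_cell E (Ident (VC E) (ObM (Fv F) u)) (FComp F v w))) =
      Comp (VC E) (FComp F (vcomp D u v) w)
        (Comp (VC E) (vcomp_cell E (FComp F u v) (Ident (VC E) (ObM (Fv F) w)))
          (Assoc E (ObM (Fv F) u) (ObM (Fv F) v) (ObM (Fv F) w)))"
    and FUnit_LUnit: "u \<in> Obj (VC D) \<Longrightarrow>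
      Comp (VC E) (ArM (Fv F) (LUnit D u))
        (Comp (VC E) (FComp F (ObM (VId D) (ObM (Src D) u)) u)
          (vcomp_cell E (FUnit F (ObM (Src D) u)) (Ident (VC E) (ObM (Fv F) u)))) =
      LUnit E (ObM (Fv F) u)"
    and FUnit_RUnit: "u \<in> Obj (VC D) \<Longrightarrow>
      Comp (VC E) (ArM (Fv F) (RUnit D u))
        (Comp (VC E) (FComp F u (ObM (VId D) (ObM (Tgt D) u)))
          (vcomp_cell E (Ident (VC E) (ObM (Fv F) u)) (FUnit F (ObM (Tgt D) u)))) =
      RUnit E (ObM (Fv F) u)"


section \<open>Double categories of squares\<close>

text \<open>
  A cell \<open>(f, k, l, g)\<close> is a square with vertical sides \<open>f\<close> (left) and \<open>g\<close> (right), top side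
  \<open>k\<close> and bottom side \<open>l\<close>; as an arrow of the category of vertical arrows it goes from
  \<open>f\<close> to \<open>g\<close>.
\<close>

definition commutative_square :: "('o, 'm) cat \<Rightarrow> 'm \<times> 'm \<times> 'm \<times> 'm \<Rightarrow> bool" where
  "commutative_square C = (\<lambda>(f, k, l, g).
     f \<in> Arr C \<and> g \<in> Arr C \<and> k \<in> hom C (Dom C f) (Dom C g) \<and> l \<in> hom C (Cod C f) (Cod C g) \<and>
     Comp C g k = Comp C l f)"

definition pullback_square :: "('o, 'm) cat \<Rightarrow> 'm \<times> 'm \<times> 'm \<times> 'm \<Rightarrow> bool" where
  "pullback_square C = (\<lambda>(f, k, l, g).
     commutative_square C (f, k, l, g) \<and>
     (\<forall>x \<in> Obj C. \<forall>a \<in> hom C x (Dom C g). \<forall>b \<in> hom C x (Cod C f). Comp C g a = Comp C l b \<longrightarrow>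
        (\<exists>!h. h \<in> hom C x (Dom C f) \<and> Comp C k h = a \<and> Comp C f h = b)))"

definition squares ::
  "('o, 'm) cat \<Rightarrow> ('m \<times> 'm \<times> 'm \<times> 'm) set \<Rightarrow> ('o, 'm, 'm, 'm \<times> 'm \<times> 'm \<times> 'm) dblcat" where
  "squares C Q = \<lparr>
     HC = C,
     VC = \<lparr>
       Obj = Arr C,
       Arr = Q,
       Dom = (\<lambda>(f, k, l, g). f),
       Cod = (\<lambda>(f, k, l, g). g),
       Ident = (\<lambda>f. (f, Ident C (Dom C f), Ident C (Cod C f), f)),
       Comp = (\<lambda>(f', k', l', g') (f, k, l, g). (f, Comp C k' k, Comp C l' l, g'))\<rparr>,
     Src = \<lparr>ObM = Dom C, ArM = (\<lambda>(f, k, l, g). k)\<rparr>,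
     Tgt = \<lparr>ObM = Cod C, ArM = (\<lambda>(f, k, l, g). l)\<rparr>,
     VId = \<lparr>ObM = Ident C, ArM = (\<lambda>k. (Ident C (Dom C k), k, k, Ident C (Cod C k)))\<rparr>,
     VComp = \<lparr>
       ObM = (\<lambda>(u, v). Comp C v u),
       ArM = (\<lambda>((f, k, l, g), (f', k', l', g')). (Comp C f' f, k, l', Comp C g' g))\<rparr>,
     Assoc = (\<lambda>u v w. let f = Comp C w (Comp C v u) in
       (f, Ident C (Dom C f), Ident C (Cod C f), f)),
     LUnit = (\<lambda>f. (f, Ident C (Dom C f), Ident C (Cod C f), f)),
     RUnit = (\<lambda>f. (f, Ident C (Dom C f), Ident C (Cod C f), f))\<rparr>"

definition Sq :: "('o, 'm) cat \<Rightarrow> ('o, 'm, 'm, 'm \<times> 'm \<times> 'm \<times> 'm) dblcat" where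
  "Sq C = squares C {c. commutative_square C c}"

definition Pb :: "('o, 'm) cat \<Rightarrow> ('o, 'm, 'm, 'm \<times> 'm \<times> 'm \<times> 'm) dblcat" where
  "Pb C = squares C {c. pullback_square C c}"


section \<open>DF monoids\<close>

type_synonym ('o, 'm, 'p, 'n) df =
  "('o, 'm, 'm, 'm \<times> 'm \<times> 'm \<times> 'm, 'p, 'n, 'n, 'n \<times> 'n \<times> 'n \<times> 'n) dblftor"

text \<open>Intended for \<open>C\<close> extensive with pullbacks and \<open>S\<close> with finite products.\<close>

definition DF_monoid :: "('o, 'm) cat \<Rightarrow> ('p, 'n) cat \<Rightarrow> ('o, 'm, 'p, 'n) df \<Rightarrow> bool" where
  "DF_monoid C S F \<longleftrightarrow> lax_double_functor (op_dbl (Pb C)) (Sq S) F \<and>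
     preserves_finite_products (HC (op_dbl (Pb C))) (HC (Sq S)) (Fh F) \<and>
     preserves_finite_products (VC (op_dbl (Pb C))) (VC (Sq S)) (Fv F)"

definition DF_obj :: "('o, 'm, 'p, 'n) df \<Rightarrow> 'o \<Rightarrow> 'p" where
  "DF_obj F = ObM (Fh F)"

definition DF_star :: "('o, 'm, 'p, 'n) df \<Rightarrow> 'm \<Rightarrow> 'n" where
  "DF_star F = ArM (Fh F)"

definition DF_shriek :: "('o, 'm, 'p, 'n) df \<Rightarrow> 'm \<Rightarrow> 'n" where
  "DF_shriek F = ObM (Fv F)"

definition DF_iso ::
  "('o, 'm) cat \<Rightarrow> ('p, 'n) cat \<Rightarrow> ('o, 'm, 'p, 'n) df \<Rightarrow> ('o, 'm, 'p, 'n) df \<Rightarrow> bool" where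
  "DF_iso C S F G \<longleftrightarrow> (\<exists>\<tau>.
     (\<forall>I \<in> Obj C. \<tau> I \<in> hom S (DF_obj F I) (DF_obj G I) \<and> iso S (\<tau> I)) \<and>
     (\<forall>I J. \<forall>f \<in> hom C I J.
        Comp S (\<tau> J) (DF_shriek F f) = Comp S (DF_shriek G f) (\<tau> I) \<and>
        Comp S (\<tau> I) (DF_star F f) = Comp S (DF_star G f) (\<tau> J)))"


section \<open>Finite sets\<close>

text \<open>
  The category of finite subsets of a type \<open>'a\<close>. When \<open>'a\<close> is infinite, it contains sets
  of every finite cardinality, and so it is a version of the category of finite sets.
\<close>

type_synonym 'a fmap = "'a set \<times> ('a \<Rightarrow> 'a) \<times> 'a set"

definition Setf :: "('a set, 'a fmap) cat" where
  "Setf = \<lparr>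
     Obj = {A. finite A},
     Arr = {(A, f, B). finite A \<and> finite B \<and> f \<in> A \<rightarrow>\<^sub>E B},
     Dom = (\<lambda>(A, f, B). A),
     Cod = (\<lambda>(A, f, B). B),
     Ident = (\<lambda>A. (A, \<lambda>x\<in>A. x, A)),
     Comp = (\<lambda>(B', g, C) (A, f, B). (A, compose A g f, C))\<rparr>"

definition const_map :: "'a set \<Rightarrow> 'a \<Rightarrow> 'a set \<Rightarrow> 'a fmap" where
  "const_map A b B = (A, \<lambda>x\<in>A. b, B)"

text \<open>
  The structure on the value of \<open>F\<close> at the one-element set \<open>{c}\<close>, with respect to the
  two-element set \<open>{u, v}\<close>. The comparison with the chosen product (terminal object) of \<open>S\<close>
  is inverted in the multiplication (unit).
\<close>

definition DF_mult ::
  "('p, 'n) cat \<Rightarrow> ('a set, 'a fmap, 'p, 'n) df \<Rightarrow> 'a \<Rightarrow> 'a \<Rightarrow> 'a \<Rightarrow> 'n" where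
  "DF_mult S F c u v = Comp S (DF_shriek F (const_map {u, v} c {c}))
     (inv_arr S (pairing S (DF_star F (const_map {c} u {u, v}))
                           (DF_star F (const_map {c} v {u, v}))))"

definition DF_unit :: "('p, 'n) cat \<Rightarrow> ('a set, 'a fmap, 'p, 'n) df \<Rightarrow> 'a \<Rightarrow> 'n" where
  "DF_unit S F c = Comp S (DF_shriek F (const_map {} c {c})) (bang S (one S) (DF_obj F {}))"

end

(*
  By the Beck-Chevalley condition, F_! of the mapping D -> 1 sends a D-indexed family of generalized
  elements of F1 (that is, a generalized element of FD) to a sum that depends only on the family:
  a decomposition D = D1 + D2, classified by a mapping D -> 2, splits the sum over D into the binary
  sum of those over D1 and D2. The axioms of a commutative monoid and, by induction, the formula
  "F_! f sums over the fibres of f" follow. So FA is the A-fold power of F1, with F^* acting by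
  reindexing and F_! by summation over fibres. This determines F up to isomorphism, and conversely
  the powers of any commutative monoid with these actions form a DF monoid: functoriality of F_! is
  the Fubini rule for finite sums, and Beck-Chevalley holds since a square in Set_f is a pullback
  iff it is bijective on fibres.
*)
theory Submission
  imports "HOL-Algebra.FiniteProduct" Defs
begin

hide_const (open) Group.hom Group.iso Group.one

section \<open>Categories and product cones\<close>

text \<open>A special cell of \<open>Sq S\<close> is a commutative square with identity horizontal
  sides, so it amounts to an equality of vertical arrows. The lax comparisons of a DF monoid thus
  make F_! a strict functor; conversely, a pair of functors with Beck-Chevalley becomes a double
  functor whose comparisons are identity cells. For this functor, preservation of products by F_v
  comes from that by F_h: coproducts of vertical arrows are componentwise, their injections are
  pullback squares (extensivity), and Beck-Chevalley sends these to commutative squares. The laws of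
  a commutative monoid object speak of chosen products, while F supplies products only up to
  isomorphism. To avoid carrying coherence isomorphisms, equations are tested on arrows from an
  arbitrary X: for a commutative monoid object a, hom(X, a) is an ordinary commutative monoid,
  natural in X, and sums over finite sets become \<open>finprod\<close>. Existence and uniqueness
  meet in one predicate, \<open>presentation\<close>. It is stated for a general monoid a instead of
  F1, so that an isomorphism between F1 and a is absorbed in the choice of projections.\<close>

lemma homD:
  assumes "f \<in> hom C a b"
  shows "f \<in> Arr C" "Dom C f = a" "Cod C f = b"
  using assms by (auto simp: hom_def)

context category
begin

lemma hom_Obj:
  assumes "f \<in> hom C a b"
  shows "a \<in> Obj C" "b \<in> Obj C"
  using assms Dom_Obj Cod_Obj by (auto simp: hom_def)

lemma Arr_hom: "f \<in> Arr C \<Longrightarrow> f \<in> hom C (Dom C f) (Cod C f)"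
  by (simp add: hom_def)

lemma Arr_Comp:
  assumes "f \<in> Arr C" "g \<in> Arr C" "Dom C g = Cod C f"
  shows "Comp C g f \<in> Arr C" "Dom C (Comp C g f) = Dom C f" "Cod C (Comp C g f) = Cod C g"
  using Comp_hom[of f "Dom C f" "Cod C f" g "Cod C g"] assms by (auto simp: hom_def)

lemma Arr_Ident:
  assumes "a \<in> Obj C"
  shows "Ident C a \<in> Arr C" "Dom C (Ident C a) = a" "Cod C (Ident C a) = a"
  using Ident_hom[OF assms] by (auto simp: hom_def)

lemma Comp_assoc':
  assumes "f \<in> Arr C" "g \<in> Arr C" "h \<in> Arr C" "Dom C g = Cod C f" "Dom C h = Cod C g"
  shows "Comp C (Comp C h g) f = Comp C h (Comp C g f)"
  using Comp_assoc[of f "Dom C f" "Cod C f" g "Cod C g" h "Cod C h"] assms by (auto simp: hom_def)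

lemma Comp_Ident':
  assumes "f \<in> Arr C"
  shows "Dom C f = a \<Longrightarrow> Comp C f (Ident C a) = f" "Cod C f = b \<Longrightarrow> Comp C (Ident C b) f = f"
  using Comp_Ident Ident_Comp Arr_hom[OF assms] by auto

lemmas cat_simps = Arr_Comp Arr_Ident Comp_assoc' Comp_Ident' Dom_Obj Cod_Obj

lemma inverse_pairI:
  assumes "f \<in> hom C a b" "g \<in> hom C b a" "Comp C g f = Ident C a" "Comp C f g = Ident C b"
  shows "inverse_pair C f g"
  using assms by (auto simp: inverse_pair_def hom_def)

lemma inverse_pair_unique:
  assumes "inverse_pair C f g" "inverse_pair C f h"
  shows "g = h"
proof -
  have gh: "g \<in> hom C (Cod C f) (Dom C f)" "h \<in> hom C (Cod C f) (Dom C f)"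
    "f \<in> hom C (Dom C f) (Cod C f)"
    using assms by (auto simp: inverse_pair_def hom_def)
  have "g = Comp C (Comp C h f) g"
    using assms Ident_Comp[OF gh(1)] by (simp add: inverse_pair_def)
  also have "\<dots> = Comp C h (Comp C f g)"
    using Comp_assoc[OF gh(1,3,2)] by simp
  also have "\<dots> = h"
    using assms Comp_Ident[OF gh(2)] by (simp add: inverse_pair_def)
  finally show ?thesis .
qed

lemma inv_arr_eq: "inverse_pair C f g \<Longrightarrow> inv_arr C f = g"
  unfolding inv_arr_def using inverse_pair_unique by blast

lemma inverse_pair_Ident: "a \<in> Obj C \<Longrightarrow> inverse_pair C (Ident C a) (Ident C a)"
  by (simp add: inverse_pair_def hom_def cat_simps)

lemma iso_Ident: "a \<in> Obj C \<Longrightarrow> iso C (Ident C a)"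
  unfolding iso_def using inverse_pair_Ident by blast

lemma inv_arr_Ident: "a \<in> Obj C \<Longrightarrow> inv_arr C (Ident C a) = Ident C a"
  by (simp add: inv_arr_eq inverse_pair_Ident)

end

lemma category_op: "category C \<Longrightarrow> category (op_cat C)"
  unfolding category_def op_cat_def hom_def by simp

lemma functor_between_op:
  assumes "functor_between A B F"
  shows "functor_between (op_cat A) (op_cat B) F"
proof -
  interpret functor_between A B F by fact
  show ?thesis
    using category_op[OF A.category_axioms] category_op[OF B.category_axioms]
      ObM_Obj ArM_hom ArM_Ident ArM_Comp
    by (auto simp: functor_between_def functor_between_axioms_def op_cat_def hom_def)
qed

section \<open>Product cones over index sets of arbitrary type\<close>

lemma product_coneD:
  assumes "product_cone C I X p \<pi>"
  shows "p \<in> Obj C" "i \<in> I \<Longrightarrow> \<pi> i \<in> hom C p (X i)"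
  using assms by (auto simp: product_cone_def)

lemma product_cone_cong:
  assumes "product_cone C I X p \<pi>" "\<And>i. i \<in> I \<Longrightarrow> X i = Y i" "\<And>i. i \<in> I \<Longrightarrow> \<pi> i = \<rho> i"
  shows "product_cone C I Y p \<rho>"
  using assms by (simp add: product_cone_def)

text \<open>Passes between arbitrary finite index sets and sets of naturals, the only ones over
  which a definition or a locale assumption can quantify here.\<close>

lemma product_cone_reindex:
  assumes "product_cone C I X p \<pi>" "bij_betw b J I"
  shows "product_cone C J (\<lambda>j. X (b j)) p (\<lambda>j. \<pi> (b j))"
proof -
  have *: "(\<forall>i\<in>I. P i) \<longleftrightarrow> (\<forall>j\<in>J. P (b j))" for P
    using assms(2) by (auto simp: bij_betw_def)
  have "\<exists>!h. h \<in> hom C a p \<and> (\<forall>j\<in>J. Comp C (\<pi> (b j)) h = f j)"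
    if "a \<in> Obj C" "\<forall>j\<in>J. f j \<in> hom C a (X (b j))" for a f
  proof -
    define g where "g i = f (the_inv_into J b i)" for i
    have g: "g (b j) = f j" if "j \<in> J" for j
      using assms(2) that by (simp add: g_def bij_betw_def the_inv_into_f_f)
    have "\<forall>i\<in>I. g i \<in> hom C a (X i)"
      using that(2) g by (simp add: *)
    then have "\<exists>!h. h \<in> hom C a p \<and> (\<forall>i\<in>I. Comp C (\<pi> i) h = g i)"
      using assms(1) that(1) by (simp add: product_cone_def)
    then show ?thesis by (simp add: * g)
  qed
  then show ?thesis
    using assms(1) by (auto simp: product_cone_def *)
qed

text \<open>Stated for an explicit category so that it serves for \<open>op_cat Setf\<close> as
  well, where it expresses that the injections of a coproduct are jointly epic.\<close>

lemma product_cone_ext: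
  assumes "product_cone C I X p \<pi>" "category C" "f \<in> hom C a p" "g \<in> hom C a p"
    "\<And>i. i \<in> I \<Longrightarrow> Comp C (\<pi> i) f = Comp C (\<pi> i) g"
  shows "f = g"
proof -
  interpret category C by fact
  have "a \<in> Obj C" using hom_Obj(1) assms(3) .
  moreover have "\<forall>i\<in>I. Comp C (\<pi> i) g \<in> hom C a (X i)"
    using assms(1,4) Comp_hom by (auto simp: product_cone_def)
  ultimately have "\<exists>!h. h \<in> hom C a p \<and> (\<forall>i\<in>I. Comp C (\<pi> i) h = Comp C (\<pi> i) g)"
    using assms(1) by (simp add: product_cone_def)
  then show ?thesis using assms(3-5) by blast
qed

text \<open>The mediating arrow as a function of the cone. Source and target are explicit arguments
  since an empty family \<open>f\<close> or \<pi> does not determine them.\<close>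

definition tuple :: "('o, 'm) cat \<Rightarrow> 'i set \<Rightarrow> ('i \<Rightarrow> 'm) \<Rightarrow> 'o \<Rightarrow> 'o \<Rightarrow> ('i \<Rightarrow> 'm) \<Rightarrow> 'm" where
  "tuple C I \<pi> a p f = (THE h. h \<in> hom C a p \<and> (\<forall>i\<in>I. Comp C (\<pi> i) h = f i))"

lemma tuple:
  assumes "product_cone C I X p \<pi>" "a \<in> Obj C" "\<And>i. i \<in> I \<Longrightarrow> f i \<in> hom C a (X i)"
  shows "tuple C I \<pi> a p f \<in> hom C a p"
    and "i \<in> I \<Longrightarrow> Comp C (\<pi> i) (tuple C I \<pi> a p f) = f i"
proof -
  have "\<exists>!h. h \<in> hom C a p \<and> (\<forall>i\<in>I. Comp C (\<pi> i) h = f i)"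
    using assms by (simp add: product_cone_def)
  from theI'[OF this]
  show "tuple C I \<pi> a p f \<in> hom C a p" "i \<in> I \<Longrightarrow> Comp C (\<pi> i) (tuple C I \<pi> a p f) = f i"
    unfolding tuple_def by auto
qed

lemma product_coneI:
  assumes "p \<in> Obj C" "\<And>i. i \<in> I \<Longrightarrow> \<pi> i \<in> hom C p (X i)"
    "\<And>a f. a \<in> Obj C \<Longrightarrow> (\<And>i. i \<in> I \<Longrightarrow> f i \<in> hom C a (X i)) \<Longrightarrow>
      \<exists>h. h \<in> hom C a p \<and> (\<forall>i\<in>I. Comp C (\<pi> i) h = f i)"
    "\<And>a h k. h \<in> hom C a p \<Longrightarrow> k \<in> hom C a p \<Longrightarrow>
      (\<And>i. i \<in> I \<Longrightarrow> Comp C (\<pi> i) h = Comp C (\<pi> i) k) \<Longrightarrow> h = k"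
  shows "product_cone C I X p \<pi>"
  unfolding product_cone_def
proof (intro conjI ballI allI impI)
  show "p \<in> Obj C" "\<And>i. i \<in> I \<Longrightarrow> \<pi> i \<in> hom C p (X i)" by fact+
  fix a f assume "a \<in> Obj C" and f: "\<forall>i\<in>I. f i \<in> hom C a (X i)"
  then obtain h where "h \<in> hom C a p \<and> (\<forall>i\<in>I. Comp C (\<pi> i) h = f i)"
    using assms(3)[of a f] by auto
  then show "\<exists>!h. h \<in> hom C a p \<and> (\<forall>i\<in>I. Comp C (\<pi> i) h = f i)"
    using assms(4)[of _ a] by (intro ex1I[of _ h]) auto
qed

section \<open>Products up to isomorphism\<close>

context category
begin

text \<open>The inverse is the tuple of the inverses of the components after the projections of
  \<open>q\<close>. Both composites are recognized as identities by projecting.\<close>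

lemma product_cone_iso_components:
  assumes p: "product_cone C I X p \<pi>" and q: "product_cone C I Y q \<rho>"
    and h: "h \<in> hom C p q"
    and \<phi>: "\<And>i. i \<in> I \<Longrightarrow> \<phi> i \<in> hom C (X i) (Y i) \<and> iso C (\<phi> i)"
    and comm: "\<And>i. i \<in> I \<Longrightarrow> Comp C (\<rho> i) h = Comp C (\<phi> i) (\<pi> i)"
  shows "iso C h"
proof -
  define \<psi> where "\<psi> i = inv_arr C (\<phi> i)" for i
  have inv: "inverse_pair C (\<phi> i) (\<psi> i)" if "i \<in> I" for i
    using \<phi>[OF that] inv_arr_eq unfolding \<psi>_def iso_def by metis
  have \<psi>: "\<psi> i \<in> hom C (Y i) (X i)" "Comp C (\<psi> i) (\<phi> i) = Ident C (X i)"
    "Comp C (\<phi> i) (\<psi> i) = Ident C (Y i)" if "i \<in> I" for i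
    using inv[OF that] \<phi>[OF that] by (auto simp: inverse_pair_def hom_def)
  note pd = product_coneD[OF p] and qd = product_coneD[OF q]
  define k where "k = tuple C I \<pi> q p (\<lambda>i. Comp C (\<psi> i) (\<rho> i))"
  have k: "k \<in> hom C q p" "\<And>i. i \<in> I \<Longrightarrow> Comp C (\<pi> i) k = Comp C (\<psi> i) (\<rho> i)"
    using tuple[OF p qd(1), of "\<lambda>i. Comp C (\<psi> i) (\<rho> i)"] Comp_hom[OF qd(2) \<psi>(1)]
    by (auto simp: k_def)
  have "inverse_pair C h k"
  proof (rule inverse_pairI[OF h k(1)])
    show "Comp C k h = Ident C p"
    proof (rule product_cone_ext[OF p category_axioms])
      fix i assume i: "i \<in> I"
      have "Comp C (\<pi> i) (Comp C k h) = Comp C (Comp C (\<pi> i) k) h"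
        using Comp_assoc[OF h k(1) pd(2)[OF i]] .
      also have "\<dots> = Comp C (\<psi> i) (Comp C (\<rho> i) h)"
        using Comp_assoc[OF h qd(2)[OF i] \<psi>(1)[OF i]] k(2)[OF i] by simp
      also have "\<dots> = \<pi> i"
        using Comp_assoc[OF pd(2)[OF i] _ \<psi>(1)[OF i]] \<phi>[OF i] \<psi>(2)[OF i] comm[OF i]
          Ident_Comp[OF pd(2)[OF i]] by simp
      finally show "Comp C (\<pi> i) (Comp C k h) = Comp C (\<pi> i) (Ident C p)"
        using Comp_Ident[OF pd(2)[OF i]] by simp
    qed (use Comp_hom[OF h k(1)] Ident_hom[OF pd(1)] in auto)
    show "Comp C h k = Ident C q"
    proof (rule product_cone_ext[OF q category_axioms])
      fix i assume i: "i \<in> I"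
      have "Comp C (\<rho> i) (Comp C h k) = Comp C (Comp C (\<rho> i) h) k"
        using Comp_assoc[OF k(1) h qd(2)[OF i]] .
      also have "\<dots> = Comp C (\<phi> i) (Comp C (\<pi> i) k)"
        using Comp_assoc[OF k(1) pd(2)[OF i]] \<phi>[OF i] comm[OF i] by auto
      also have "\<dots> = \<rho> i"
        using Comp_assoc[OF qd(2)[OF i] \<psi>(1)[OF i]] \<phi>[OF i] \<psi>(3)[OF i] k(2)[OF i]
          Ident_Comp[OF qd(2)[OF i]] by auto
      finally show "Comp C (\<rho> i) (Comp C h k) = Comp C (\<rho> i) (Ident C q)"
        using Comp_Ident[OF qd(2)[OF i]] by simp
    qed (use Comp_hom[OF k(1) h] Ident_hom[OF qd(1)] in auto)
  qed
  then show ?thesis by (auto simp: iso_def)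
qed

lemma product_cones_iso:
  assumes p: "product_cone C I X p \<pi>" and q: "product_cone C I X q \<rho>"
  obtains h where "h \<in> hom C p q" "iso C h" "\<And>i. i \<in> I \<Longrightarrow> Comp C (\<rho> i) h = \<pi> i"
proof -
  note pd = product_coneD[OF p] and qd = product_coneD[OF q]
  define h where "h = tuple C I \<rho> p q \<pi>"
  have h: "h \<in> hom C p q" "\<And>i. i \<in> I \<Longrightarrow> Comp C (\<rho> i) h = \<pi> i"
    using tuple[OF q pd(1), of \<pi>] pd(2) by (auto simp: h_def)
  have X: "X i \<in> Obj C" if "i \<in> I" for i
    using hom_Obj(2)[OF pd(2)[OF that]] .
  have "iso C h"
    by (rule product_cone_iso_components[OF p q h(1), of "\<lambda>i. Ident C (X i)"])
      (use h(2) Ident_Comp[OF pd(2)] Ident_hom[OF X] iso_Ident[OF X] in auto)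
  then show ?thesis using that h by blast
qed

lemma product_cone_transfer:
  assumes q: "product_cone C I X q \<rho>" and h: "h \<in> hom C p q" "iso C h"
    and \<pi>: "\<And>i. i \<in> I \<Longrightarrow> \<pi> i = Comp C (\<rho> i) h"
  shows "product_cone C I X p \<pi>"
proof (rule product_coneI)
  note qd = product_coneD[OF q]
  obtain k where k: "k \<in> hom C q p" "Comp C k h = Ident C p" "Comp C h k = Ident C q"
    using h by (auto simp: iso_def inverse_pair_def hom_def)
  show "p \<in> Obj C" using hom_Obj(1)[OF h(1)] .
  show \<pi>': "\<pi> i \<in> hom C p (X i)" if "i \<in> I" for i
    using \<pi>[OF that] Comp_hom[OF h(1) qd(2)[OF that]] by simp
  show "\<exists>l. l \<in> hom C a p \<and> (\<forall>i\<in>I. Comp C (\<pi> i) l = f i)"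
    if a: "a \<in> Obj C" and f: "\<And>i. i \<in> I \<Longrightarrow> f i \<in> hom C a (X i)" for a f
  proof -
    define l where "l = tuple C I \<rho> a q f"
    have l: "l \<in> hom C a q" "\<And>i. i \<in> I \<Longrightarrow> Comp C (\<rho> i) l = f i"
      using tuple[OF q a, of f] f by (auto simp: l_def)
    have kl: "Comp C k l \<in> hom C a p" using Comp_hom[OF l(1) k(1)] .
    have "Comp C h (Comp C k l) = l"
      using Comp_assoc[OF l(1) k(1) h(1)] k(3) Ident_Comp[OF l(1)] by simp
    then have "Comp C (\<pi> i) (Comp C k l) = f i" if "i \<in> I" for i
      using Comp_assoc[OF kl h(1) qd(2)[OF that]] l(2)[OF that] \<pi>[OF that] by simp
    then show ?thesis using kl by blast
  qed
  show "l = l'" if l: "l \<in> hom C a p" "l' \<in> hom C a p"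
    and eq: "\<And>i. i \<in> I \<Longrightarrow> Comp C (\<pi> i) l = Comp C (\<pi> i) l'" for a l l'
  proof -
    have "Comp C h l = Comp C h l'"
    proof (rule product_cone_ext[OF q category_axioms])
      fix i assume i: "i \<in> I"
      show "Comp C (\<rho> i) (Comp C h l) = Comp C (\<rho> i) (Comp C h l')"
        using Comp_assoc[OF _ h(1) qd(2)[OF i]] l eq[OF i] \<pi>[OF i] by simp
    qed (use Comp_hom[OF _ h(1)] l in auto)
    then have "Comp C k (Comp C h l) = Comp C k (Comp C h l')" by simp
    then show ?thesis
      using Comp_assoc[OF _ h(1) k(1)] l k(2) Ident_Comp by auto
  qed
qed

end

context functor_between
begin

lemma ArM_iso:
  assumes "h \<in> hom A p q" "iso A h"
  shows "iso B (ArM F h)"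
proof -
  obtain k where k: "k \<in> hom A q p" "Comp A k h = Ident A p" "Comp A h k = Ident A q"
    using assms by (auto simp: iso_def inverse_pair_def hom_def)
  have "inverse_pair B (ArM F h) (ArM F k)"
    using B.inverse_pairI[OF ArM_hom[OF assms(1)] ArM_hom[OF k(1)]]
      ArM_Comp[OF assms(1) k(1)] ArM_Comp[OF k(1) assms(1)] k
      ArM_Ident A.hom_Obj[OF assms(1)] by simp
  then show ?thesis by (auto simp: iso_def)
qed

text \<open>All products of a family are isomorphic, so preservation has to be checked on one of
  them only. This is why explicit disjoint unions suffice later.\<close>

lemma preserves_product_cone:
  assumes p: "product_cone A I X p \<pi>" and q: "product_cone A I X q \<rho>"
    and F: "product_cone B I (\<lambda>i. ObM F (X i)) (ObM F q) (\<lambda>i. ArM F (\<rho> i))"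
  shows "product_cone B I (\<lambda>i. ObM F (X i)) (ObM F p) (\<lambda>i. ArM F (\<pi> i))"
proof -
  obtain h where h: "h \<in> hom A p q" "iso A h" "\<And>i. i \<in> I \<Longrightarrow> Comp A (\<rho> i) h = \<pi> i"
    using A.product_cones_iso[OF p q] by blast
  show ?thesis
    by (rule B.product_cone_transfer[OF F ArM_hom[OF h(1)] ArM_iso[OF h(1,2)]])
      (use h(3) ArM_Comp[OF h(1) product_coneD(2)[OF q]] in auto)
qed

end

section \<open>Chosen products and hom monoids\<close>

locale finite_product_category = category +
  assumes has_products: "has_finite_products C"
begin

text \<open>Extends \<open>has_finite_products\<close> from sets of naturals to every index type;
  the types needed are \<open>bool\<close> for binary products and the element type of
  \<open>Setf\<close> for powers.\<close>

lemma finite_product_exists: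
  fixes I :: "'i set"
  assumes "finite I" "\<And>i. i \<in> I \<Longrightarrow> X i \<in> Obj C"
  obtains p \<pi> where "product_cone C I X p \<pi>"
proof -
  obtain b :: "'i \<Rightarrow> nat" where b: "bij_betw b I {0..<card I}"
    using ex_bij_betw_finite_nat[OF assms(1)] by blast
  define Y where "Y n = X (the_inv_into I b n)" for n
  have Y: "Y (b i) = X i" if "i \<in> I" for i
    using b that by (simp add: Y_def bij_betw_def the_inv_into_f_f)
  have "Y n \<in> Obj C" if "n \<in> {0..<card I}" for n
  proof -
    from that b obtain i where "i \<in> I" "n = b i"
      by (metis bij_betw_imp_surj_on imageE)
    then show ?thesis using Y assms(2) by simp
  qed
  then have "\<exists>p \<pi>. product_cone C {0..<card I} Y p \<pi>"
    using has_products unfolding has_finite_products_def by simp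
  then obtain p \<pi> where "product_cone C {0..<card I} Y p \<pi>" by auto
  from product_cone_reindex[OF this b] have "product_cone C I X p (\<lambda>i. \<pi> (b i))"
    by (rule product_cone_cong) (simp_all add: Y)
  then show ?thesis by (rule that)
qed

lemma terminal_one: "terminal C (one C)"
proof -
  obtain p \<pi> where "product_cone C ({} :: nat set) (\<lambda>_. undefined) p \<pi>"
    by (rule finite_product_exists[of "{}" "\<lambda>_. undefined"]) auto
  then have "terminal C p"
    by (simp add: product_cone_def terminal_def)
  then show ?thesis unfolding one_def by (rule someI)
qed

lemma one_Obj: "one C \<in> Obj C"
  using terminal_one by (simp add: terminal_def)

lemma terminal_ext:
  assumes "terminal C t" "f \<in> hom C a t" "g \<in> hom C a t"
  shows "f = g"
proof -
  have "\<exists>!f. f \<in> hom C a t"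
    using assms(1) hom_Obj(1)[OF assms(2)] by (simp add: terminal_def)
  then show ?thesis using assms(2,3) by (elim ex1E) metis
qed

lemma terminal_bang_hom: "terminal C t \<Longrightarrow> a \<in> Obj C \<Longrightarrow> bang C a t \<in> hom C a t"
  unfolding bang_def terminal_def by (rule theI') simp

lemma bang_hom: "a \<in> Obj C \<Longrightarrow> bang C a (one C) \<in> hom C a (one C)"
  by (rule terminal_bang_hom[OF terminal_one])

lemma bang_eq: "f \<in> hom C a (one C) \<Longrightarrow> bang C a (one C) = f"
  by (rule terminal_ext[OF terminal_one bang_hom[OF hom_Obj(1)]])

lemma prod_cone:
  assumes "a \<in> Obj C" "b \<in> Obj C"
  shows "product_cone C UNIV (two a b) (prod_obj C a b) (two (proj1 C a b) (proj2 C a b))"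
proof -
  obtain p \<pi> where "product_cone C (UNIV :: bool set) (two a b) p \<pi>"
    by (rule finite_product_exists[of "UNIV :: bool set" "two a b"]) (auto simp: assms)
  \<comment> \<open>\<open>chosen_product\<close> selects a pair of projections, so the family
    indexed by \<open>bool\<close> is first rewritten as \<open>two\<close> of its values.\<close>
  then have "product_cone C UNIV (two a b) p (two (\<pi> True) (\<pi> False))"
    by (rule product_cone_cong) auto
  then have "\<exists>x. (\<lambda>(p, p1, p2). product_cone C UNIV (two a b) p (two p1 p2)) x"
    by auto
  from someI_ex[OF this] show ?thesis
    unfolding prod_obj_def proj1_def proj2_def chosen_product_def case_prod_beta .
qed

lemma prod_obj_Obj: "a \<in> Obj C \<Longrightarrow> b \<in> Obj C \<Longrightarrow> prod_obj C a b \<in> Obj C"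
  using product_coneD(1)[OF prod_cone] .

lemma proj_hom:
  assumes "a \<in> Obj C" "b \<in> Obj C"
  shows "proj1 C a b \<in> hom C (prod_obj C a b) a" "proj2 C a b \<in> hom C (prod_obj C a b) b"
  using product_coneD(2)[OF prod_cone[OF assms], of True]
    product_coneD(2)[OF prod_cone[OF assms], of False] by auto

lemma prod_ext:
  assumes "h \<in> hom C x (prod_obj C a b)" "k \<in> hom C x (prod_obj C a b)" "a \<in> Obj C" "b \<in> Obj C"
    "Comp C (proj1 C a b) h = Comp C (proj1 C a b) k"
    "Comp C (proj2 C a b) h = Comp C (proj2 C a b) k"
  shows "h = k"
  using product_cone_ext[OF prod_cone[OF assms(3,4)] category_axioms assms(1,2)] assms(5,6) by auto

lemma pairing:
  assumes f: "f \<in> hom C x a" and g: "g \<in> hom C x b"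
  shows "pairing C f g \<in> hom C x (prod_obj C a b)"
    and "Comp C (proj1 C a b) (pairing C f g) = f"
    and "Comp C (proj2 C a b) (pairing C f g) = g"
proof -
  note ob = hom_Obj[OF f] hom_Obj(2)[OF g]
  let ?P = "\<lambda>h. h \<in> hom C x (prod_obj C a b) \<and> Comp C (proj1 C a b) h = f \<and>
    Comp C (proj2 C a b) h = g"
  have "?P (tuple C UNIV (two (proj1 C a b) (proj2 C a b)) x (prod_obj C a b) (two f g))"
    using tuple[OF prod_cone[OF ob(2,3)] ob(1), of "two f g"] f g
      tuple(2)[OF prod_cone[OF ob(2,3)] ob(1), of "two f g" True]
      tuple(2)[OF prod_cone[OF ob(2,3)] ob(1), of "two f g" False] by simp
  then have "\<exists>!h. ?P h"
    using prod_ext[OF _ _ ob(2,3)] by (intro ex1I) auto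
  moreover have "pairing C f g = (THE h. ?P h)"
    using f g unfolding pairing_def by (simp add: homD[OF f] homD[OF g])
  ultimately have "?P (pairing C f g)"
    using theI'[of ?P] by simp
  then show "pairing C f g \<in> hom C x (prod_obj C a b)"
    "Comp C (proj1 C a b) (pairing C f g) = f" "Comp C (proj2 C a b) (pairing C f g) = g"
    by auto
qed

lemma pairing_eqI:
  assumes "h \<in> hom C x (prod_obj C a b)" "a \<in> Obj C" "b \<in> Obj C"
    "Comp C (proj1 C a b) h = f" "Comp C (proj2 C a b) h = g"
  shows "pairing C f g = h"
proof -
  have "f \<in> hom C x a" "g \<in> hom C x b"
    using assms Comp_hom[OF assms(1)] proj_hom by blast+
  note p = pairing[OF this]
  show ?thesis by (rule prod_ext[OF p(1) assms(1-3)]) (simp_all add: p assms)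
qed

lemma pairing_Comp:
  assumes f: "f \<in> hom C x a" and g: "g \<in> hom C x b" and h: "h \<in> hom C y x"
  shows "Comp C (pairing C f g) h = pairing C (Comp C f h) (Comp C g h)"
proof -
  note ob = hom_Obj(2)[OF f] hom_Obj(2)[OF g]
  note p = pairing[OF f g]
  show ?thesis
    by (rule pairing_eqI[OF Comp_hom[OF h p(1)] ob, symmetric])
      (simp_all add: Comp_assoc[OF h p(1)  proj_hom(1)[OF ob]]
        Comp_assoc[OF h p(1)  proj_hom(2)[OF ob]] p)
qed

lemma prod_arr:
  assumes f: "f \<in> hom C a a'" and g: "g \<in> hom C b b'"
  shows "prod_arr C f g \<in> hom C (prod_obj C a b) (prod_obj C a' b')"
    and "x \<in> hom C z a \<Longrightarrow> y \<in> hom C z b \<Longrightarrow>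
      Comp C (prod_arr C f g) (pairing C x y) = pairing C (Comp C f x) (Comp C g y)"
proof -
  have ob: "a \<in> Obj C" "b \<in> Obj C" using hom_Obj(1) f g by auto
  note fp = Comp_hom[OF proj_hom(1)[OF ob] f] and gp = Comp_hom[OF proj_hom(2)[OF ob] g]
  have eq: "prod_arr C f g = pairing C (Comp C f (proj1 C a b)) (Comp C g (proj2 C a b))"
    by (simp add: prod_arr_def homD[OF f] homD[OF g])
  show "prod_arr C f g \<in> hom C (prod_obj C a b) (prod_obj C a' b')"
    unfolding eq using pairing(1)[OF fp gp] .
  assume x: "x \<in> hom C z a" and y: "y \<in> hom C z b"
  show "Comp C (prod_arr C f g) (pairing C x y) = pairing C (Comp C f x) (Comp C g y)"
    unfolding eq pairing_Comp[OF fp gp pairing(1)[OF x y]]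
    using Comp_assoc[OF pairing(1)[OF x y] proj_hom(1)[OF ob] f]
      Comp_assoc[OF pairing(1)[OF x y] proj_hom(2)[OF ob] g] pairing[OF x y] by simp
qed

lemma pairing_proj:
  assumes "a \<in> Obj C" "b \<in> Obj C"
  shows "pairing C (proj1 C a b) (proj2 C a b) = Ident C (prod_obj C a b)"
  by (rule pairing_eqI[OF Ident_hom[OF prod_obj_Obj[OF assms]] assms])
    (rule Comp_Ident[OF proj_hom(1)[OF assms]] Comp_Ident[OF proj_hom(2)[OF assms]])+

lemma prod_swap:
  assumes "a \<in> Obj C" "b \<in> Obj C"
  shows "prod_swap C a b \<in> hom C (prod_obj C a b) (prod_obj C b a)"
    and "x \<in> hom C z a \<Longrightarrow> y \<in> hom C z b \<Longrightarrow>
      Comp C (prod_swap C a b) (pairing C x y) = pairing C y x"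
proof -
  note p = proj_hom[OF assms]
  show "prod_swap C a b \<in> hom C (prod_obj C a b) (prod_obj C b a)"
    unfolding prod_swap_def by (rule pairing(1)[OF p(2,1)])
  assume x: "x \<in> hom C z a" and y: "y \<in> hom C z b"
  show "Comp C (prod_swap C a b) (pairing C x y) = pairing C y x"
    unfolding prod_swap_def pairing_Comp[OF p(2,1) pairing(1)[OF x y]] by (simp add: pairing[OF x y])
qed

lemma prod_assoc:
  assumes "a \<in> Obj C" "b \<in> Obj C" "c \<in> Obj C"
  shows "prod_assoc C a b c \<in> hom C (prod_obj C (prod_obj C a b) c) (prod_obj C a (prod_obj C b c))"
    and "x \<in> hom C z a \<Longrightarrow> y \<in> hom C z b \<Longrightarrow> w \<in> hom C z c \<Longrightarrow>
      Comp C (prod_assoc C a b c) (pairing C (pairing C x y) w) = pairing C x (pairing C y w)"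
proof -
  note ab = prod_obj_Obj[OF assms(1,2)]
  note q = proj_hom[OF ab assms(3)]
  note p = proj_hom[OF assms(1,2)]
  note h = Comp_hom[OF q(1) p(1)] Comp_hom[OF q(1) p(2)]
  note i = pairing(1)[OF h(2) q(2)]
  show "prod_assoc C a b c \<in> hom C (prod_obj C (prod_obj C a b) c) (prod_obj C a (prod_obj C b c))"
    unfolding prod_assoc_def Let_def using pairing(1)[OF h(1) i] .
  assume x: "x \<in> hom C z a" and y: "y \<in> hom C z b" and w: "w \<in> hom C z c"
  note xy = pairing[OF x y]
  note xyw = pairing[OF xy(1) w]
  show "Comp C (prod_assoc C a b c) (pairing C (pairing C x y) w) = pairing C x (pairing C y w)"
    unfolding prod_assoc_def Let_def pairing_Comp[OF h(1) i xyw(1)] pairing_Comp[OF h(2) q(2) xyw(1)]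
    using Comp_assoc[OF xyw(1) q(1) p(1)] Comp_assoc[OF xyw(1) q(1) p(2)] xy xyw by simp
qed

text \<open>The generalized elements of \<open>a\<close> at stage \<open>X\<close> with pointwise
  operations, that is, the Yoneda image of a monoid object. The record type is that of the algebra
  library, which gives access to \<open>finprod\<close>.\<close>

definition hom_monoid :: "'a \<Rightarrow> 'b \<Rightarrow> 'b \<Rightarrow> 'a \<Rightarrow> 'b monoid" where
  "hom_monoid a \<mu> \<eta> X = \<lparr>carrier = hom C X a, mult = (\<lambda>f g. Comp C \<mu> (pairing C f g)),
     one = Comp C \<eta> (bang C X (one C))\<rparr>"

lemma hom_monoid_simps [simp]:
  "carrier (hom_monoid a \<mu> \<eta> X) = hom C X a"
  "mult (hom_monoid a \<mu> \<eta> X) f g = Comp C \<mu> (pairing C f g)"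
  "monoid.one (hom_monoid a \<mu> \<eta> X) = Comp C \<eta> (bang C X (one C))"
  by (simp_all add: hom_monoid_def)

text \<open>Each law is the corresponding diagram composed with a tuple of generalized elements;
  \<open>prod_arr\<close>, \<open>prod_swap\<close> and \<open>prod_assoc\<close> act on tuples by
  the expected formulas.\<close>

lemma comm_monoid_hom_monoid:
  assumes M: "comm_monoid_object C a \<mu> \<eta>" and X: "X \<in> Obj C"
  shows "comm_monoid (hom_monoid a \<mu> \<eta> X)"
proof -
  note a = M[unfolded comm_monoid_object_def, THEN conjunct1]
  have \<mu>: "\<mu> \<in> hom C (prod_obj C a a) a" and \<eta>: "\<eta> \<in> hom C (one C) a"
    and assoc: "Comp C \<mu> (prod_arr C \<mu> (Ident C a)) =
       Comp C \<mu> (Comp C (prod_arr C (Ident C a) \<mu>) (prod_assoc C a a a))"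
    and unit: "Comp C \<mu> (prod_arr C \<eta> (Ident C a)) = proj2 C (one C) a"
    and comm: "Comp C \<mu> (prod_swap C a a) = \<mu>"
    using M by (auto simp: comm_monoid_object_def)
  note I = Ident_hom[OF a] and b = bang_hom[OF X]
  show ?thesis
  proof (rule comm_monoidI, unfold hom_monoid_simps)
    fix f g assume f: "f \<in> hom C X a" and g: "g \<in> hom C X a"
    note fg = pairing[OF f g]
    show "Comp C \<mu> (pairing C f g) \<in> hom C X a"
      using Comp_hom[OF fg(1) \<mu>] .
    show "Comp C \<mu> (pairing C f g) = Comp C \<mu> (pairing C g f)"
      using Comp_assoc[OF fg(1) prod_swap(1)[OF a a] \<mu>] comm prod_swap(2)[OF a a f g] by simp
    fix h assume h: "h \<in> hom C X a"
    note gh = pairing[OF g h]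
    note fgh = pairing[OF fg(1) h]
    have "Comp C \<mu> (pairing C (Comp C \<mu> (pairing C f g)) h) =
        Comp C \<mu> (Comp C (prod_arr C \<mu> (Ident C a)) (pairing C (pairing C f g) h))"
      using prod_arr(2)[OF \<mu> I fg(1) h] Ident_Comp[OF h] by simp
    also have "\<dots> = Comp C (Comp C \<mu> (Comp C (prod_arr C (Ident C a) \<mu>) (prod_assoc C a a a)))
        (pairing C (pairing C f g) h)"
      using Comp_assoc[OF fgh(1) prod_arr(1)[OF \<mu> I] \<mu>] assoc by simp
    also have "\<dots> = Comp C \<mu> (Comp C (prod_arr C (Ident C a) \<mu>)
        (Comp C (prod_assoc C a a a) (pairing C (pairing C f g) h)))"
      using Comp_assoc[OF fgh(1) Comp_hom[OF prod_assoc(1)[OF a a a] prod_arr(1)[OF I \<mu>]] \<mu>]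
        Comp_assoc[OF fgh(1) prod_assoc(1)[OF a a a] prod_arr(1)[OF I \<mu>]] by simp
    also have "\<dots> = Comp C \<mu> (pairing C f (Comp C \<mu> (pairing C g h)))"
      using prod_assoc(2)[OF a a a f g h] prod_arr(2)[OF I \<mu> f gh(1)] Ident_Comp[OF f] by simp
    finally show "Comp C \<mu> (pairing C (Comp C \<mu> (pairing C f g)) h) =
      Comp C \<mu> (pairing C f (Comp C \<mu> (pairing C g h)))" .
  next
    show "Comp C \<eta> (bang C X (one C)) \<in> hom C X a"
      using Comp_hom[OF b \<eta>] .
    fix f assume f: "f \<in> hom C X a"
    have "Comp C \<mu> (pairing C (Comp C \<eta> (bang C X (one C))) f) =
        Comp C \<mu> (Comp C (prod_arr C \<eta> (Ident C a)) (pairing C (bang C X (one C)) f))"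
      using prod_arr(2)[OF \<eta> I b f] Ident_Comp[OF f] by simp
    also have "\<dots> = f"
      using Comp_assoc[OF pairing(1)[OF b f] prod_arr(1)[OF \<eta> I] \<mu>] unit pairing(3)[OF b f] by simp
    finally show "Comp C \<mu> (pairing C (Comp C \<eta> (bang C X (one C))) f) = f" .
  qed
qed

lemma hom_monoid_precompose:
  assumes \<mu>: "\<mu> \<in> hom C (prod_obj C a a) a" and f: "f \<in> hom C X a" and g: "g \<in> hom C X a"
    and h: "h \<in> hom C Y X"
  shows "Comp C (Comp C \<mu> (pairing C f g)) h = Comp C \<mu> (pairing C (Comp C f h) (Comp C g h))"
  using Comp_assoc[OF h pairing(1)[OF f g] \<mu>] pairing_Comp[OF f g h] by simp

lemma hom_monoid_unit_precompose:
  assumes "\<eta> \<in> hom C (one C) a" and h: "h \<in> hom C Y X"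
  shows "Comp C (Comp C \<eta> (bang C X (one C))) h = Comp C \<eta> (bang C Y (one C))"
proof -
  note b = bang_hom[OF hom_Obj(2)[OF h]]
  show ?thesis
    using Comp_assoc[OF h b assms(1)] bang_eq[OF Comp_hom[OF h b]] by simp
qed

text \<open>Precomposition with \<open>h\<close> is a homomorphism from hom(X, a) to hom(Y, a),
  because the operations are pointwise. This is the naturality in the stage of definition that all
  later calculations use.\<close>

lemma finprod_precompose:
  assumes M: "comm_monoid_object C a \<mu> \<eta>" and h: "h \<in> hom C Y X"
    and f: "\<And>x. x \<in> A \<Longrightarrow> f x \<in> hom C X a"
  shows "Comp C (finprod (hom_monoid a \<mu> \<eta> X) f A) h = finprod (hom_monoid a \<mu> \<eta> Y) (\<lambda>x. Comp C (f x) h) A"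
proof -
  have \<mu>: "\<mu> \<in> hom C (prod_obj C a a) a" and \<eta>: "\<eta> \<in> hom C (one C) a"
    using M by (auto simp: comm_monoid_object_def)
  interpret X: comm_monoid "hom_monoid a \<mu> \<eta> X"
    using comm_monoid_hom_monoid[OF M hom_Obj(2)[OF h]] .
  interpret Y: comm_monoid "hom_monoid a \<mu> \<eta> Y"
    using comm_monoid_hom_monoid[OF M hom_Obj(1)[OF h]] .
  show ?thesis using f
  \<comment> \<open>Over an infinite set \<open>finprod\<close> is the unit by convention, so this
    case is settled like the empty one.\<close>
  proof (induction A rule: infinite_finite_induct)
    case (insert x A)
    have fin: "finprod (hom_monoid a \<mu> \<eta> X) f A \<in> hom C X a"
      using X.finprod_closed[of f A] insert.prems by auto
    show ?case
      using insert hom_monoid_precompose[OF \<mu> _ fin h]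
      by (simp add: Pi_def Comp_hom[OF h])
  qed (simp_all add: hom_monoid_unit_precompose[OF \<eta> h])
qed

text \<open>
  By the Yoneda lemma, it is enough to check the axioms of a commutative monoid on generalized
  elements.
\<close>

lemma comm_monoid_objectI:
  assumes a: "a \<in> Obj C" and \<mu>: "\<mu> \<in> hom C (prod_obj C a a) a" and \<eta>: "\<eta> \<in> hom C (one C) a"
    and assoc: "\<And>X f g h. f \<in> hom C X a \<Longrightarrow> g \<in> hom C X a \<Longrightarrow> h \<in> hom C X a \<Longrightarrow>
      Comp C \<mu> (pairing C (Comp C \<mu> (pairing C f g)) h) =
      Comp C \<mu> (pairing C f (Comp C \<mu> (pairing C g h)))"
    and comm: "\<And>X f g. f \<in> hom C X a \<Longrightarrow> g \<in> hom C X a \<Longrightarrow>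
      Comp C \<mu> (pairing C f g) = Comp C \<mu> (pairing C g f)"
    and unit: "\<And>X f. f \<in> hom C X a \<Longrightarrow>
      Comp C \<mu> (pairing C f (Comp C \<eta> (bang C X (one C)))) = f"
  shows "comm_monoid_object C a \<mu> \<eta>"
proof -
  note aa = prod_obj_Obj[OF a a] and I = Ident_hom[OF a]
  note aaa = prod_obj_Obj[OF aa a]
  have pp: "pairing C (proj1 C x y) (proj2 C x y) = Ident C (prod_obj C x y)"
    if "x \<in> Obj C" "y \<in> Obj C" for x y
    using that by (rule pairing_proj)
  have "Comp C \<mu> (prod_arr C \<mu> (Ident C a)) =
       Comp C \<mu> (Comp C (prod_arr C (Ident C a) \<mu>) (prod_assoc C a a a))"
  proof -
    \<comment> \<open>The projections \<open>x\<close>, \<open>y\<close>, \<open>z\<close> of (a x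
      a) x a are the universal triple of generalized elements; the assumed law at this triple is the
      associativity diagram itself.\<close>
    define z where "z = proj2 C (prod_obj C a a) a"
    define q where "q = proj1 C (prod_obj C a a) a"
    define x y where "x = Comp C (proj1 C a a) q" and "y = Comp C (proj2 C a a) q"
    have q: "q \<in> hom C (prod_obj C (prod_obj C a a) a) (prod_obj C a a)"
      and z: "z \<in> hom C (prod_obj C (prod_obj C a a) a) a"
      using proj_hom[OF aa a] by (auto simp: q_def z_def)
    have x: "x \<in> hom C (prod_obj C (prod_obj C a a) a) a"
      and y: "y \<in> hom C (prod_obj C (prod_obj C a a) a) a"
      using Comp_hom[OF q] proj_hom[OF a a] by (auto simp: x_def y_def)
    have xy: "pairing C x y = q"
      using pairing_eqI[OF q a a] by (simp add: x_def y_def)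
    have "Comp C \<mu> (prod_arr C \<mu> (Ident C a)) =
        Comp C \<mu> (pairing C (Comp C \<mu> (pairing C x y)) z)"
      unfolding prod_arr_def xy homD[OF \<mu>] homD[OF I] z_def[symmetric] q_def[symmetric]
      using Ident_Comp[OF z] by simp
    also have "\<dots> = Comp C \<mu> (pairing C x (Comp C \<mu> (pairing C y z)))"
      by (rule assoc[OF x y z])
    also have "pairing C x (Comp C \<mu> (pairing C y z)) =
        Comp C (prod_arr C (Ident C a) \<mu>) (pairing C x (pairing C y z))"
      using prod_arr(2)[OF I \<mu> x pairing(1)[OF y z]] Ident_Comp[OF x] by simp
    also have "pairing C x (pairing C y z) = prod_assoc C a a a"
      unfolding prod_assoc_def Let_def x_def y_def z_def q_def ..
    finally show ?thesis .
  qed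
  moreover have "Comp C \<mu> (prod_arr C (Ident C a) \<eta>) = proj1 C a (one C)"
  proof -
    note p = proj_hom[OF a one_Obj]
    have "prod_arr C (Ident C a) \<eta> =
        pairing C (proj1 C a (one C)) (Comp C \<eta> (bang C (prod_obj C a (one C)) (one C)))"
      unfolding prod_arr_def homD[OF \<eta>] homD[OF I] bang_eq[OF p(2)]
      using Ident_Comp[OF p(1)] by simp
    then show ?thesis using unit[OF p(1)] by simp
  qed
  \<comment> \<open>The left unit law is obtained from the right one by \<open>comm\<close>.\<close>
  moreover have "Comp C \<mu> (prod_arr C \<eta> (Ident C a)) = proj2 C (one C) a"
  proof -
    note p = proj_hom[OF one_Obj a]
    have "prod_arr C \<eta> (Ident C a) =
        pairing C (Comp C \<eta> (bang C (prod_obj C (one C) a) (one C))) (proj2 C (one C) a)"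
      unfolding prod_arr_def homD[OF \<eta>] homD[OF I] bang_eq[OF p(1)]
      using Ident_Comp[OF p(2)] by simp
    then show ?thesis
      using unit[OF p(2)] comm[OF Comp_hom[OF bang_hom[OF hom_Obj(1)[OF p(2)]] \<eta>] p(2)] by simp
  qed
  moreover have "Comp C \<mu> (prod_swap C a a) = \<mu>"
    unfolding prod_swap_def
    using comm[OF proj_hom(2,1)[OF a a]] pp[OF a a] Comp_Ident[OF \<mu>] by simp
  ultimately show ?thesis
    using a \<mu> \<eta> by (simp add: comm_monoid_object_def)
qed

end

section \<open>Strict double categories\<close>

text \<open>Squares in a category compose strictly, so all constraint cells are identities.
  Isolating this situation settles the coherence axioms once for \<open>Sq S\<close> and for the
  opposite of \<open>Pb Setf\<close>.\<close>

locale strict_double_category =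
  fixes D :: "('o, 'h, 'v, 'c) dblcat"
  assumes Src_functor: "functor_between (VC D) (HC D) (Src D)"
    and Tgt_functor: "functor_between (VC D) (HC D) (Tgt D)"
    and VId_functor: "functor_between (HC D) (VC D) (VId D)"
    and VComp_functor: "functor_between (VPairs D) (VC D) (VComp D)"
    and Src_VId: "x \<in> Obj (HC D) \<Longrightarrow> ObM (Src D) (ObM (VId D) x) = x"
    and Tgt_VId: "x \<in> Obj (HC D) \<Longrightarrow> ObM (Tgt D) (ObM (VId D) x) = x"
    and Src_VId_arr: "h \<in> Arr (HC D) \<Longrightarrow> ArM (Src D) (ArM (VId D) h) = h"
    and Tgt_VId_arr: "h \<in> Arr (HC D) \<Longrightarrow> ArM (Tgt D) (ArM (VId D) h) = h"
    and Src_vcomp: "vcomposable D u v \<Longrightarrow> ObM (Src D) (vcomp D u v) = ObM (Src D) u"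
    and Tgt_vcomp: "vcomposable D u v \<Longrightarrow> ObM (Tgt D) (vcomp D u v) = ObM (Tgt D) v"
    and Src_vcomp_cell: "(\<alpha>, \<beta>) \<in> Arr (VPairs D) \<Longrightarrow>
      ArM (Src D) (vcomp_cell D \<alpha> \<beta>) = ArM (Src D) \<alpha>"
    and Tgt_vcomp_cell: "(\<alpha>, \<beta>) \<in> Arr (VPairs D) \<Longrightarrow>
      ArM (Tgt D) (vcomp_cell D \<alpha> \<beta>) = ArM (Tgt D) \<beta>"
    and vcomp_assoc: "\<lbrakk>vcomposable D u v; vcomposable D v w\<rbrakk> \<Longrightarrow>
      vcomp D u (vcomp D v w) = vcomp D (vcomp D u v) w"
    and vcomp_VId_left: "u \<in> Obj (VC D) \<Longrightarrow> vcomp D (ObM (VId D) (ObM (Src D) u)) u = u"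
    and vcomp_VId_right: "u \<in> Obj (VC D) \<Longrightarrow> vcomp D u (ObM (VId D) (ObM (Tgt D) u)) = u"
    and vcomp_cell_assoc: "\<lbrakk>(\<alpha>, \<beta>) \<in> Arr (VPairs D); (\<beta>, \<gamma>) \<in> Arr (VPairs D)\<rbrakk> \<Longrightarrow>
      vcomp_cell D \<alpha> (vcomp_cell D \<beta> \<gamma>) = vcomp_cell D (vcomp_cell D \<alpha> \<beta>) \<gamma>"
    and vcomp_cell_VId_left: "\<alpha> \<in> Arr (VC D) \<Longrightarrow>
      vcomp_cell D (ArM (VId D) (ArM (Src D) \<alpha>)) \<alpha> = \<alpha>"
    and vcomp_cell_VId_right: "\<alpha> \<in> Arr (VC D) \<Longrightarrow>
      vcomp_cell D \<alpha> (ArM (VId D) (ArM (Tgt D) \<alpha>)) = \<alpha>"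
    and Assoc_eq: "\<lbrakk>vcomposable D u v; vcomposable D v w\<rbrakk> \<Longrightarrow>
      Assoc D u v w = Ident (VC D) (vcomp D u (vcomp D v w))"
    and LUnit_eq: "u \<in> Obj (VC D) \<Longrightarrow> LUnit D u = Ident (VC D) u"
    and RUnit_eq: "u \<in> Obj (VC D) \<Longrightarrow> RUnit D u = Ident (VC D) u"
begin

sublocale Src: functor_between "VC D" "HC D" "Src D" by (rule Src_functor)
sublocale Tgt: functor_between "VC D" "HC D" "Tgt D" by (rule Tgt_functor)
sublocale VId: functor_between "HC D" "VC D" "VId D" by (rule VId_functor)
sublocale VComp: functor_between "VPairs D" "VC D" "VComp D" by (rule VComp_functor)

lemma vcomposableD:
  assumes "vcomposable D u v"
  shows "u \<in> Obj (VC D)" "v \<in> Obj (VC D)" "ObM (Tgt D) u = ObM (Src D) v"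
  using assms by (auto simp: VPairs_def)

lemma vcomp_Obj: "vcomposable D u v \<Longrightarrow> vcomp D u v \<in> Obj (VC D)"
  by (rule VComp.ObM_Obj)

lemma vcomposable_vcomp:
  assumes "vcomposable D u v" "vcomposable D v w"
  shows "vcomposable D u (vcomp D v w)" "vcomposable D (vcomp D u v) w"
  using assms vcomp_Obj Src_vcomp Tgt_vcomp by (auto simp: VPairs_def)

lemma vcomp_cell_Ident:
  assumes "vcomposable D u v"
  shows "vcomp_cell D (Ident (VC D) u) (Ident (VC D) v) = Ident (VC D) (vcomp D u v)"
  using VComp.ArM_Ident[OF assms] by (simp add: VPairs_def)

lemma Ident_special_iso: "u \<in> Obj (VC D) \<Longrightarrow> Ident (VC D) u \<in> special_iso D u u"
  using Src.A.Ident_hom Src.ArM_Ident Tgt.ArM_Ident Src.A.iso_Ident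
  by (auto simp: special_iso_def special_def)

lemma vcomp_cell_hom:
  assumes "(\<alpha>, \<beta>) \<in> hom (VPairs D) (u, v) (u', v')"
  shows "vcomp_cell D \<alpha> \<beta> \<in> hom (VC D) (vcomp D u v) (vcomp D u' v')"
  using VComp.ArM_hom[OF assms] .

lemma vcomposable_VId:
  assumes "u \<in> Obj (VC D)"
  shows "vcomposable D u (ObM (VId D) (ObM (Tgt D) u))"
    "vcomposable D (ObM (VId D) (ObM (Src D) u)) u"
  using assms Src.ObM_Obj Tgt.ObM_Obj VId.ObM_Obj Src_VId Tgt_VId by (auto simp: VPairs_def)

text \<open>With identity constraints, naturality says that vertical composition of cells is
  strictly associative and unital, while pentagon and triangle compare composites of identity
  cells.\<close>

sublocale double_category D
proof (unfold_locales; (rule Src_VId Tgt_VId Src_VId_arr Tgt_VId_arr Src_vcomp Tgt_vcomp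
      Src_vcomp_cell Tgt_vcomp_cell; assumption)?)
  fix u v w assume uv: "vcomposable D u v" and vw: "vcomposable D v w"
  show "Assoc D u v w \<in> special_iso D (vcomp D u (vcomp D v w)) (vcomp D (vcomp D u v) w)"
    using Ident_special_iso vcomp_Obj[OF vcomposable_vcomp(2)[OF uv vw]]
    by (simp add: Assoc_eq[OF uv vw] vcomp_assoc[OF uv vw])
next
  fix u assume u: "u \<in> Obj (VC D)"
  show "LUnit D u \<in> special_iso D (vcomp D (ObM (VId D) (ObM (Src D) u)) u) u"
    "RUnit D u \<in> special_iso D (vcomp D u (ObM (VId D) (ObM (Tgt D) u))) u"
    using Ident_special_iso[OF u] u
    by (simp_all add: LUnit_eq RUnit_eq vcomp_VId_left vcomp_VId_right)
next
  fix \<alpha> \<beta> \<gamma> u v w u' v' w'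
  assume \<alpha>\<beta>: "(\<alpha>, \<beta>) \<in> hom (VPairs D) (u, v) (u', v')"
    and \<beta>\<gamma>: "(\<beta>, \<gamma>) \<in> hom (VPairs D) (v, w) (v', w')"
  note uv = VComp.A.hom_Obj[OF \<alpha>\<beta>] and vw = VComp.A.hom_Obj[OF \<beta>\<gamma>]
  have "(\<alpha>, vcomp_cell D \<beta> \<gamma>) \<in> hom (VPairs D) (u, vcomp D v w) (u', vcomp D v' w')"
    using \<alpha>\<beta> \<beta>\<gamma> vcomp_cell_hom[OF \<beta>\<gamma>] Src_vcomp_cell by (auto simp: hom_def VPairs_def)
  note l = vcomp_cell_hom[OF this]
  have eq: "vcomp_cell D \<alpha> (vcomp_cell D \<beta> \<gamma>) = vcomp_cell D (vcomp_cell D \<alpha> \<beta>) \<gamma>"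
    using vcomp_cell_assoc \<alpha>\<beta> \<beta>\<gamma> by (simp add: hom_def)
  show "Comp (VC D) (Assoc D u' v' w') (vcomp_cell D \<alpha> (vcomp_cell D \<beta> \<gamma>)) =
       Comp (VC D) (vcomp_cell D (vcomp_cell D \<alpha> \<beta>) \<gamma>) (Assoc D u v w)"
    using Src.A.Ident_Comp[OF l] Src.A.Comp_Ident[OF l]
    by (simp add: Assoc_eq[OF uv(1) vw(1)] Assoc_eq[OF uv(2) vw(2)] eq)
next
  fix \<alpha> u u' assume \<alpha>: "\<alpha> \<in> hom (VC D) u u'"
  note \<alpha>a = homD(1)[OF \<alpha>]
  show "Comp (VC D) (LUnit D u') (vcomp_cell D (ArM (VId D) (ArM (Src D) \<alpha>)) \<alpha>) =
      Comp (VC D) \<alpha> (LUnit D u)"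
    "Comp (VC D) (RUnit D u') (vcomp_cell D \<alpha> (ArM (VId D) (ArM (Tgt D) \<alpha>))) =
      Comp (VC D) \<alpha> (RUnit D u)"
    using Src.A.Ident_Comp[OF \<alpha>] Src.A.Comp_Ident[OF \<alpha>] Src.A.hom_Obj[OF \<alpha>]
    by (simp_all add: LUnit_eq RUnit_eq vcomp_cell_VId_left[OF \<alpha>a] vcomp_cell_VId_right[OF \<alpha>a])
next
  fix u v w z
  assume uv: "vcomposable D u v" and vw: "vcomposable D v w" and wz: "vcomposable D w z"
  note uvw = vcomposable_vcomp[OF uv vw] and vwz = vcomposable_vcomp[OF vw wz]
  note a = vcomposable_vcomp[OF uvw(2) wz] vcomposable_vcomp[OF uv vwz(1)]
    vcomposable_vcomp[OF uvw(1) vwz(2)]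
  note o = vcomp_Obj[OF a(1)] vcomp_Obj[OF a(2)] vcomp_Obj[OF a(3)] vcomp_Obj[OF a(4)]
  have "Comp (VC D) (Ident (VC D) x) (Ident (VC D) x) = Ident (VC D) x" if "x \<in> Obj (VC D)" for x
    using Src.A.Ident_Comp[OF Src.A.Ident_hom[OF that]] .
  note c = this[OF o(1)] this[OF o(2)] this[OF o(3)] this[OF o(4)]
  show "Comp (VC D) (Assoc D (vcomp D u v) w z) (Assoc D u v (vcomp D w z)) =
      Comp (VC D) (vcomp_cell D (Assoc D u v w) (Ident (VC D) z))
        (Comp (VC D) (Assoc D u (vcomp D v w) z)
          (vcomp_cell D (Ident (VC D) u) (Assoc D v w z)))"
    using c
    by (simp add: Assoc_eq uv vw wz uvw vwz vcomp_cell_Ident a vcomp_assoc)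
next
  fix u v assume uv: "vcomposable D u v"
  note d = vcomposableD[OF uv]
  have i: "vcomposable D (ObM (VId D) (ObM (Tgt D) u)) v"
    using vcomposable_VId(2)[OF d(2)] d(3) by simp
  show "Comp (VC D) (vcomp_cell D (RUnit D u) (Ident (VC D) v))
        (Assoc D u (ObM (VId D) (ObM (Tgt D) u)) v) =
      vcomp_cell D (Ident (VC D) u) (LUnit D v)"
    using Src.A.Ident_Comp[OF Src.A.Ident_hom[OF vcomp_Obj[OF uv]]] d vcomp_VId_left[OF d(2)]
    by (simp add: Assoc_eq[OF vcomposable_VId(1)[OF d(1)] i, unfolded d(3)] RUnit_eq LUnit_eq
        vcomp_cell_Ident[OF uv])
qed

end

lemma VPairs_op: "VPairs (op_dbl D) = op_cat (VPairs D)"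
  by (auto simp: VPairs_def op_dbl_def op_cat_def fun_eq_iff)

lemma op_dbl_simps [simp]:
  "HC (op_dbl D) = op_cat (HC D)" "VC (op_dbl D) = op_cat (VC D)" "Src (op_dbl D) = Src D"
  "Tgt (op_dbl D) = Tgt D" "VId (op_dbl D) = VId D" "VComp (op_dbl D) = VComp D"
  "Assoc (op_dbl D) u v w = inv_arr (VC D) (Assoc D u v w)"
  "LUnit (op_dbl D) u = inv_arr (VC D) (LUnit D u)"
  "RUnit (op_dbl D) u = inv_arr (VC D) (RUnit D u)"
  by (simp_all add: op_dbl_def)

lemma op_cat_simps [simp]:
  "Obj (op_cat C) = Obj C" "Arr (op_cat C) = Arr C" "Dom (op_cat C) = Cod C"
  "Cod (op_cat C) = Dom C" "Ident (op_cat C) = Ident C" "Comp (op_cat C) g f = Comp C f g"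
  "hom (op_cat C) a b = hom C b a"
  by (auto simp: op_cat_def hom_def)

text \<open>The opposite has the inverses of the constraint cells as its constraints, and the
  inverse of an identity cell is again that identity.\<close>

lemma strict_double_category_op:
  assumes "strict_double_category D"
  shows "strict_double_category (op_dbl D)"
proof -
  interpret strict_double_category D by fact
  show ?thesis
    by (rule strict_double_category.intro)
      (use functor_between_op Src_functor Tgt_functor VId_functor VComp_functor in
        \<open>auto simp: VPairs_op Src_VId Tgt_VId Src_VId_arr Tgt_VId_arr Src_vcomp Tgt_vcomp
          Src_vcomp_cell Tgt_vcomp_cell vcomp_assoc vcomp_VId_left vcomp_VId_right
          vcomp_cell_assoc vcomp_cell_VId_left vcomp_cell_VId_right Assoc_eq LUnit_eq RUnit_eq
          Src.A.inv_arr_Ident vcomp_Obj vcomposable_vcomp\<close>)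
qed

section \<open>Double categories of squares\<close>

text \<open>The closure properties shared by commutative squares and pullback squares, so that one
  argument makes both \<open>Sq\<close> and \<open>Pb\<close> double categories.\<close>

locale square_class = category C for C :: "('o, 'm) cat" +
  fixes Q :: "('m \<times> 'm \<times> 'm \<times> 'm) set"
  assumes commutative: "q \<in> Q \<Longrightarrow> commutative_square C q"
    and horizontal_identity: "f \<in> Arr C \<Longrightarrow> (f, Ident C (Dom C f), Ident C (Cod C f), f) \<in> Q"
    and vertical_identity: "k \<in> Arr C \<Longrightarrow> (Ident C (Dom C k), k, k, Ident C (Cod C k)) \<in> Q"
    and horizontal_comp: "(f, k, l, g) \<in> Q \<Longrightarrow> (g, k', l', h) \<in> Q \<Longrightarrow>
      (f, Comp C k' k, Comp C l' l, h) \<in> Q"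
    and vertical_comp: "(f, k, l, g) \<in> Q \<Longrightarrow> (f', l, l', g') \<in> Q \<Longrightarrow>
      (Comp C f' f, k, l', Comp C g' g) \<in> Q"
begin

lemma squareD:
  assumes "(f, k, l, g) \<in> Q"
  shows "f \<in> Arr C" "g \<in> Arr C" "k \<in> Arr C" "l \<in> Arr C" "Dom C k = Dom C f" "Cod C k = Dom C g"
    "Dom C l = Cod C f" "Cod C l = Cod C g" "Comp C g k = Comp C l f"
  using commutative[OF assms] by (auto simp: commutative_square_def hom_def)

lemma horizontal_identity':
  "f \<in> Arr C \<Longrightarrow> Cod C f = y \<Longrightarrow> (f, Ident C (Dom C f), Ident C y, f) \<in> Q"
  using horizontal_identity by blast

lemma vertical_assoc:
  assumes "(f, k, l, g) \<in> Q" "(f', l, l', g') \<in> Q" "(f'', l', l'', g'') \<in> Q"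
  shows "Comp C (Comp C f'' f') f = Comp C f'' (Comp C f' f)"
    "Comp C (Comp C g'' g') g = Comp C g'' (Comp C g' g)"
  using squareD[OF assms(1)] squareD[OF assms(2)] squareD[OF assms(3)] by (auto simp: Comp_assoc')

lemma category_VC: "category (VC (squares C Q))"
  by unfold_locales
    (auto simp: squares_def hom_def cat_simps horizontal_identity squareD intro!: horizontal_comp
      dest: squareD)

lemma squares_simps:
  "HC (squares C Q) = C"
  "Obj (VC (squares C Q)) = Arr C" "Arr (VC (squares C Q)) = Q"
  "Dom (VC (squares C Q)) (f, k, l, g) = f" "Cod (VC (squares C Q)) (f, k, l, g) = g"
  "Ident (VC (squares C Q)) f = (f, Ident C (Dom C f), Ident C (Cod C f), f)"
  "Comp (VC (squares C Q)) (f', k', l', g') (f, k, l, g) = (f, Comp C k' k, Comp C l' l, g')"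
  "ObM (Src (squares C Q)) f = Dom C f" "ArM (Src (squares C Q)) (f, k, l, g) = k"
  "ObM (Tgt (squares C Q)) f = Cod C f" "ArM (Tgt (squares C Q)) (f, k, l, g) = l"
  "ObM (VId (squares C Q)) = Ident C"
  "ArM (VId (squares C Q)) k = (Ident C (Dom C k), k, k, Ident C (Cod C k))"
  "vcomp (squares C Q) u v = Comp C v u"
  "vcomp_cell (squares C Q) (f, k, l, g) (f', k', l', g') = (Comp C f' f, k, l', Comp C g' g)"
  "Assoc (squares C Q) u v w = (Comp C w (Comp C v u), Ident C (Dom C (Comp C w (Comp C v u))),
    Ident C (Cod C (Comp C w (Comp C v u))), Comp C w (Comp C v u))"
  "LUnit (squares C Q) f = (f, Ident C (Dom C f), Ident C (Cod C f), f)"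
  "RUnit (squares C Q) f = (f, Ident C (Dom C f), Ident C (Cod C f), f)"
  by (simp_all add: squares_def Let_def)

lemma VC_hom: "hom (VC (squares C Q)) f g = {q \<in> Q. \<exists>k l. q = (f, k, l, g)}"
  by (auto simp: hom_def squares_simps)

lemma VC_homI: "(f, k, l, g) \<in> Q \<Longrightarrow> (f, k, l, g) \<in> hom (VC (squares C Q)) f g"
  by (simp add: VC_hom)

lemma VC_homE:
  assumes "q \<in> hom (VC (squares C Q)) f g"
  obtains k l where "q = (f, k, l, g)" "(f, k, l, g) \<in> Q"
  using assms by (auto simp: VC_hom)

lemma VPairs_hom: "hom (VPairs (squares C Q)) (u, v) (u', v') =
    {q. \<exists>k l m. q = ((u, k, l, u'), (v, l, m, v')) \<and> (u, k, l, u') \<in> Q \<and> (v, l, m, v') \<in> Q}"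
  by (auto simp: hom_def VPairs_def squares_simps)

lemma VPairs_homE:
  assumes "(\<alpha>, \<beta>) \<in> hom (VPairs (squares C Q)) (u, v) (u', v')"
  obtains k l m where "\<alpha> = (u, k, l, u')" "\<beta> = (v, l, m, v')" "(u, k, l, u') \<in> Q" "(v, l, m, v') \<in> Q"
  using assms by (auto simp: VPairs_hom)

lemma category_VPairs: "category (VPairs (squares C Q))"
  by (rule category.intro, auto simp: VPairs_hom)
    (auto simp: VPairs_def squares_simps cat_simps horizontal_identity horizontal_identity' squareD
      intro!: horizontal_comp dest: squareD)

lemma strict_double_category_squares: "strict_double_category (squares C Q)"
proof (rule strict_double_category.intro)
  show "functor_between (VC (squares C Q)) (HC (squares C Q)) (Src (squares C Q))"
    "functor_between (VC (squares C Q)) (HC (squares C Q)) (Tgt (squares C Q))"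
    by (intro functor_between.intro[OF category_VC] functor_between_axioms.intro;
      auto simp: squares_simps VC_hom category_axioms Dom_Obj Cod_Obj hom_def dest: squareD)+
  show "functor_between (HC (squares C Q)) (VC (squares C Q)) (VId (squares C Q))"
    by (intro functor_between.intro[OF _ category_VC] functor_between_axioms.intro)
      (auto simp: squares_simps VC_hom category_axioms cat_simps vertical_identity hom_def)
  show "functor_between (VPairs (squares C Q)) (VC (squares C Q)) (VComp (squares C Q))"
  proof (intro functor_between.intro[OF category_VPairs category_VC] functor_between_axioms.intro;
      clarify)
    fix u v assume uv: "vcomposable (squares C Q) u v"
    then show "vcomp (squares C Q) u v \<in> Obj (VC (squares C Q))"
      "ArM (VComp (squares C Q)) (Ident (VPairs (squares C Q)) (u, v)) =
       Ident (VC (squares C Q)) (vcomp (squares C Q) u v)"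
      by (auto simp: VPairs_def squares_simps cat_simps)
  next
    fix \<alpha> \<beta> u v u' v' assume h: "(\<alpha>, \<beta>) \<in> hom (VPairs (squares C Q)) (u, v) (u', v')"
    then show "vcomp_cell (squares C Q) \<alpha> \<beta> \<in>
       hom (VC (squares C Q)) (vcomp (squares C Q) u v) (vcomp (squares C Q) u' v')"
      by (auto simp: VPairs_hom squares_simps VC_hom intro: vertical_comp)
    fix \<alpha>' \<beta>' u'' v'' assume "(\<alpha>', \<beta>') \<in> hom (VPairs (squares C Q)) (u', v') (u'', v'')"
    with h show "ArM (VComp (squares C Q)) (Comp (VPairs (squares C Q)) (\<alpha>', \<beta>') (\<alpha>, \<beta>)) =
      Comp (VC (squares C Q)) (vcomp_cell (squares C Q) \<alpha>' \<beta>') (vcomp_cell (squares C Q) \<alpha> \<beta>)"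
      by (auto simp: VPairs_hom) (auto simp: VPairs_def squares_simps)
  qed
qed (auto simp: VPairs_def squares_simps cat_simps squareD intro: vertical_assoc dest: squareD)

end

section \<open>Commutative squares and pullback squares as classes of squares\<close>

context category
begin

lemma square_class_commutative: "square_class C {q. commutative_square C q}"
proof (rule square_class.intro[OF category_axioms square_class_axioms.intro]; simp)
  show "commutative_square C (f, Ident C (Dom C f), Ident C (Cod C f), f)"
    "commutative_square C (Ident C (Dom C f), f, f, Ident C (Cod C f))" if "f \<in> Arr C" for f
    using that by (auto simp: commutative_square_def hom_def cat_simps)
next
  fix f k l g k' l' h
  assume "commutative_square C (f, k, l, g)" "commutative_square C (g, k', l', h)"
  then have *: "f \<in> Arr C" "g \<in> Arr C" "h \<in> Arr C" "k \<in> Arr C" "l \<in> Arr C" "k' \<in> Arr C" "l' \<in> Arr C"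
    "Dom C k = Dom C f" "Cod C k = Dom C g" "Dom C l = Cod C f" "Cod C l = Cod C g"
    "Dom C k' = Dom C g" "Cod C k' = Dom C h" "Dom C l' = Cod C g" "Cod C l' = Cod C h"
    and eq: "Comp C g k = Comp C l f" "Comp C h k' = Comp C l' g"
    by (auto simp: commutative_square_def hom_def)
  have "Comp C h (Comp C k' k) = Comp C (Comp C l' g) k"
    unfolding eq(2)[symmetric] using * by (simp add: cat_simps)
  also have "\<dots> = Comp C (Comp C l' l) f"
    using * eq by (simp add: cat_simps)
  finally show "commutative_square C (f, Comp C k' k, Comp C l' l, h)"
    using * by (simp add: commutative_square_def hom_def cat_simps)
next
  fix f k l g f' l' g'
  assume "commutative_square C (f, k, l, g)" "commutative_square C (f', l, l', g')"
  then have *: "f \<in> Arr C" "g \<in> Arr C" "f' \<in> Arr C" "g' \<in> Arr C" "k \<in> Arr C" "l \<in> Arr C" "l' \<in> Arr C"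
    "Dom C k = Dom C f" "Cod C k = Dom C g" "Cod C f = Dom C f'" "Cod C g = Dom C g'"
    "Dom C l = Dom C f'" "Cod C l = Dom C g'" "Dom C l' = Cod C f'" "Cod C l' = Cod C g'"
    and eq: "Comp C g k = Comp C l f" "Comp C g' l = Comp C l' f'"
    by (auto simp: commutative_square_def hom_def)
  have "Comp C (Comp C g' g) k = Comp C (Comp C g' l) f"
    using * eq(1) by (simp add: cat_simps)
  also have "\<dots> = Comp C l' (Comp C f' f)"
    using * eq(2) by (simp add: cat_simps)
  finally show "commutative_square C (Comp C f' f, k, l', Comp C g' g)"
    using * by (simp add: commutative_square_def hom_def cat_simps)
qed

lemma pullback_squareI:
  assumes "commutative_square C (f, k, l, g)"
    and "\<And>x a b. a \<in> hom C x (Dom C g) \<Longrightarrow> b \<in> hom C x (Cod C f) \<Longrightarrow> Comp C g a = Comp C l b \<Longrightarrow>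
      \<exists>h. h \<in> hom C x (Dom C f) \<and> Comp C k h = a \<and> Comp C f h = b"
    and "\<And>x h h'. h \<in> hom C x (Dom C f) \<Longrightarrow> h' \<in> hom C x (Dom C f) \<Longrightarrow>
      Comp C k h = Comp C k h' \<Longrightarrow> Comp C f h = Comp C f h' \<Longrightarrow> h = h'"
  shows "pullback_square C (f, k, l, g)"
  unfolding pullback_square_def split
proof (intro conjI ballI impI assms(1))
  fix x a b assume "a \<in> hom C x (Dom C g)" "b \<in> hom C x (Cod C f)" "Comp C g a = Comp C l b"
  from assms(2)[OF this] obtain h
    where "h \<in> hom C x (Dom C f) \<and> Comp C k h = a \<and> Comp C f h = b" by blast
  then show "\<exists>!h. h \<in> hom C x (Dom C f) \<and> Comp C k h = a \<and> Comp C f h = b"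
    using assms(3) by (intro ex1I[of _ h]) auto
qed

lemma pullback_squareD:
  assumes "pullback_square C (f, k, l, g)"
  shows "f \<in> hom C (Dom C f) (Cod C f)" "g \<in> hom C (Dom C g) (Cod C g)"
    "k \<in> hom C (Dom C f) (Dom C g)" "l \<in> hom C (Cod C f) (Cod C g)" "Comp C g k = Comp C l f"
  using assms by (auto simp: pullback_square_def commutative_square_def Arr_hom)

lemma pullback_square_lift:
  assumes "pullback_square C (f, k, l, g)" "a \<in> hom C x (Dom C g)" "b \<in> hom C x (Cod C f)"
    "Comp C g a = Comp C l b"
  obtains h where "h \<in> hom C x (Dom C f)" "Comp C k h = a" "Comp C f h = b"
  using assms hom_Obj(1)[OF assms(2)] unfolding pullback_square_def by blast

lemma pullback_square_ext:
  assumes pb: "pullback_square C (f, k, l, g)" and h: "h \<in> hom C x (Dom C f)" "h' \<in> hom C x (Dom C f)"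
    and eq: "Comp C k h = Comp C k h'" "Comp C f h = Comp C f h'"
  shows "h = h'"
proof -
  note p = pullback_squareD[OF pb]
  have "Comp C g (Comp C k h) = Comp C l (Comp C f h)"
    using Comp_assoc[OF h(1) p(3,2)] Comp_assoc[OF h(1) p(1,4)] p(5) by simp
  then have "\<exists>!m. m \<in> hom C x (Dom C f) \<and> Comp C k m = Comp C k h \<and> Comp C f m = Comp C f h"
    using pb hom_Obj(1)[OF h(1)] Comp_hom[OF h(1) p(3)] Comp_hom[OF h(1) p(1)]
    unfolding pullback_square_def by simp
  then show ?thesis using h eq by (elim ex1E) metis
qed

text \<open>Closure under the two compositions is the pasting of pullback squares: a cone over the
  composite is lifted through the second square, and the result through the first.\<close>

lemma square_class_pullback: "square_class C {q. pullback_square C q}"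
proof (rule square_class.intro[OF category_axioms square_class_axioms.intro]; (simp only: mem_Collect_eq)?)
  interpret S: square_class C "{q. commutative_square C q}"
    by (rule square_class_commutative)
  show "commutative_square C q" if "pullback_square C q" for q
    using that by (auto simp: pullback_square_def)
  show "pullback_square C (f, Ident C (Dom C f), Ident C (Cod C f), f)" if f: "f \<in> Arr C" for f
  proof (rule pullback_squareI)
    show "commutative_square C (f, Ident C (Dom C f), Ident C (Cod C f), f)"
      using S.horizontal_identity[OF f] by simp
    show "\<exists>h. h \<in> hom C x (Dom C f) \<and> Comp C (Ident C (Dom C f)) h = a \<and> Comp C f h = b"
      if "a \<in> hom C x (Dom C f)" "b \<in> hom C x (Cod C f)" "Comp C f a = Comp C (Ident C (Cod C f)) b"
      for x a b using that Ident_Comp[OF that(1)] Ident_Comp[OF that(2)] by auto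
  qed (simp add: Ident_Comp)
  show "pullback_square C (Ident C (Dom C k), k, k, Ident C (Cod C k))" if k: "k \<in> Arr C" for k
  proof (rule pullback_squareI)
    show "commutative_square C (Ident C (Dom C k), k, k, Ident C (Cod C k))"
      using S.vertical_identity[OF k] by simp
    have o: "Dom C k \<in> Obj C" "Cod C k \<in> Obj C" using k Dom_Obj Cod_Obj by auto
    note i = Arr_Ident[OF o(1)] Arr_Ident[OF o(2)]
    show "\<exists>h. h \<in> hom C x (Dom C (Ident C (Dom C k))) \<and> Comp C k h = a \<and>
        Comp C (Ident C (Dom C k)) h = b"
      if "a \<in> hom C x (Dom C (Ident C (Cod C k)))" "b \<in> hom C x (Cod C (Ident C (Dom C k)))"
        "Comp C (Ident C (Cod C k)) a = Comp C k b" for x a b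
      using that unfolding i by (intro exI[of _ b]) (simp add: Ident_Comp)
    show "h = h'" if "h \<in> hom C x (Dom C (Ident C (Dom C k)))"
        "h' \<in> hom C x (Dom C (Ident C (Dom C k)))"
        "Comp C (Ident C (Dom C k)) h = Comp C (Ident C (Dom C k)) h'" for x h h'
      using that unfolding i by (simp add: Ident_Comp)
  qed
next
  interpret S: square_class C "{q. commutative_square C q}"
    by (rule square_class_commutative)
  fix f k l g k' l' h
  assume 1: "pullback_square C (f, k, l, g)" and 2: "pullback_square C (g, k', l', h)"
  note p = pullback_squareD[OF 1] and q = pullback_squareD[OF 2]
  show "pullback_square C (f, Comp C k' k, Comp C l' l, h)"
  proof (rule pullback_squareI)
    show "commutative_square C (f, Comp C k' k, Comp C l' l, h)"
      using 1 2 S.horizontal_comp[of f k l g k' l' h] by (simp add: pullback_square_def)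
    fix x a b assume a: "a \<in> hom C x (Dom C h)" and b: "b \<in> hom C x (Cod C f)"
      and eq: "Comp C h a = Comp C (Comp C l' l) b"
    have "Comp C h a = Comp C l' (Comp C l b)"
      using eq Comp_assoc[OF b p(4) q(4)] by simp
    from pullback_square_lift[OF 2 a Comp_hom[OF b p(4)] this] obtain m
      where m: "m \<in> hom C x (Dom C g)" "Comp C k' m = a" "Comp C g m = Comp C l b" .
    from pullback_square_lift[OF 1 m(1) b m(3)] obtain n
      where n: "n \<in> hom C x (Dom C f)" "Comp C k n = m" "Comp C f n = b" .
    then have "Comp C (Comp C k' k) n = a"
      using Comp_assoc[OF n(1) p(3) q(3)] m by simp
    then show "\<exists>n. n \<in> hom C x (Dom C f) \<and> Comp C (Comp C k' k) n = a \<and> Comp C f n = b"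
      using n by blast
  next
    fix x n n' assume n: "n \<in> hom C x (Dom C f)" "n' \<in> hom C x (Dom C f)"
      and eq: "Comp C (Comp C k' k) n = Comp C (Comp C k' k) n'" "Comp C f n = Comp C f n'"
    \<comment> \<open>Cancelling in the second square also requires equality after \<open>g\<close>;
      it follows from equality after \<open>f\<close>, since the first square commutes.\<close>
    have "Comp C k n = Comp C k n'"
    proof (rule pullback_square_ext[OF 2 Comp_hom[OF n(1) p(3)] Comp_hom[OF n(2) p(3)]])
      show "Comp C k' (Comp C k n) = Comp C k' (Comp C k n')"
        using eq(1) Comp_assoc[OF n(1) p(3) q(3)] Comp_assoc[OF n(2) p(3) q(3)] by simp
      show "Comp C g (Comp C k n) = Comp C g (Comp C k n')"
        using Comp_assoc[OF n(1) p(3) p(2)] Comp_assoc[OF n(2) p(3) p(2)] p(5) eq(2)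
          Comp_assoc[OF n(1) p(1) p(4)] Comp_assoc[OF n(2) p(1) p(4)] by simp
    qed
    then show "n = n'" using pullback_square_ext[OF 1 n] eq(2) by blast
  qed
next
  interpret S: square_class C "{q. commutative_square C q}"
    by (rule square_class_commutative)
  fix f k l g f' l' g'
  assume 1: "pullback_square C (f, k, l, g)" and 2: "pullback_square C (f', l, l', g')"
  note p = pullback_squareD[OF 1] and q = pullback_squareD[OF 2]
  have d: "Cod C f = Dom C f'" "Cod C g = Dom C g'"
    using homD(2,3)[OF p(4)] homD(2,3)[OF q(3)] by auto
  note p' = p[unfolded d]
  have D: "Dom C (Comp C f' f) = Dom C f" "Dom C (Comp C g' g) = Dom C g"
     "Cod C (Comp C f' f) = Cod C f'"
    using homD[OF Comp_hom[OF p'(1) q(1)]] homD[OF Comp_hom[OF p'(2) q(2)]] by auto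
  show "pullback_square C (Comp C f' f, k, l', Comp C g' g)"
  proof (rule pullback_squareI; (simp only: D)?)
    show "commutative_square C (Comp C f' f, k, l', Comp C g' g)"
      using 1 2 S.vertical_comp[of f k l g f' l' g'] by (simp add: pullback_square_def)
    fix x a b assume a: "a \<in> hom C x (Dom C g)" and b: "b \<in> hom C x (Cod C f')"
      and eq: "Comp C (Comp C g' g) a = Comp C l' b"
    have "Comp C g' (Comp C g a) = Comp C l' b"
      using eq Comp_assoc[OF a p'(2) q(2)] by simp
    from pullback_square_lift[OF 2 Comp_hom[OF a p'(2)] b this] obtain m
      where m: "m \<in> hom C x (Dom C f')" "Comp C l m = Comp C g a" "Comp C f' m = b" .
    have "m \<in> hom C x (Cod C f)" using m(1) d by simp
    from pullback_square_lift[OF 1 a this] m(2) obtain n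
      where n: "n \<in> hom C x (Dom C f)" "Comp C k n = a" "Comp C f n = m" by auto
    then have "Comp C (Comp C f' f) n = b"
      using Comp_assoc[OF n(1) p'(1) q(1)] m by simp
    then show "\<exists>n. n \<in> hom C x (Dom C f) \<and> Comp C k n = a \<and> Comp C (Comp C f' f) n = b"
      using n by blast
  next
    fix x n n' assume n: "n \<in> hom C x (Dom C f)" "n' \<in> hom C x (Dom C f)"
      and eq: "Comp C k n = Comp C k n'" "Comp C (Comp C f' f) n = Comp C (Comp C f' f) n'"
    have "Comp C f n = Comp C f n'"
    proof (rule pullback_square_ext[OF 2 Comp_hom[OF n(1) p'(1)] Comp_hom[OF n(2) p'(1)]])
      show "Comp C f' (Comp C f n) = Comp C f' (Comp C f n')"
        using eq(2) Comp_assoc[OF n(1) p'(1) q(1)] Comp_assoc[OF n(2) p'(1) q(1)] by simp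
      show "Comp C l (Comp C f n) = Comp C l (Comp C f n')"
        using Comp_assoc[OF n(1) p(1,4)] Comp_assoc[OF n(2) p(1,4)] p(5) eq(1)
          Comp_assoc[OF n(1) p(3,2)] Comp_assoc[OF n(2) p(3,2)] by simp
    qed
    then show "n = n'" using pullback_square_ext[OF 1 n] eq(1) by blast
  qed
qed

end

section \<open>Finite sets\<close>

definition fn :: "'a fmap \<Rightarrow> 'a \<Rightarrow> 'a" where
  "fn f = fst (snd f)"

definition mk_fmap :: "'a set \<Rightarrow> ('a \<Rightarrow> 'a) \<Rightarrow> 'a set \<Rightarrow> 'a fmap" where
  "mk_fmap A h B = (A, restrict h A, B)"

lemma Setf_homE:
  assumes "f \<in> hom Setf A B"
  obtains h where "finite A" "finite B" "h \<in> A \<rightarrow>\<^sub>E B" "f = (A, h, B)"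
  using assms by (cases f) (auto simp: Setf_def hom_def)

lemma fn_in: "f \<in> hom Setf A B \<Longrightarrow> x \<in> A \<Longrightarrow> fn f x \<in> B"
  by (elim Setf_homE) (auto simp: fn_def)

lemma Setf_finite: "f \<in> hom Setf A B \<Longrightarrow> finite A" "f \<in> hom Setf A B \<Longrightarrow> finite B"
  by (auto elim: Setf_homE)

lemma Setf_ext:
  assumes "f \<in> hom Setf A B" "g \<in> hom Setf A B" "\<And>x. x \<in> A \<Longrightarrow> fn f x = fn g x"
  shows "f = g"
  using assms by (elim Setf_homE) (auto simp: fn_def intro: PiE_ext)

lemma mk_fmap_hom: "finite A \<Longrightarrow> finite B \<Longrightarrow> (\<And>x. x \<in> A \<Longrightarrow> h x \<in> B) \<Longrightarrow> mk_fmap A h B \<in> hom Setf A B"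
  by (auto simp: mk_fmap_def hom_def Setf_def)

lemma fn_mk_fmap [simp]: "x \<in> A \<Longrightarrow> fn (mk_fmap A h B) x = h x"
  by (simp add: mk_fmap_def fn_def)

lemma const_map_eq: "const_map A b B = mk_fmap A (\<lambda>_. b) B"
  by (simp add: const_map_def mk_fmap_def)

lemma fn_Comp: "f \<in> hom Setf A B \<Longrightarrow> x \<in> A \<Longrightarrow> fn (Comp Setf g f) x = fn g (fn f x)"
  by (elim Setf_homE, cases g) (auto simp: fn_def Setf_def compose_def)

lemma fn_Ident: "x \<in> A \<Longrightarrow> fn (Ident Setf A) x = x"
  by (simp add: fn_def Setf_def)

lemma Setf_Obj [simp]: "Obj Setf = {A. finite A}"
  by (simp add: Setf_def)

lemma Setf_Comp_hom:
  assumes "f \<in> hom Setf A B" "g \<in> hom Setf B C"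
  shows "Comp Setf g f \<in> hom Setf A C"
  using assms by (elim Setf_homE) (auto simp: Setf_def hom_def compose_def)

lemma Setf_Ident_hom: "finite A \<Longrightarrow> Ident Setf A \<in> hom Setf A A"
  by (auto simp: Setf_def hom_def)

lemma category_Setf: "category Setf"
proof (rule category.intro)
  fix f :: "'a fmap" and A B
  assume f: "f \<in> hom Setf A B"
  note c = Setf_Comp_hom
  show "Comp Setf f (Ident Setf A) = f"
    using f Setf_Ident_hom[OF Setf_finite(1)[OF f]]
    by (intro Setf_ext[OF c f]) (auto simp: fn_Comp fn_Ident)
  show "Comp Setf (Ident Setf B) f = f"
    using f Setf_Ident_hom[OF Setf_finite(2)[OF f]] fn_in[OF f]
    by (intro Setf_ext[OF c f]) (auto simp: fn_Comp fn_Ident)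
  fix g h :: "'a fmap" and C D
  assume g: "g \<in> hom Setf B C" and h: "h \<in> hom Setf C D"
  show "Comp Setf h (Comp Setf g f) = Comp Setf (Comp Setf h g) f"
    using fn_in[OF f]
    by (intro Setf_ext[OF c[OF c[OF f g] h] c[OF f c[OF g h]]])
      (simp add: fn_Comp[OF c[OF f g]] fn_Comp[OF f] fn_Comp[OF g])
qed (auto simp: Setf_Comp_hom Setf_Ident_hom; auto simp: Setf_def)+

interpretation Setf: category Setf
  by (rule category_Setf)

interpretation op_Setf: category "op_cat Setf"
  by (rule category_op[OF category_Setf])

lemma Setf_eqD: "f = g \<Longrightarrow> fn f x = fn g x"
  by simp

text \<open>Elements are mappings from a singleton. Tested on these, uniqueness of lifts is
  injectivity of \<open>k\<close> on each fibre, and existence is surjectivity onto the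
  corresponding fibre of \<open>g\<close>. The singletons \<open>{i}\<close> and \<open>{x}\<close>
  are taken inside the sets at hand.\<close>

lemma pullback_square_Setf_iff:
  assumes f: "f \<in> hom Setf I J" and g: "g \<in> hom Setf L K"
    and k: "k \<in> hom Setf I L" and l: "l \<in> hom Setf J K"
  shows "pullback_square Setf (f, k, l, g) \<longleftrightarrow> Comp Setf g k = Comp Setf l f \<and>
    (\<forall>j\<in>J. bij_betw (fn k) {i \<in> I. fn f i = j} {x \<in> L. fn g x = fn l j})"
    (is "_ \<longleftrightarrow> ?comm \<and> ?bij")
proof
  note dc = homD(2,3)[OF f] homD(2,3)[OF g]
  note fin = Setf_finite[OF f] Setf_finite(1)[OF g]
  assume pb: "pullback_square Setf (f, k, l, g)"
  then have comm: ?comm by (rule Setf.pullback_squareD(5))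
  have gk: "fn g (fn k i) = fn l (fn f i)" if "i \<in> I" for i
    using Setf_eqD[OF comm, of i] fn_Comp[OF k that] fn_Comp[OF f that] by simp
  have "bij_betw (fn k) {i \<in> I. fn f i = j} {x \<in> L. fn g x = fn l j}" if j: "j \<in> J" for j
  proof (rule bij_betw_imageI)
    show "inj_on (fn k) {i \<in> I. fn f i = j}"
    proof (rule inj_onI; clarify)
      fix i i' assume i: "i \<in> I" "i' \<in> I" and eq: "fn k i = fn k i'" "fn f i' = fn f i"
      define p q where "p = mk_fmap {i} (\<lambda>_. i) I" and "q = mk_fmap {i} (\<lambda>_. i') I"
      have pq: "p \<in> hom Setf {i} I" "q \<in> hom Setf {i} I"
        unfolding p_def q_def using i fin by (auto intro!: mk_fmap_hom)
      have "p = q"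
      proof (rule Setf.pullback_square_ext[OF pb, unfolded dc, OF pq])
        show "Comp Setf k p = Comp Setf k q"
          by (rule Setf_ext[OF Setf_Comp_hom[OF pq(1) k] Setf_Comp_hom[OF pq(2) k]])
            (simp add: fn_Comp[OF pq(1)] fn_Comp[OF pq(2)], simp add: p_def q_def eq)
        show "Comp Setf f p = Comp Setf f q"
          by (rule Setf_ext[OF Setf_Comp_hom[OF pq(1) f] Setf_Comp_hom[OF pq(2) f]])
            (simp add: fn_Comp[OF pq(1)] fn_Comp[OF pq(2)], simp add: p_def q_def eq)
      qed
      from Setf_eqD[OF this, of i] show "i = i'" by (simp add: p_def q_def)
    qed
    show "fn k ` {i \<in> I. fn f i = j} = {x \<in> L. fn g x = fn l j}"
    proof (intro equalityI subsetI)
      fix x assume x: "x \<in> {x \<in> L. fn g x = fn l j}"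
      define p q where "p = mk_fmap {x} (\<lambda>_. x) L" and "q = mk_fmap {x} (\<lambda>_. j) J"
      have p: "p \<in> hom Setf {x} L" and q: "q \<in> hom Setf {x} J"
        unfolding p_def q_def using x j fin by (auto intro!: mk_fmap_hom)
      have "Comp Setf g p = Comp Setf l q"
        by (rule Setf_ext[OF Setf_Comp_hom[OF p g] Setf_Comp_hom[OF q l]])
          (simp add: fn_Comp[OF p] fn_Comp[OF q], use x in \<open>simp add: p_def q_def\<close>)
      from Setf.pullback_square_lift[OF pb, unfolded dc, OF p q this]
      obtain h where h: "h \<in> hom Setf {x} I" "Comp Setf k h = p" "Comp Setf f h = q" .
      have "fn k (fn h x) = x" "fn f (fn h x) = j"
        using Setf_eqD[OF h(2), of x] Setf_eqD[OF h(3), of x] fn_Comp[OF h(1), of x]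
        by (simp_all add: p_def q_def)
      then show "x \<in> fn k ` {i \<in> I. fn f i = j}"
        using fn_in[OF h(1), of x] by (intro image_eqI[of _ _ "fn h x"]) simp_all
    qed (use gk fn_in[OF k] in auto)
  qed
  then show "?comm \<and> ?bij" using comm by blast
next
  note dc = homD(2,3)[OF f] homD(2,3)[OF g]
  assume "?comm \<and> ?bij"
  then have comm: ?comm and bij: ?bij by auto
  show "pullback_square Setf (f, k, l, g)"
  proof (rule Setf.pullback_squareI; (simp only: dc)?)
    show "commutative_square Setf (f, k, l, g)"
      using comm k l homD[OF f] homD[OF g] by (simp add: commutative_square_def)
    fix x a b assume a: "a \<in> hom Setf x L" and b: "b \<in> hom Setf x J"
      and eq: "Comp Setf g a = Comp Setf l b"
    \<comment> \<open>For each \<open>t\<close> the compatible pair of values of \<open>a\<close>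
      and \<open>b\<close> has a preimage in the fibre of \<open>f\<close> over
      \<open>fn b t\<close>, by surjectivity of \<open>k\<close> on that fibre.\<close>
    define h where "h = (\<lambda>t. SOME i. i \<in> I \<and> fn f i = fn b t \<and> fn k i = fn a t)"
    have h: "h t \<in> I \<and> fn f (h t) = fn b t \<and> fn k (h t) = fn a t" if t: "t \<in> x" for t
    proof -
      have "fn g (fn a t) = fn l (fn b t)"
        using Setf_eqD[OF eq, of t] fn_Comp[OF a t] fn_Comp[OF b t] by simp
      then have "fn a t \<in> {y \<in> L. fn g y = fn l (fn b t)}" using fn_in[OF a t] by simp
      also have "\<dots> = fn k ` {i \<in> I. fn f i = fn b t}"
        using bij fn_in[OF b t] by (simp add: bij_betw_def)
      finally have "\<exists>i. i \<in> I \<and> fn f i = fn b t \<and> fn k i = fn a t" by auto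
      then show ?thesis unfolding h_def by (rule someI_ex)
    qed
    have m: "mk_fmap x h I \<in> hom Setf x I"
      using h by (intro mk_fmap_hom[OF Setf_finite(1)[OF a] Setf_finite(1)[OF f]]) simp
    have "Comp Setf k (mk_fmap x h I) = a"
      by (rule Setf_ext[OF Setf_Comp_hom[OF m k] a]) (simp add: fn_Comp[OF m] h)
    moreover have "Comp Setf f (mk_fmap x h I) = b"
      by (rule Setf_ext[OF Setf_Comp_hom[OF m f] b]) (simp add: fn_Comp[OF m] h)
    ultimately show "\<exists>h. h \<in> hom Setf x I \<and> Comp Setf k h = a \<and> Comp Setf f h = b"
      using m by blast
  next
    fix x h h' assume h: "h \<in> hom Setf x I" "h' \<in> hom Setf x I"
      and eq: "Comp Setf k h = Comp Setf k h'" "Comp Setf f h = Comp Setf f h'"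
    show "h = h'"
    proof (rule Setf_ext[OF h])
      fix t assume t: "t \<in> x"
      have e: "fn k (fn h t) = fn k (fn h' t)" "fn f (fn h t) = fn f (fn h' t)"
        using Setf_eqD[OF eq(1), of t] Setf_eqD[OF eq(2), of t] fn_Comp[OF h(1) t] fn_Comp[OF h(2) t]
        by simp_all
      note i = fn_in[OF h(1) t] fn_in[OF h(2) t]
      then have "inj_on (fn k) {i \<in> I. fn f i = fn f (fn h t)}"
        using bij fn_in[OF f] by (simp add: bij_betw_def)
      from inj_onD[OF this e(1)] show "fn h t = fn h' t" using i e(2) by simp
    qed
  qed
qed

text \<open>Coproduct cocones of finite sets, described by elements. \<open>Sigma I A\<close> itself
  cannot be the coproduct, since its elements have a different type; it is only required to be in
  bijection with \<open>P\<close>.\<close>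

definition disjoint_union :: "'i set \<Rightarrow> ('i \<Rightarrow> 'a set) \<Rightarrow> 'a set \<Rightarrow> ('i \<Rightarrow> 'a fmap) \<Rightarrow> bool" where
  "disjoint_union I A P \<iota> \<longleftrightarrow> finite P \<and> (\<forall>i\<in>I. \<iota> i \<in> hom Setf (A i) P) \<and>
     bij_betw (\<lambda>(i, x). fn (\<iota> i) x) (Sigma I A) P"

lemma disjoint_unionD:
  assumes "disjoint_union I A P \<iota>"
  shows "finite P" "i \<in> I \<Longrightarrow> \<iota> i \<in> hom Setf (A i) P"
    "i \<in> I \<Longrightarrow> j \<in> I \<Longrightarrow> x \<in> A i \<Longrightarrow> y \<in> A j \<Longrightarrow> fn (\<iota> i) x = fn (\<iota> j) y \<Longrightarrow> i = j \<and> x = y"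
    "p \<in> P \<Longrightarrow> \<exists>i\<in>I. \<exists>x\<in>A i. p = fn (\<iota> i) x"
proof -
  show "finite P" "i \<in> I \<Longrightarrow> \<iota> i \<in> hom Setf (A i) P"
    using assms by (auto simp: disjoint_union_def)
  have b: "bij_betw (\<lambda>(i, x). fn (\<iota> i) x) (Sigma I A) P"
    using assms by (simp add: disjoint_union_def)
  show "i = j \<and> x = y" if "i \<in> I" "j \<in> I" "x \<in> A i" "y \<in> A j" "fn (\<iota> i) x = fn (\<iota> j) y"
    using inj_onD[OF bij_betw_imp_inj_on[OF b], of "(i, x)" "(j, y)"] that by simp
  show "\<exists>i\<in>I. \<exists>x\<in>A i. p = fn (\<iota> i) x" if "p \<in> P"
    using that bij_betw_imp_surj_on[OF b] by force
qed

lemma disjoint_unionI: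
  assumes "finite P" "\<And>i. i \<in> I \<Longrightarrow> \<iota> i \<in> hom Setf (A i) P"
    "\<And>i j x y. i \<in> I \<Longrightarrow> j \<in> I \<Longrightarrow> x \<in> A i \<Longrightarrow> y \<in> A j \<Longrightarrow> fn (\<iota> i) x = fn (\<iota> j) y \<Longrightarrow> i = j \<and> x = y"
    "\<And>p. p \<in> P \<Longrightarrow> \<exists>i\<in>I. \<exists>x\<in>A i. p = fn (\<iota> i) x"
  shows "disjoint_union I A P \<iota>"
  unfolding disjoint_union_def
proof (intro conjI ballI bij_betw_imageI)
  show "inj_on (\<lambda>(i, x). fn (\<iota> i) x) (Sigma I A)"
    using assms(3) by (auto simp: inj_on_def)
  show "(\<lambda>(i, x). fn (\<iota> i) x) ` Sigma I A = P"
    using assms(4) fn_in[OF assms(2)] by (auto simp: image_iff)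
qed (use assms in auto)

text \<open>An infinite type contains a finite set of the cardinality of \<open>Sigma I A\<close>,
  and any bijection carries the injections over to it.\<close>

lemma disjoint_union_exists:
  assumes "infinite (UNIV :: 'a set)" "finite I" "\<And>i. i \<in> I \<Longrightarrow> finite (A i)"
  obtains P and \<iota> :: "'i \<Rightarrow> 'a fmap" where "disjoint_union I A P \<iota>"
proof -
  have "finite (Sigma I A)" using assms by auto
  moreover obtain P :: "'a set" where P: "finite P" "card P = card (Sigma I A)"
    using infinite_arbitrarily_large[OF assms(1)] by blast
  ultimately obtain e where e: "bij_betw e (Sigma I A) P"
    using finite_same_card_bij by metis
  define \<iota> where "\<iota> i = mk_fmap (A i) (\<lambda>x. e (i, x)) P" for i
  have "disjoint_union I A P \<iota>"
    unfolding disjoint_union_def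
  proof (intro conjI ballI)
    show "\<iota> i \<in> hom Setf (A i) P" if "i \<in> I" for i
      unfolding \<iota>_def using e assms(3)[OF that] P that bij_betwE by (intro mk_fmap_hom) fastforce+
    show "bij_betw (\<lambda>(i, x). fn (\<iota> i) x) (Sigma I A) P"
      using e by (rule iffD1[OF bij_betw_cong, rotated]) (auto simp: \<iota>_def)
  qed fact
  then show ?thesis by (rule that)
qed

lemma product_cone_disjoint_union:
  assumes "disjoint_union I A P \<iota>"
  shows "product_cone (op_cat Setf) I A P \<iota>"
proof (rule product_coneI; (simp only: op_cat_simps)?)
  note d = disjoint_unionD[OF assms]
  show "P \<in> Obj Setf" "\<And>i. i \<in> I \<Longrightarrow> \<iota> i \<in> hom Setf (A i) P"
    using d by auto
  fix B f assume B: "B \<in> Obj Setf" and f: "\<And>i. i \<in> I \<Longrightarrow> f i \<in> hom Setf (A i) B"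
  \<comment> \<open>The cotuple of the \<open>f i\<close>. It is well defined because an element of
    \<open>P\<close> comes from only one pair of an index and an element.\<close>
  define h where "h p = (SOME y. \<exists>i\<in>I. \<exists>x\<in>A i. p = fn (\<iota> i) x \<and> y = fn (f i) x)" for p
  have h: "h (fn (\<iota> i) x) = fn (f i) x" if "i \<in> I" "x \<in> A i" for i x
    unfolding h_def by (rule some_equality) (use that d(3) in blast)+
  have m: "mk_fmap P h B \<in> hom Setf P B"
  proof (rule mk_fmap_hom)
    show "h p \<in> B" if "p \<in> P" for p
      using d(4)[OF that] h fn_in[OF f] by auto
  qed (use d B in auto)
  have "Comp Setf (mk_fmap P h B) (\<iota> i) = f i" if i: "i \<in> I" for i
    by (rule Setf_ext[OF Setf_Comp_hom[OF d(2)[OF i] m] f[OF i]])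
      (simp add: fn_Comp[OF d(2)[OF i]] fn_in[OF d(2)[OF i]] h[OF i])
  then show "\<exists>h. h \<in> hom Setf P B \<and> (\<forall>i\<in>I. Comp Setf h (\<iota> i) = f i)"
    using m by blast
next
  note d = disjoint_unionD[OF assms]
  fix B h k assume h: "h \<in> hom Setf P B" and k: "k \<in> hom Setf P B"
    and eq: "\<And>i. i \<in> I \<Longrightarrow> Comp Setf h (\<iota> i) = Comp Setf k (\<iota> i)"
  show "h = k"
  proof (rule Setf_ext[OF h k])
    fix p assume "p \<in> P"
    then obtain i x where "i \<in> I" "x \<in> A i" "p = fn (\<iota> i) x" using d(4) by blast
    then show "fn h p = fn k p"
      using Setf_eqD[OF eq[of i], of x] fn_Comp[OF d(2)] by simp
  qed
qed

text \<open>This is extensivity: the summands of \<open>R\<close> are disjoint, so an element of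
  \<open>P\<close> lying over the \<open>i\<close>-th summand can only come from the
  \<open>i\<close>-th summand of \<open>P\<close>.\<close>

lemma pullback_square_disjoint_union:
  assumes \<iota>: "disjoint_union I A P \<iota>" and \<kappa>: "disjoint_union I B R \<kappa>"
    and X: "\<And>i. i \<in> I \<Longrightarrow> X i \<in> hom Setf (A i) (B i)" and f: "f \<in> hom Setf P R"
    and comm: "\<And>i. i \<in> I \<Longrightarrow> Comp Setf f (\<iota> i) = Comp Setf (\<kappa> i) (X i)"
    and i: "i \<in> I"
  shows "pullback_square Setf (X i, \<iota> i, \<kappa> i, f)"
proof (subst pullback_square_Setf_iff[OF X[OF i] f disjoint_unionD(2)[OF \<iota> i] disjoint_unionD(2)[OF \<kappa> i]],
    intro conjI ballI comm[OF i])
  note d = disjoint_unionD[OF \<iota>] and e = disjoint_unionD[OF \<kappa>]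
  have f\<iota>: "fn f (fn (\<iota> j) x) = fn (\<kappa> j) (fn (X j) x)" if "j \<in> I" "x \<in> A j" for j x
    using Setf_eqD[OF comm[OF that(1)], of x] fn_Comp[OF d(2)[OF that(1)] that(2)]
      fn_Comp[OF X[OF that(1)] that(2)] by simp
  fix y assume y: "y \<in> B i"
  show "bij_betw (fn (\<iota> i)) {x \<in> A i. fn (X i) x = y} {p \<in> P. fn f p = fn (\<kappa> i) y}"
  proof (rule bij_betw_imageI)
    show "inj_on (fn (\<iota> i)) {x \<in> A i. fn (X i) x = y}"
      using d(3)[OF i i] by (auto simp: inj_on_def)
    show "fn (\<iota> i) ` {x \<in> A i. fn (X i) x = y} = {p \<in> P. fn f p = fn (\<kappa> i) y}"
    proof (intro equalityI subsetI)
      fix p assume p: "p \<in> {p \<in> P. fn f p = fn (\<kappa> i) y}"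
      then obtain j x where j: "j \<in> I" "x \<in> A j" "p = fn (\<iota> j) x" using d(4) by blast
      then have "fn (\<kappa> j) (fn (X j) x) = fn (\<kappa> i) y" using p f\<iota> by simp
      from e(3)[OF j(1) i fn_in[OF X[OF j(1)] j(2)] y this]
      show "p \<in> fn (\<iota> i) ` {x \<in> A i. fn (X i) x = y}" using j by auto
    qed (use f\<iota>[OF i] fn_in[OF d(2)[OF i]] in auto)
  qed
qed

interpretation Pb: square_class Setf "{q. pullback_square Setf q}"
  by (rule Setf.square_class_pullback)

text \<open>By extensivity, vertical arrows and pullback squares have coproducts, formed componentwise.\<close>

lemma product_cone_pullback_squares:
  assumes \<iota>: "disjoint_union I A P \<iota>" and \<kappa>: "disjoint_union I B R \<kappa>"
    and X: "\<And>i. i \<in> I \<Longrightarrow> X i \<in> hom Setf (A i) (B i)" and f: "f \<in> hom Setf P R"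
    and comm: "\<And>i. i \<in> I \<Longrightarrow> Comp Setf f (\<iota> i) = Comp Setf (\<kappa> i) (X i)"
  shows "product_cone (op_cat (VC (Pb Setf))) I X f (\<lambda>i. (X i, \<iota> i, \<kappa> i, f))"
  unfolding Pb_def
proof (rule product_coneI; (simp only: op_cat_simps)?)
  have pb: "pullback_square Setf (X i, \<iota> i, \<kappa> i, f)" if "i \<in> I" for i
    by (rule pullback_square_disjoint_union[OF \<iota> \<kappa> X f comm that])
  note d = disjoint_unionD[OF \<iota>] and e = disjoint_unionD[OF \<kappa>]
  note p = product_cone_disjoint_union[OF \<iota>] and r = product_cone_disjoint_union[OF \<kappa>]
  show "f \<in> Obj (VC (squares Setf {q. pullback_square Setf q}))"
    using homD(1)[OF f] by (simp add: Pb.squares_simps)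
  show "(X i, \<iota> i, \<kappa> i, f) \<in> hom (VC (squares Setf {q. pullback_square Setf q})) (X i) f"
    if "i \<in> I" for i using Pb.VC_homI pb[OF that] by simp
  fix g q assume g: "g \<in> Obj (VC (squares Setf {q. pullback_square Setf q}))"
    and q_hom: "\<And>i. i \<in> I \<Longrightarrow> q i \<in> hom (VC (squares Setf {q. pullback_square Setf q})) (X i) g"
  \<comment> \<open>The top and bottom sides of the competing squares \<open>q i\<close>; the
    vertical sides \<open>X i\<close> and \<open>g\<close> are prescribed. Cotupling the
    \<open>a i\<close> and the \<open>b i\<close> gives the mediating square.\<close>
  define a b where "a i = fst (snd (q i))" and "b i = fst (snd (snd (q i)))" for i
  have q: "q i = (X i, a i, b i, g)" and q_pb: "pullback_square Setf (X i, a i, b i, g)"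
    if i: "i \<in> I" for i
  proof -
    obtain a' b' where "q i = (X i, a', b', g)" "(X i, a', b', g) \<in> {q. pullback_square Setf q}"
      using q_hom[OF i] by (rule Pb.VC_homE)
    then show "q i = (X i, a i, b i, g)" "pullback_square Setf (X i, a i, b i, g)"
      by (simp_all add: a_def b_def)
  qed
  define L K where "L = Dom Setf g" and "K = Cod Setf g"
  have gh: "g \<in> hom Setf L K" using g by (simp add: L_def K_def Pb.squares_simps Setf.Arr_hom)
  have LK: "finite L" "finite K" using Setf_finite[OF gh] by auto
  note dX = homD(2,3)[OF X]
  have a: "a i \<in> hom Setf (A i) L" and b: "b i \<in> hom Setf (B i) K"
    and ab: "Comp Setf g (a i) = Comp Setf (b i) (X i)" if "i \<in> I" for i
    using Setf.pullback_squareD[OF q_pb[OF that]] dX[OF that] by (simp_all add: L_def K_def)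
  define h k where "h = tuple (op_cat Setf) I \<iota> L P a" and "k = tuple (op_cat Setf) I \<kappa> K R b"
  have h: "h \<in> hom Setf P L" "\<And>i. i \<in> I \<Longrightarrow> Comp Setf h (\<iota> i) = a i"
    using tuple[OF p, of L a] a LK by (auto simp: h_def)
  have k: "k \<in> hom Setf R K" "\<And>i. i \<in> I \<Longrightarrow> Comp Setf k (\<kappa> i) = b i"
    using tuple[OF r, of K b] b LK by (auto simp: k_def)
  have "Comp Setf g h = Comp Setf k f"
  proof (rule product_cone_ext[OF p op_Setf.category_axioms]; (simp only: op_cat_simps)?)
    fix i assume i: "i \<in> I"
    show "Comp Setf (Comp Setf g h) (\<iota> i) = Comp Setf (Comp Setf k f) (\<iota> i)"
      using Setf.Comp_assoc[OF d(2)[OF i] h(1) gh] Setf.Comp_assoc[OF d(2)[OF i] f k(1)] h(2)[OF i]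
        ab[OF i] comm[OF i] Setf.Comp_assoc[OF X[OF i] e(2)[OF i] k(1)] k(2)[OF i] by simp
  qed (rule Setf_Comp_hom[OF h(1) gh] Setf_Comp_hom[OF f k(1)])+
  \<comment> \<open>The mediating square is a pullback because this is local on \<open>R\<close>:
    \<open>r\<close> lies in a summand \<open>i\<close>, where the fibre of \<open>f\<close> is the
    image under \<iota> of a fibre of \<open>X i\<close>, and on that fibre \<open>h\<close> acts as
    \<open>a i\<close>.\<close>
  moreover have "bij_betw (fn h) {p \<in> P. fn f p = r} {x \<in> L. fn g x = fn k r}" if rR: "r \<in> R" for r
  proof -
    obtain i y where i: "i \<in> I" and y: "y \<in> B i" "r = fn (\<kappa> i) y" using e(4)[OF rR] by blast
    have 1: "bij_betw (fn (\<iota> i)) {x \<in> A i. fn (X i) x = y} {p \<in> P. fn f p = r}"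
      using iffD1[OF pullback_square_Setf_iff[OF X[OF i] f d(2)[OF i] e(2)[OF i]] pb[OF i]] y by simp
    have bk: "fn (b i) y = fn k r"
      using Setf_eqD[OF k(2)[OF i], of y] fn_Comp[OF e(2)[OF i] y(1)] y(2) by simp
    have "bij_betw (fn (a i)) {x \<in> A i. fn (X i) x = y} {x \<in> L. fn g x = fn (b i) y}"
      using iffD1[OF pullback_square_Setf_iff[OF X[OF i] gh a[OF i] b[OF i]] q_pb[OF i]] y by simp
    note 2 = this[unfolded bk]
    have "fn (a i) x = (fn h \<circ> fn (\<iota> i)) x" if "x \<in> {x \<in> A i. fn (X i) x = y}" for x
      using Setf_eqD[OF h(2)[OF i], of x] fn_Comp[OF d(2)[OF i], of x] that by simp
    from iffD1[OF bij_betw_cong[OF this] 2] show ?thesis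
      by (rule iffD2[OF bij_betw_comp_iff[OF 1]])
  qed
  ultimately have "pullback_square Setf (f, h, k, g)"
    using pullback_square_Setf_iff[OF f gh h(1) k(1)] by blast
  then have "(f, h, k, g) \<in> hom (VC (squares Setf {q. pullback_square Setf q})) f g"
    using Pb.VC_homI by simp
  then show "\<exists>m. m \<in> hom (VC (squares Setf {q. pullback_square Setf q})) f g \<and>
      (\<forall>i\<in>I. Comp (VC (squares Setf {q. pullback_square Setf q})) m (X i, \<iota> i, \<kappa> i, f) = q i)"
    by (intro exI[of _ "(f, h, k, g)"]) (simp add: Pb.squares_simps h k q)
next
  note d = disjoint_unionD[OF \<iota>] and e = disjoint_unionD[OF \<kappa>]
  note p = product_cone_disjoint_union[OF \<iota>] and r = product_cone_disjoint_union[OF \<kappa>]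
  fix g m m' assume m_hom: "m \<in> hom (VC (squares Setf {q. pullback_square Setf q})) f g"
    "m' \<in> hom (VC (squares Setf {q. pullback_square Setf q})) f g"
    and eq: "\<And>i. i \<in> I \<Longrightarrow> Comp (VC (squares Setf {q. pullback_square Setf q})) m (X i, \<iota> i, \<kappa> i, f) =
      Comp (VC (squares Setf {q. pullback_square Setf q})) m' (X i, \<iota> i, \<kappa> i, f)"
  obtain h k where m: "m = (f, h, k, g)" and pb: "(f, h, k, g) \<in> {q. pullback_square Setf q}"
    using m_hom(1) by (rule Pb.VC_homE)
  obtain h' k' where m': "m' = (f, h', k', g)" and pb': "(f, h', k', g) \<in> {q. pullback_square Setf q}"
    using m_hom(2) by (rule Pb.VC_homE)
  note D = Setf.pullback_squareD[OF CollectD[OF pb], unfolded homD(2,3)[OF f]]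
    Setf.pullback_squareD[OF CollectD[OF pb'], unfolded homD(2,3)[OF f]]
  have "h = h'"
    by (rule product_cone_ext[OF p op_Setf.category_axioms]; (simp only: op_cat_simps)?)
      (use D eq in \<open>auto simp: Pb.squares_simps m m'\<close>)
  moreover have "k = k'"
    by (rule product_cone_ext[OF r op_Setf.category_axioms]; (simp only: op_cat_simps)?)
      (use D eq in \<open>auto simp: Pb.squares_simps m m'\<close>)
  ultimately show "m = m'" by (simp add: m m')
qed

section \<open>DF monoids on finite sets as pairs of functors\<close>

text \<open>
  An assumption of a locale cannot quantify over the type of the indices of a disjoint union;
  \<open>nat\<close> suffices, since index sets are finite.
\<close>

locale finite_set_DF = finite_product_category S for S :: "('p, 'n) cat" +
  fixes ob :: "'a set \<Rightarrow> 'p" and st sh :: "'a fmap \<Rightarrow> 'n"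
  assumes ob_Obj: "finite A \<Longrightarrow> ob A \<in> Obj S"
    and st_hom: "f \<in> hom Setf A B \<Longrightarrow> st f \<in> hom S (ob B) (ob A)"
    and sh_hom: "f \<in> hom Setf A B \<Longrightarrow> sh f \<in> hom S (ob A) (ob B)"
    and st_Ident: "finite A \<Longrightarrow> st (Ident Setf A) = Ident S (ob A)"
    and sh_Ident: "finite A \<Longrightarrow> sh (Ident Setf A) = Ident S (ob A)"
    and st_Comp: "f \<in> hom Setf A B \<Longrightarrow> g \<in> hom Setf B C \<Longrightarrow>
      st (Comp Setf g f) = Comp S (st f) (st g)"
    and sh_Comp: "f \<in> hom Setf A B \<Longrightarrow> g \<in> hom Setf B C \<Longrightarrow>
      sh (Comp Setf g f) = Comp S (sh g) (sh f)"
    and Beck_Chevalley: "pullback_square Setf (f, k, l, g) \<Longrightarrow>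
      Comp S (sh f) (st k) = Comp S (st l) (sh g)"
    and product_cone_nat: "finite (I :: nat set) \<Longrightarrow> (\<And>i. i \<in> I \<Longrightarrow> finite (X i)) \<Longrightarrow>
      disjoint_union I X P \<iota> \<Longrightarrow> product_cone S I (\<lambda>i. ob (X i)) (ob P) (\<lambda>i. st (\<iota> i))"
    and infinite_UNIV: "infinite (UNIV :: 'a set)"

section \<open>From DF monoids to pairs of functors\<close>

lemma strict_double_category_Sq: "category S \<Longrightarrow> strict_double_category (Sq S)"
  unfolding Sq_def
  by (rule square_class.strict_double_category_squares[OF category.square_class_commutative])

lemma strict_double_category_Pb: "category S \<Longrightarrow> strict_double_category (Pb S)"
  unfolding Pb_def
  by (rule square_class.strict_double_category_squares[OF category.square_class_pullback])

lemma Pb_simps: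
  "HC (Pb Setf) = Setf" "Obj (VC (Pb Setf)) = Arr Setf"
  "Arr (VC (Pb Setf)) = {q. pullback_square Setf q}"
  "Ident (VC (Pb Setf)) f = (f, Ident Setf (Dom Setf f), Ident Setf (Cod Setf f), f)"
  "Comp (VC (Pb Setf)) (f', k', l', g') (f, k, l, g) = (f, Comp Setf k' k, Comp Setf l' l, g')"
  "ObM (Src (Pb Setf)) f = Dom Setf f" "ArM (Src (Pb Setf)) (f, k, l, g) = k"
  "ObM (Tgt (Pb Setf)) f = Cod Setf f" "ArM (Tgt (Pb Setf)) (f, k, l, g) = l"
  "ObM (VId (Pb Setf)) = Ident Setf"
  "ArM (VId (Pb Setf)) k = (Ident Setf (Dom Setf k), k, k, Ident Setf (Cod Setf k))"
  "vcomp (Pb Setf) u v = Comp Setf v u"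
  "vcomp_cell (Pb Setf) (f, k, l, g) (f', k', l', g') = (Comp Setf f' f, k, l', Comp Setf g' g)"
  unfolding Pb_def by (simp_all only: Pb.squares_simps)

lemma vcomposable_op_Pb:
  "vcomposable (op_dbl (Pb Setf)) u v \<longleftrightarrow> u \<in> Arr Setf \<and> v \<in> Arr Setf \<and> Cod Setf u = Dom Setf v"
  unfolding VPairs_op op_cat_simps by (auto simp: VPairs_def Pb_simps)

text \<open>The unit and composition comparisons give the functoriality of F_!, and the image of a
  pullback square is a commutative square, which is the Beck-Chevalley equation.\<close>

lemma finite_set_DF_of_DF_monoid:
  fixes F :: "('a set, 'a fmap, 'p, 'n) df"
  assumes S: "category S" "has_finite_products S" and F: "DF_monoid Setf S F"
    and inf: "infinite (UNIV :: 'a set)"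
  shows "finite_set_DF S (DF_obj F) (DF_star F) (DF_shriek F)"
proof -
  interpret S: category S by fact
  interpret Sq: square_class S "{q. commutative_square S q}"
    by (rule S.square_class_commutative)
  interpret F: lax_double_functor "op_dbl (Pb Setf)" "Sq S" F
    using F by (simp add: DF_monoid_def)
  interpret Fh: functor_between "op_cat Setf" S "Fh F"
    using F.Fh_functor by (simp add: Pb_simps Sq_def Sq.squares_simps)
  note sq = Sq.squares_simps[folded Sq_def]
  let ?o = "DF_obj F" and ?st = "DF_star F" and ?sh = "DF_shriek F"
  have sh_hom: "?sh f \<in> hom S (?o A) (?o B)" if f: "f \<in> hom Setf A B" for f A B
  proof -
    have fo: "f \<in> Obj (VC (op_dbl (Pb Setf)))" using homD(1)[OF f] by (simp add: Pb_simps)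
    show ?thesis
      using functor_between.ObM_Obj[OF F.Fv_functor fo] F.Src_Fv[OF fo] F.Tgt_Fv[OF fo] homD(2,3)[OF f]
      by (simp add: DF_shriek_def DF_obj_def hom_def sq Pb_simps)
  qed
  show ?thesis
  proof unfold_locales
    show "has_finite_products S" "infinite (UNIV :: 'a set)" by fact+
    fix A :: "'a set" assume A: "finite A"
    then show ob: "?o A \<in> Obj S"
      using Fh.ObM_Obj by (simp add: DF_obj_def)
    show "?st (Ident Setf A) = Ident S (?o A)"
      using Fh.ArM_Ident[of A] A by (simp add: DF_star_def DF_obj_def)
    have sid: "?sh (Ident Setf A) \<in> hom S (?o A) (?o A)"
      using sh_hom[OF Setf_Ident_hom[OF A]] .
    \<comment> \<open>Both horizontal sides of this cell are identities, so its commutativity says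
      that its two vertical sides are equal.\<close>
    have "FUnit F A \<in> special (Sq S) (Ident S (?o A)) (?sh (Ident Setf A))"
      using F.FUnit_special[of A] A by (simp add: Pb_simps sq DF_obj_def DF_shriek_def)
    then obtain k l where q: "FUnit F A = (Ident S (?o A), k, l, ?sh (Ident Setf A))"
      "(Ident S (?o A), k, l, ?sh (Ident Setf A)) \<in> {q. commutative_square S q}"
      "ArM (Src (Sq S)) (FUnit F A) = Ident S (?o A)" "ArM (Tgt (Sq S)) (FUnit F A) = Ident S (?o A)"
      unfolding special_def Sq_def
      by (auto elim!: Sq.VC_homE simp: Sq.squares_simps S.Arr_Ident[OF ob])
    then have "Comp S (?sh (Ident Setf A)) (Ident S (?o A)) = Comp S (Ident S (?o A)) (Ident S (?o A))"
      using Sq.squareD(9)[OF q(2)] by (simp add: sq)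
    then show "?sh (Ident Setf A) = Ident S (?o A)"
      using S.Comp_Ident[OF sid] S.Ident_Comp[OF S.Ident_hom[OF ob]] by simp
  next
    fix f :: "'a fmap" and A B assume f: "f \<in> hom Setf A B"
    show "?st f \<in> hom S (?o B) (?o A)"
      using Fh.ArM_hom[of f B A] f by (simp add: DF_star_def DF_obj_def)
    show "?sh f \<in> hom S (?o A) (?o B)" using sh_hom[OF f] .
    fix g :: "'a fmap" and C assume g: "g \<in> hom Setf B C"
    show "?st (Comp Setf g f) = Comp S (?st f) (?st g)"
      using Fh.ArM_Comp[of g C B f A] f g by (simp add: DF_star_def)
    let ?c = "Comp S (?sh g) (?sh f)"
    have c: "?c \<in> hom S (?o A) (?o C)" using S.Comp_hom[OF sh_hom[OF f] sh_hom[OF g]] .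
    have s: "?sh (Comp Setf g f) \<in> hom S (?o A) (?o C)" using sh_hom[OF Setf_Comp_hom[OF f g]] .
    have "vcomposable (op_dbl (Pb Setf)) f g"
      unfolding vcomposable_op_Pb using homD[OF f] homD[OF g] by simp
    then have "FComp F f g \<in> special (Sq S) ?c (?sh (Comp Setf g f))"
      using F.FComp_special[of f g] by (simp add: Pb_simps sq DF_shriek_def)
    then obtain k l where q: "FComp F f g = (?c, k, l, ?sh (Comp Setf g f))"
      "(?c, k, l, ?sh (Comp Setf g f)) \<in> {q. commutative_square S q}"
      "ArM (Src (Sq S)) (FComp F f g) = Ident S (?o A)" "ArM (Tgt (Sq S)) (FComp F f g) = Ident S (?o C)"
      unfolding special_def Sq_def
      by (auto elim!: Sq.VC_homE simp: Sq.squares_simps homD[OF c])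
    then have "Comp S (?sh (Comp Setf g f)) (Ident S (?o A)) = Comp S (Ident S (?o C)) ?c"
      using Sq.squareD(9)[OF q(2)] by (simp add: sq)
    then show "?sh (Comp Setf g f) = ?c"
      using S.Comp_Ident[OF s] S.Ident_Comp[OF c] by simp
  next
    fix f k l g :: "'a fmap" assume pb: "pullback_square Setf (f, k, l, g)"
    \<comment> \<open>In the horizontal opposite the square is a cell from \<open>g\<close> to
      \<open>f\<close>, which puts F_! of \<open>g\<close> on the left of its image.\<close>
    have "(f, k, l, g) \<in> hom (VC (op_dbl (Pb Setf))) g f"
      unfolding Pb_def op_dbl_simps op_cat_simps using Pb.VC_homI pb by simp
    from functor_between.ArM_hom[OF F.Fv_functor this]
    have "ArM (Fv F) (f, k, l, g) \<in> hom (VC (squares S {q. commutative_square S q})) (?sh g) (?sh f)"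
      by (simp add: DF_shriek_def Sq_def)
    then obtain k' l' where q: "ArM (Fv F) (f, k, l, g) = (?sh g, k', l', ?sh f)"
      "(?sh g, k', l', ?sh f) \<in> {q. commutative_square S q}" by (rule Sq.VC_homE)
    have a: "(f, k, l, g) \<in> Arr (VC (op_dbl (Pb Setf)))"
      using pb by (simp add: Pb_simps)
    have "k' = ?st k" "l' = ?st l"
      using F.Src_Fv_cell[OF a] F.Tgt_Fv_cell[OF a] by (simp_all add: q(1) sq Pb_simps DF_star_def)
    then show "Comp S (?sh f) (?st k) = Comp S (?st l) (?sh g)"
      using Sq.squareD(9)[OF q(2)] by simp
  next
    fix I :: "nat set" and X P and \<iota> :: "nat \<Rightarrow> 'a fmap"
    assume "finite I" "\<And>i. i \<in> I \<Longrightarrow> finite (X i)" and d: "disjoint_union I X P \<iota>"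
    moreover have "preserves_finite_products (op_cat Setf) S (Fh F)"
      using F by (simp add: DF_monoid_def Pb_simps sq)
    ultimately show "product_cone S I (\<lambda>i. ?o (X i)) (?o P) (\<lambda>i. ?st (\<iota> i))"
      using product_cone_disjoint_union[OF d]
      unfolding preserves_finite_products_def DF_obj_def DF_star_def by simp
  qed
qed

text \<open>\<open>VC (Sq C)\<close> is the arrow category of \<open>C\<close>, where products are
  computed separately on domains and codomains; \<open>comm\<close> says that \<open>f\<close> is
  the product of the arrows \<open>X i\<close>.\<close>

lemma (in category) product_cone_commutative_squares:
  assumes A: "product_cone C I A P a" and B: "product_cone C I B R b" and f: "f \<in> hom C P R"
    and X: "\<And>i. i \<in> I \<Longrightarrow> X i \<in> hom C (A i) (B i)"
    and comm: "\<And>i. i \<in> I \<Longrightarrow> Comp C (X i) (a i) = Comp C (b i) f"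
  shows "product_cone (VC (Sq C)) I X f (\<lambda>i. (f, a i, b i, X i))"
  unfolding Sq_def
proof (rule product_coneI)
  interpret Sq: square_class C "{q. commutative_square C q}"
    by (rule square_class_commutative)
  note Ad = product_coneD[OF A] and Bd = product_coneD[OF B]
  let ?V = "VC (squares C {q. commutative_square C q})"
  show "f \<in> Obj ?V" using homD(1)[OF f] by (simp add: Sq.squares_simps)
  show "(f, a i, b i, X i) \<in> hom ?V f (X i)" if i: "i \<in> I" for i
    by (rule Sq.VC_homI)
      (use Ad(2)[OF i] Bd(2)[OF i] homD[OF f] homD[OF X[OF i]] comm[OF i] in
        \<open>simp add: commutative_square_def\<close>)
  show "\<exists>m. m \<in> hom ?V g f \<and> (\<forall>i\<in>I. Comp ?V (f, a i, b i, X i) m = q i)"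
    if g: "g \<in> Obj ?V" and q_hom: "\<And>i. i \<in> I \<Longrightarrow> q i \<in> hom ?V g (X i)" for g q
  proof -
    define c d where "c i = fst (snd (q i))" and "d i = fst (snd (snd (q i)))" for i
    have q: "q i = (g, c i, d i, X i)" and sq: "(g, c i, d i, X i) \<in> {q. commutative_square C q}"
      if i: "i \<in> I" for i
    proof -
      obtain c' d' where "q i = (g, c', d', X i)" "(g, c', d', X i) \<in> {q. commutative_square C q}"
        using q_hom[OF i] by (rule Sq.VC_homE)
      then show "q i = (g, c i, d i, X i)" "(g, c i, d i, X i) \<in> {q. commutative_square C q}"
        by (simp_all add: c_def d_def)
    qed
    define L K where "L = Dom C g" and "K = Cod C g"
    have gh: "g \<in> hom C L K" using g by (simp add: L_def K_def Sq.squares_simps Arr_hom)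
    have c: "c i \<in> hom C L (A i)" and d: "d i \<in> hom C K (B i)"
      and cd: "Comp C (X i) (c i) = Comp C (d i) g" if i: "i \<in> I" for i
      using Sq.squareD[OF sq[OF i]] homD[OF X[OF i]] by (simp_all add: L_def K_def hom_def)
    define h k where "h = tuple C I a L P c" and "k = tuple C I b K R d"
    have h: "h \<in> hom C L P" "\<And>i. i \<in> I \<Longrightarrow> Comp C (a i) h = c i"
      using tuple[OF A hom_Obj(1)[OF gh], of c] c by (auto simp: h_def)
    have k: "k \<in> hom C K R" "\<And>i. i \<in> I \<Longrightarrow> Comp C (b i) k = d i"
      using tuple[OF B hom_Obj(2)[OF gh], of d] d by (auto simp: k_def)
    have "Comp C f h = Comp C k g"
    proof (rule product_cone_ext[OF B category_axioms Comp_hom[OF h(1) f] Comp_hom[OF gh k(1)]])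
      fix i assume i: "i \<in> I"
      show "Comp C (b i) (Comp C f h) = Comp C (b i) (Comp C k g)"
        using Comp_assoc[OF h(1) f Bd(2)[OF i]] comm[OF i, symmetric]
          Comp_assoc[OF h(1) Ad(2)[OF i] X[OF i]] h(2)[OF i] cd[OF i]
          Comp_assoc[OF gh k(1) Bd(2)[OF i]] k(2)[OF i] by simp
    qed
    then have "commutative_square C (g, h, k, f)"
      using h(1) k(1) homD[OF f] homD[OF gh] by (simp add: commutative_square_def)
    then have "(g, h, k, f) \<in> hom ?V g f" using Sq.VC_homI by simp
    then show ?thesis
      by (intro exI[of _ "(g, h, k, f)"]) (simp add: Sq.squares_simps h k q)
  qed
  show "m = m'" if m_hom: "m \<in> hom ?V g f" "m' \<in> hom ?V g f"
    and eq: "\<And>i. i \<in> I \<Longrightarrow> Comp ?V (f, a i, b i, X i) m = Comp ?V (f, a i, b i, X i) m'" for g m m'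
  proof -
    obtain h k where m: "m = (g, h, k, f)" and sq: "(g, h, k, f) \<in> {q. commutative_square C q}"
      using m_hom(1) by (rule Sq.VC_homE)
    obtain h' k' where m': "m' = (g, h', k', f)" and sq': "(g, h', k', f) \<in> {q. commutative_square C q}"
      using m_hom(2) by (rule Sq.VC_homE)
    have D: "h \<in> hom C (Dom C g) P" "k \<in> hom C (Cod C g) R"
      "h' \<in> hom C (Dom C g) P" "k' \<in> hom C (Cod C g) R"
      using Sq.squareD[OF sq] Sq.squareD[OF sq'] homD[OF f] by (simp_all add: hom_def)
    have "h = h'"
      by (rule product_cone_ext[OF A category_axioms D(1,3)])
        (use eq in \<open>simp add: Sq.squares_simps m m'\<close>)
    moreover have "k = k'"
      by (rule product_cone_ext[OF B category_axioms D(2,4)])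
        (use eq in \<open>simp add: Sq.squares_simps m m'\<close>)
    ultimately show "m = m'" by (simp add: m m')
  qed
qed

section \<open>The DF monoid of a pair of functors\<close>

context finite_set_DF
begin

interpretation Sq: square_class S "{q. commutative_square S q}"
  by (rule square_class_commutative)

text \<open>A cell runs backwards in the horizontal opposite, hence the exchange of \<open>f\<close>
  and \<open>g\<close> under \<open>sh\<close>. Strict functoriality of \<open>sh\<close> permits
  identity cells as comparisons.\<close>

definition DF :: "('a set, 'a fmap, 'p, 'n) df" where
  "DF = \<lparr>Fh = \<lparr>ObM = ob, ArM = st\<rparr>,
     Fv = \<lparr>ObM = sh, ArM = (\<lambda>(f, k, l, g). (sh g, st k, st l, sh f))\<rparr>,
     FUnit = (\<lambda>A. Ident (VC (Sq S)) (Ident S (ob A))),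
     FComp = (\<lambda>u v. Ident (VC (Sq S)) (Comp S (sh v) (sh u)))\<rparr>"

lemma DF_simps [simp]: "DF_obj DF = ob" "DF_star DF = st" "DF_shriek DF = sh"
  by (simp_all add: DF_def DF_obj_def DF_star_def DF_shriek_def)

lemma lax_double_functor_DF: "lax_double_functor (op_dbl (Pb Setf)) (Sq S) DF"
proof -
  interpret D: strict_double_category "op_dbl (Pb (Setf :: ('a set, 'a fmap) cat))"
    by (rule strict_double_category_op[OF strict_double_category_Pb[OF category_Setf]])
  interpret E: strict_double_category "Sq S"
    by (rule strict_double_category_Sq[OF category_axioms])
  note sq = Sq.squares_simps[folded Sq_def]
  have fields: "ObM (Fh DF) = ob" "ArM (Fh DF) = st" "ObM (Fv DF) = sh"
    "ArM (Fv DF) (f, k, l, g) = (sh g, st k, st l, sh f)"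
    "FUnit DF A = Ident (VC (Sq S)) (Ident S (ob A))"
    "FComp DF u v = Ident (VC (Sq S)) (Comp S (sh v) (sh u))" for f k l g A u v
    by (simp_all add: DF_def)
  have sh_arr: "sh f \<in> Arr S" "Dom S (sh f) = ob (Dom Setf f)" "Cod S (sh f) = ob (Cod Setf f)"
    if "f \<in> Arr Setf" for f :: "'a fmap" using sh_hom[OF Setf.Arr_hom[OF that]] by (simp_all add: hom_def)
  have st_arr: "st f \<in> Arr S" "Dom S (st f) = ob (Cod Setf f)" "Cod S (st f) = ob (Dom Setf f)"
    if "f \<in> Arr Setf" for f :: "'a fmap" using st_hom[OF Setf.Arr_hom[OF that]] by (simp_all add: hom_def)
  have pbD: "f \<in> Arr Setf" "g \<in> Arr Setf" "k \<in> Arr Setf" "l \<in> Arr Setf"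
    "Dom Setf k = Dom Setf f" "Cod Setf k = Dom Setf g" "Dom Setf l = Cod Setf f"
    "Cod Setf l = Cod Setf g"
    if "pullback_square Setf (f, k, l, g)" for f k l g :: "'a fmap"
    using Pb.squareD[of f k l g] that by simp_all
  have sh_Comp': "sh (Comp Setf g f) = Comp S (sh g) (sh f)"
    if "f \<in> Arr Setf" "g \<in> Arr Setf" "Cod Setf f = Dom Setf g" for f g
    using sh_Comp Setf.Arr_hom[OF that(1)] Setf.Arr_hom[OF that(2)] that(3) by metis
  have st_Comp': "st (Comp Setf g f) = Comp S (st f) (st g)"
    if "f \<in> Arr Setf" "g \<in> Arr Setf" "Cod Setf f = Dom Setf g" for f g
    using st_Comp Setf.Arr_hom[OF that(1)] Setf.Arr_hom[OF that(2)] that(3) by metis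
  have fin: "finite (Dom Setf f)" "finite (Cod Setf f)" if "f \<in> Arr Setf" for f :: "'a fmap"
    using Setf_finite[OF Setf.Arr_hom[OF that]] by auto
  \<comment> \<open>Beck-Chevalley is exactly what makes the image of a pullback square a cell. The
    remaining conditions concern identity cells and the two functorialities.\<close>
  have square: "(sh g, st k, st l, sh f) \<in> {q. commutative_square S q}"
    if pb: "pullback_square Setf (f, k, l, g)" for f k l g
    using pbD[OF pb] Beck_Chevalley[OF pb] by (simp add: commutative_square_def hom_def sh_arr st_arr)
  have ids: "ArM (Fv DF) (Ident (VC (op_dbl (Pb Setf))) f) = Ident (VC (Sq S)) (sh f)"
    if "f \<in> Arr Setf" for f
    using that by (simp add: fields Pb_simps sq st_Ident fin sh_arr)
  show ?thesis
  proof (intro lax_double_functor.intro lax_double_functor_axioms.intro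
      D.double_category_axioms E.double_category_axioms)
    show "functor_between (HC (op_dbl (Pb Setf))) (HC (Sq S)) (Fh DF)"
      using category_op[OF category_Setf] category_axioms
      by (intro functor_between.intro functor_between_axioms.intro)
        (auto simp: Pb_simps sq fields ob_Obj st_hom st_Ident st_Comp)
    show "functor_between (VC (op_dbl (Pb Setf))) (VC (Sq S)) (Fv DF)"
    proof (intro functor_between.intro D.Src.A.category_axioms E.Src.A.category_axioms
        functor_between_axioms.intro)
      show "ObM (Fv DF) f \<in> Obj (VC (Sq S))" if "f \<in> Obj (VC (op_dbl (Pb Setf)))" for f :: "'a fmap"
        using that by (simp add: fields sq Pb_simps sh_arr)
      show "ArM (Fv DF) (Ident (VC (op_dbl (Pb Setf))) f) = Ident (VC (Sq S)) (ObM (Fv DF) f)"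
        if "f \<in> Obj (VC (op_dbl (Pb Setf)))" for f
        using ids that by (simp add: fields Pb_simps)
      fix \<alpha> and f g :: "'a fmap" assume \<alpha>: "\<alpha> \<in> hom (VC (op_dbl (Pb Setf))) f g"
      then obtain k l where \<alpha>_eq: "\<alpha> = (g, k, l, f)" and "(g, k, l, f) \<in> {q. pullback_square Setf q}"
        unfolding op_dbl_simps op_cat_simps Pb_def by (rule Pb.VC_homE)
      then have pb: "pullback_square Setf (g, k, l, f)" by simp
      show "ArM (Fv DF) \<alpha> \<in> hom (VC (Sq S)) (ObM (Fv DF) f) (ObM (Fv DF) g)"
        unfolding fields \<alpha>_eq Sq_def by (rule Sq.VC_homI[OF square[OF pb]])
      fix \<beta> and h :: "'a fmap" assume "\<beta> \<in> hom (VC (op_dbl (Pb Setf))) g h"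
      then obtain k' l' where \<beta>_eq: "\<beta> = (h, k', l', g)" and "(h, k', l', g) \<in> {q. pullback_square Setf q}"
        unfolding op_dbl_simps op_cat_simps Pb_def by (rule Pb.VC_homE)
      then have pb': "pullback_square Setf (h, k', l', g)" by simp
      show "ArM (Fv DF) (Comp (VC (op_dbl (Pb Setf))) \<beta> \<alpha>) =
          Comp (VC (Sq S)) (ArM (Fv DF) \<beta>) (ArM (Fv DF) \<alpha>)"
        using pbD[OF pb] pbD[OF pb'] by (simp add: \<alpha>_eq \<beta>_eq Pb_simps fields sq st_Comp')
    qed
  next
    fix f :: "'a fmap" assume "f \<in> Obj (VC (op_dbl (Pb Setf)))"
    then have f: "f \<in> Arr Setf" by (simp add: Pb_simps)
    show "ObM (Src (Sq S)) (ObM (Fv DF) f) = ObM (Fh DF) (ObM (Src (op_dbl (Pb Setf))) f)"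
      "ObM (Tgt (Sq S)) (ObM (Fv DF) f) = ObM (Fh DF) (ObM (Tgt (op_dbl (Pb Setf))) f)"
      using f by (simp_all add: fields sq Pb_simps sh_arr)
    note o = ob_Obj[OF fin(1)[OF f]] ob_Obj[OF fin(2)[OF f]]
    have i: "sh (Ident Setf A) = Ident S (ob A)" if "A = Dom Setf f \<or> A = Cod Setf f" for A
      using that sh_Ident fin[OF f] by auto
    show "Comp (VC (Sq S)) (ArM (Fv DF) (LUnit (op_dbl (Pb Setf)) f))
        (Comp (VC (Sq S)) (FComp DF (ObM (VId (op_dbl (Pb Setf))) (ObM (Src (op_dbl (Pb Setf))) f)) f)
          (vcomp_cell (Sq S) (FUnit DF (ObM (Src (op_dbl (Pb Setf))) f))
            (Ident (VC (Sq S)) (ObM (Fv DF) f)))) =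
      LUnit (Sq S) (ObM (Fv DF) f)"
      unfolding D.LUnit_eq[OF \<open>f \<in> Obj (VC (op_dbl (Pb Setf)))\<close>] ids[OF f]
      using f o i by (simp add: fields sq Pb_simps sh_arr cat_simps)
    show "Comp (VC (Sq S)) (ArM (Fv DF) (RUnit (op_dbl (Pb Setf)) f))
        (Comp (VC (Sq S)) (FComp DF f (ObM (VId (op_dbl (Pb Setf))) (ObM (Tgt (op_dbl (Pb Setf))) f)))
          (vcomp_cell (Sq S) (Ident (VC (Sq S)) (ObM (Fv DF) f))
            (FUnit DF (ObM (Tgt (op_dbl (Pb Setf))) f)))) =
      RUnit (Sq S) (ObM (Fv DF) f)"
      unfolding D.RUnit_eq[OF \<open>f \<in> Obj (VC (op_dbl (Pb Setf)))\<close>] ids[OF f]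
      using f o i by (simp add: fields sq Pb_simps sh_arr cat_simps)
  next
    fix \<alpha> :: "'a fmap \<times> 'a fmap \<times> 'a fmap \<times> 'a fmap" assume "\<alpha> \<in> Arr (VC (op_dbl (Pb Setf)))"
    then show "ArM (Src (Sq S)) (ArM (Fv DF) \<alpha>) = ArM (Fh DF) (ArM (Src (op_dbl (Pb Setf))) \<alpha>)"
      "ArM (Tgt (Sq S)) (ArM (Fv DF) \<alpha>) = ArM (Fh DF) (ArM (Tgt (op_dbl (Pb Setf))) \<alpha>)"
      by (cases \<alpha> rule: prod_cases4; simp add: fields sq Pb_simps)+
  next
    fix A :: "'a set" assume "A \<in> Obj (HC (op_dbl (Pb Setf)))"
    then have A: "finite A" by (simp add: Pb_simps)
    have "Ident S (ob A) \<in> Obj (VC (Sq S))"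
      using ob_Obj[OF A] by (simp add: sq cat_simps)
    from E.Ident_special_iso[OF this]
    show "FUnit DF A \<in> special (Sq S) (ObM (VId (Sq S)) (ObM (Fh DF) A))
        (ObM (Fv DF) (ObM (VId (op_dbl (Pb Setf))) A))"
      by (simp add: fields special_iso_def sq(12) Pb_simps sh_Ident[OF A])
  next
    fix u v :: "'a fmap" assume uv: "vcomposable (op_dbl (Pb Setf)) u v"
    note u = this[unfolded vcomposable_op_Pb]
    have "Comp S (sh v) (sh u) \<in> Obj (VC (Sq S))"
      using u by (simp add: sq cat_simps sh_arr)
    from E.Ident_special_iso[OF this]
    show "FComp DF u v \<in> special (Sq S) (vcomp (Sq S) (ObM (Fv DF) u) (ObM (Fv DF) v))
        (ObM (Fv DF) (vcomp (op_dbl (Pb Setf)) u v))"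
      using u by (simp add: fields special_iso_def sq(14) Pb_simps sh_Comp')
    fix w :: "'a fmap" assume vw: "vcomposable (op_dbl (Pb Setf)) v w"
    note v = this[unfolded vcomposable_op_Pb]
    have uvw: "Comp Setf (Comp Setf w v) u \<in> Arr Setf"
      using u v by (simp add: Setf.cat_simps)
    have o: "ob (Dom Setf u) \<in> Obj S" "ob (Cod Setf w) \<in> Obj S"
      using u v fin ob_Obj by auto
    show "Comp (VC (Sq S)) (ArM (Fv DF) (Assoc (op_dbl (Pb Setf)) u v w))
        (Comp (VC (Sq S)) (FComp DF u (vcomp (op_dbl (Pb Setf)) v w))
          (vcomp_cell (Sq S) (Ident (VC (Sq S)) (ObM (Fv DF) u)) (FComp DF v w))) =
      Comp (VC (Sq S)) (FComp DF (vcomp (op_dbl (Pb Setf)) u v) w)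
        (Comp (VC (Sq S)) (vcomp_cell (Sq S) (FComp DF u v) (Ident (VC (Sq S)) (ObM (Fv DF) w)))
          (Assoc (Sq S) (ObM (Fv DF) u) (ObM (Fv DF) v) (ObM (Fv DF) w)))"
      unfolding D.Assoc_eq[OF uv vw] using u v uvw o
      by (simp add: ids Pb_simps) (simp add: fields sq Pb_simps sh_arr sh_Comp' st_Ident fin cat_simps Setf.cat_simps)
  next
    fix h :: "'a fmap" and A B assume "h \<in> hom (HC (op_dbl (Pb Setf))) A B"
    then have h: "h \<in> hom Setf B A" by (simp add: Pb_simps)
    note f = Setf_finite[OF h]
    show "Comp (VC (Sq S)) (FUnit DF B) (ArM (VId (Sq S)) (ArM (Fh DF) h)) =
      Comp (VC (Sq S)) (ArM (Fv DF) (ArM (VId (op_dbl (Pb Setf))) h)) (FUnit DF A)"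
      using f ob_Obj homD[OF h] st_arr[OF homD(1)[OF h]]
      by (simp add: fields sq Pb_simps sh_Ident cat_simps)
  next
    fix \<alpha> \<beta> and u v u' v' :: "'a fmap"
    assume "(\<alpha>, \<beta>) \<in> hom (VPairs (op_dbl (Pb Setf))) (u, v) (u', v')"
    then have "(\<alpha>, \<beta>) \<in> hom (VPairs (Pb Setf)) (u', v') (u, v)"
      unfolding VPairs_op op_cat_simps .
    then obtain k l m where eq: "\<alpha> = (u', k, l, u)" "\<beta> = (v', l, m, v)"
      and pb: "pullback_square Setf (u', k, l, u)" "pullback_square Setf (v', l, m, v)"
      unfolding Pb_def by (rule Pb.VPairs_homE) auto
    show "Comp (VC (Sq S)) (FComp DF u' v') (vcomp_cell (Sq S) (ArM (Fv DF) \<alpha>) (ArM (Fv DF) \<beta>)) =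
      Comp (VC (Sq S)) (ArM (Fv DF) (vcomp_cell (op_dbl (Pb Setf)) \<alpha> \<beta>)) (FComp DF u v)"
      using pbD[OF pb(1)] pbD[OF pb(2)]
      by (simp add: eq fields sq Pb_simps sh_Comp' sh_arr st_arr cat_simps)
  qed
qed

text \<open>Preservation is tested on explicit disjoint unions, which suffices by
  \<open>preserves_product_cone\<close>.\<close>

lemma DF_monoid_DF: "DF_monoid Setf S DF"
  unfolding DF_monoid_def
proof (intro conjI lax_double_functor_DF)
  interpret F: lax_double_functor "op_dbl (Pb (Setf :: ('a set, 'a fmap) cat))" "Sq S" DF
    by (rule lax_double_functor_DF)
  interpret Fh: functor_between "HC (op_dbl (Pb Setf))" "HC (Sq S)" "Fh DF"
    by (rule F.Fh_functor)
  interpret Fv: functor_between "VC (op_dbl (Pb Setf))" "VC (Sq S)" "Fv DF"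
    by (rule F.Fv_functor)
  note sq = Sq.squares_simps[folded Sq_def]
  have fields: "ObM (Fh DF) = ob" "ArM (Fh DF) = st" "ObM (Fv DF) = sh"
    "ArM (Fv DF) (f, k, l, g) = (sh g, st k, st l, sh f)" for f k l g
    by (simp_all add: DF_def)
  show "preserves_finite_products (HC (op_dbl (Pb Setf))) (HC (Sq S)) (Fh DF)"
    unfolding preserves_finite_products_def
  proof (intro allI impI; elim conjE)
    fix I :: "nat set" and X :: "nat \<Rightarrow> 'a set" and p \<pi>
    assume I: "finite I" and X: "\<forall>i\<in>I. X i \<in> Obj (HC (op_dbl (Pb Setf)))"
      and p: "product_cone (HC (op_dbl (Pb Setf))) I X p \<pi>"
    have fin: "finite (X i)" if "i \<in> I" for i using X that by (simp add: Pb_simps)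
    obtain P and \<iota> :: "nat \<Rightarrow> 'a fmap" where d: "disjoint_union I X P \<iota>"
      using disjoint_union_exists[where A = X, OF infinite_UNIV I fin] by blast
    show "product_cone (HC (Sq S)) I (\<lambda>i. ObM (Fh DF) (X i)) (ObM (Fh DF) p) (\<lambda>i. ArM (Fh DF) (\<pi> i))"
      by (rule Fh.preserves_product_cone[OF p])
        (use product_cone_disjoint_union[OF d] product_cone_nat[OF I fin d] in
          \<open>simp_all add: Pb_simps sq fields\<close>)
  qed
  show "preserves_finite_products (VC (op_dbl (Pb Setf))) (VC (Sq S)) (Fv DF)"
    unfolding preserves_finite_products_def
  proof (intro allI impI; elim conjE)
    fix I :: "nat set" and X :: "nat \<Rightarrow> 'a fmap" and f \<pi>
    assume I: "finite I" and X: "\<forall>i\<in>I. X i \<in> Obj (VC (op_dbl (Pb Setf)))"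
      and p: "product_cone (VC (op_dbl (Pb Setf))) I X f \<pi>"
    define A B where "A i = Dom Setf (X i)" and "B i = Cod Setf (X i)" for i
    have Xi: "X i \<in> hom Setf (A i) (B i)" if "i \<in> I" for i
      using X that by (simp add: Pb_simps A_def B_def Setf.Arr_hom)
    note fin = Setf_finite[OF Xi]
    obtain P and \<iota> :: "nat \<Rightarrow> 'a fmap" where \<iota>: "disjoint_union I A P \<iota>"
      using disjoint_union_exists[where A = A, OF infinite_UNIV I fin(1)] by blast
    obtain R and \<kappa> :: "nat \<Rightarrow> 'a fmap" where \<kappa>: "disjoint_union I B R \<kappa>"
      using disjoint_union_exists[where A = B, OF infinite_UNIV I fin(2)] by blast
    note d = disjoint_unionD[OF \<iota>] and e = disjoint_unionD[OF \<kappa>]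
    \<comment> \<open>The coproduct of the mappings \<open>X i\<close>. Its injections are pullback
      squares, so their images commute by Beck-Chevalley and exhibit \<open>sh g\<close> as the
      product of the \<open>sh (X i)\<close>.\<close>
    define g where "g = tuple (op_cat Setf) I \<iota> R P (\<lambda>i. Comp Setf (\<kappa> i) (X i))"
    have g: "g \<in> hom Setf P R" and gX: "\<And>i. i \<in> I \<Longrightarrow> Comp Setf g (\<iota> i) = Comp Setf (\<kappa> i) (X i)"
      using tuple[OF product_cone_disjoint_union[OF \<iota>], of R "\<lambda>i. Comp Setf (\<kappa> i) (X i)"]
        Setf_Comp_hom[OF Xi e(2)] e(1) by (auto simp: g_def)
    have "product_cone (VC (Sq S)) I (\<lambda>i. sh (X i)) (sh g) (\<lambda>i. (sh g, st (\<iota> i), st (\<kappa> i), sh (X i)))"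
    proof (rule product_cone_commutative_squares)
      show "product_cone S I (\<lambda>i. ob (A i)) (ob P) (\<lambda>i. st (\<iota> i))"
        by (rule product_cone_nat[OF I fin(1) \<iota>])
      show "product_cone S I (\<lambda>i. ob (B i)) (ob R) (\<lambda>i. st (\<kappa> i))"
        by (rule product_cone_nat[OF I fin(2) \<kappa>])
      show "sh g \<in> hom S (ob P) (ob R)" by (rule sh_hom[OF g])
      show "sh (X i) \<in> hom S (ob (A i)) (ob (B i))" if "i \<in> I" for i by (rule sh_hom[OF Xi[OF that]])
      show "Comp S (sh (X i)) (st (\<iota> i)) = Comp S (st (\<kappa> i)) (sh g)" if "i \<in> I" for i
        by (rule Beck_Chevalley, rule pullback_square_disjoint_union[OF \<iota> \<kappa> Xi g gX that])
    qed
    then show "product_cone (VC (Sq S)) I (\<lambda>i. ObM (Fv DF) (X i)) (ObM (Fv DF) f) (\<lambda>i. ArM (Fv DF) (\<pi> i))"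
      using product_cone_pullback_squares[OF \<iota> \<kappa> Xi g gX]
      by (intro Fv.preserves_product_cone[OF p, of g "\<lambda>i. (X i, \<iota> i, \<kappa> i, g)"])
        (simp_all add: fields)
  qed
qed

end

section \<open>The commutative monoid of a DF monoid\<close>

context finite_set_DF
begin

text \<open>The locale provides this for indices in \<open>nat\<close>; a bijection with an initial
  segment of the naturals carries it to any index type.\<close>

lemma product_cone_union:
  fixes I :: "'i set"
  assumes I: "finite I" and d: "disjoint_union I X P \<iota>"
  shows "product_cone S I (\<lambda>i. ob (X i)) (ob P) (\<lambda>i. st (\<iota> i))"
proof -
  obtain b :: "'i \<Rightarrow> nat" where b: "bij_betw b I {0..<card I}"
    using ex_bij_betw_finite_nat[OF I] by blast
  define b' where "b' = the_inv_into I b"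
  have b': "bij_betw b' {0..<card I} I"
    unfolding b'_def by (rule bij_betw_the_inv_into[OF b])
  have b'b: "b' (b i) = i" if "i \<in> I" for i
    unfolding b'_def using b that by (simp add: bij_betw_def the_inv_into_f_f)
  have b'_in: "b' n \<in> I" if "n \<in> {0..<card I}" for n
    using bij_betwE[OF b'] that by blast
  note dd = disjoint_unionD[OF d]
  have "disjoint_union {0..<card I} (\<lambda>n. X (b' n)) P (\<lambda>n. \<iota> (b' n))"
  proof (rule disjoint_unionI)
    show "\<exists>n\<in>{0..<card I}. \<exists>x\<in>X (b' n). p = fn (\<iota> (b' n)) x" if p: "p \<in> P" for p
    proof -
      obtain i x where "i \<in> I" "x \<in> X i" "p = fn (\<iota> i) x" using dd(4)[OF p] by blast
      then show ?thesis using b'b bij_betwE[OF b] by (intro bexI[of _ "b i"]) auto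
    qed
    show "i = j \<and> x = y" if "i \<in> {0..<card I}" "j \<in> {0..<card I}" "x \<in> X (b' i)" "y \<in> X (b' j)"
      "fn (\<iota> (b' i)) x = fn (\<iota> (b' j)) y" for i j x y
      using dd(3)[OF b'_in[OF that(1)] b'_in[OF that(2)] that(3-5)]
        inj_onD[OF bij_betw_imp_inj_on[OF b'] _ that(1,2)] by simp
  qed (use dd(1) dd(2)[OF b'_in] in auto)
  from product_cone_nat[OF _ _ this] have
    "product_cone S {0..<card I} (\<lambda>n. ob (X (b' n))) (ob P) (\<lambda>n. st (\<iota> (b' n)))"
    using Setf_finite(1)[OF dd(2)[OF b'_in]] by simp
  from product_cone_reindex[OF this b] show ?thesis
    by (rule product_cone_cong) (simp_all add: b'b)
qed

lemma terminal_empty: "terminal S (ob {})"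
proof -
  have "disjoint_union ({} :: nat set) (\<lambda>_. {}) {} (\<lambda>_. Ident Setf {})"
    by (rule disjoint_unionI) auto
  from product_cone_union[OF _ this] show ?thesis
    by (simp add: product_cone_def terminal_def)
qed

lemma const_map_hom: "finite A \<Longrightarrow> finite B \<Longrightarrow> y \<in> B \<Longrightarrow> const_map A y B \<in> hom Setf A B"
  unfolding const_map_eq by (rule mk_fmap_hom)

lemma fn_const_map: "x \<in> A \<Longrightarrow> fn (const_map A y B) x = y"
  by (simp add: const_map_eq)

text \<open>A finite set is the disjoint union of its points, each regarded as a copy of
  \<open>{c}\<close>; hence F A is the A-fold power of F1.\<close>

lemma product_cone_points:
  assumes "finite A"
  shows "product_cone S A (\<lambda>_. ob {c}) (ob A) (\<lambda>x. st (const_map {c} x A))"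
  by (rule product_cone_union[OF assms], rule disjoint_unionI)
    (use assms in \<open>auto simp: const_map_hom fn_const_map\<close>)

end

text \<open>Concrete representatives \<open>{c}\<close> and \<open>{u, v}\<close> of 1 and 2. The
  element \<open>c\<close> may coincide with \<open>u\<close> or \<open>v\<close>, so points are
  always given by constant mappings out of \<open>{c}\<close> and not by inclusions.\<close>

locale pointed_finite_set_DF = finite_set_DF S ob st sh
  for S :: "('p, 'n) cat" and ob :: "'a set \<Rightarrow> 'p" and st sh :: "'a fmap \<Rightarrow> 'n" +
  fixes c u v :: 'a
  assumes u_neq_v: "u \<noteq> v"
begin

text \<open>The canonical arrow from F2 to the chosen product of F1 with itself.\<close>

definition comparison :: 'n where
  "comparison = pairing S (st (const_map {c} u {u, v})) (st (const_map {c} v {u, v}))"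

definition \<mu> :: 'n where
  "\<mu> = Comp S (sh (const_map {u, v} c {c})) (inv_arr S comparison)"

definition \<eta> :: 'n where
  "\<eta> = Comp S (sh (const_map {} c {c})) (bang S (one S) (ob {}))"

section \<open>Inclusions and constant mappings, along which elements are restricted and
  summed\<close>

definition incl :: "'a set \<Rightarrow> 'a set \<Rightarrow> 'a fmap" where
  "incl A B = mk_fmap A (\<lambda>x. x) B"

lemma incl_hom: "finite B \<Longrightarrow> A \<subseteq> B \<Longrightarrow> incl A B \<in> hom Setf A B"
  unfolding incl_def by (rule mk_fmap_hom) (auto intro: finite_subset)

lemma fn_incl: "x \<in> A \<Longrightarrow> fn (incl A B) x = x"
  by (simp add: incl_def)

lemma Comp_incl:
  assumes "finite C" "A \<subseteq> B" "B \<subseteq> C"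
  shows "Comp Setf (incl B C) (incl A B) = incl A C"
proof -
  note h = incl_hom[OF finite_subset[OF assms(3,1)] assms(2)] incl_hom[OF assms(1,3)]
  show ?thesis
    by (rule Setf_ext[OF Setf_Comp_hom[OF h] incl_hom])
      (use assms in \<open>auto simp: fn_Comp[OF h(1)] fn_incl\<close>)
qed

lemma Comp_incl_const_map:
  assumes "finite D" "d \<in> D"
  shows "Comp Setf (incl {d} D) (const_map {c} d {d}) = const_map {c} d D"
proof -
  have h: "const_map {c} d {d} \<in> hom Setf {c} {d}" "incl {d} D \<in> hom Setf {d} D"
    using assms by (auto intro: const_map_hom incl_hom)
  show ?thesis
    by (rule Setf_ext[OF Setf_Comp_hom[OF h] const_map_hom])
      (use assms in \<open>auto simp: fn_Comp[OF h(1)] fn_incl fn_const_map\<close>)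
qed

lemma Comp_const_map:
  assumes f: "f \<in> hom Setf A B" and y: "y \<in> C" "finite C"
  shows "Comp Setf (const_map B y C) f = const_map A y C"
  by (rule Setf_ext[OF Setf_Comp_hom[OF f const_map_hom] const_map_hom])
    (use Setf_finite[OF f] y fn_in[OF f] in \<open>auto simp: fn_Comp[OF f] fn_const_map\<close>)

lemma base_Obj: "ob {c} \<in> Obj S"
  using ob_Obj by simp

lemma point_hom: "finite D \<Longrightarrow> d \<in> D \<Longrightarrow> st (const_map {c} d D) \<in> hom S (ob D) (ob {c})"
  by (rule st_hom[OF const_map_hom]) simp_all

lemma sum_hom: "finite D \<Longrightarrow> sh (const_map D c {c}) \<in> hom S (ob D) (ob {c})"
  by (rule sh_hom[OF const_map_hom]) simp_all

text \<open>The points of \<open>{u, v}\<close>, reindexed by \<open>bool\<close> to match the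
  chosen binary products; \<open>u \<noteq> v\<close> makes the reindexing injective.\<close>

lemma product_cone_two:
  "product_cone S UNIV (two (ob {c}) (ob {c})) (ob {u, v})
    (two (st (const_map {c} u {u, v})) (st (const_map {c} v {u, v})))"
proof -
  have "bij_betw (two u v) UNIV {u, v}"
    using u_neq_v by (auto simp: bij_betw_def inj_on_def split: if_splits)
  from product_cone_reindex[OF product_cone_points this] show ?thesis
    by (rule product_cone_cong) auto
qed

lemma comparison_hom: "comparison \<in> hom S (ob {u, v}) (prod_obj S (ob {c}) (ob {c}))"
  unfolding comparison_def by (rule pairing(1)) (auto intro: point_hom)

lemma iso_comparison: "iso S comparison"
proof (rule product_cone_iso_components[OF product_cone_two prod_cone[OF base_Obj base_Obj]
      comparison_hom])
  fix i :: bool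
  note p = point_hom[of "{u, v}" u, simplified] point_hom[of "{u, v}" v, simplified]
  show "Ident S (ob {c}) \<in> hom S (two (ob {c}) (ob {c}) i) (two (ob {c}) (ob {c}) i) \<and>
      iso S (Ident S (ob {c}))"
    using Ident_hom[OF base_Obj] iso_Ident[OF base_Obj] by simp
  show "Comp S (two (proj1 S (ob {c}) (ob {c})) (proj2 S (ob {c}) (ob {c})) i) comparison =
      Comp S (Ident S (ob {c})) (two (st (const_map {c} u {u, v})) (st (const_map {c} v {u, v})) i)"
    using pairing(2,3)[OF p] Ident_Comp[OF p(1)] Ident_Comp[OF p(2)] by (simp add: comparison_def)
qed

lemma inv_comparison: "inverse_pair S comparison (inv_arr S comparison)"
proof -
  obtain g where "inverse_pair S comparison g"
    using iso_comparison unfolding iso_def by blast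
  then show ?thesis using inv_arr_eq by simp
qed

lemma inv_comparison_hom: "inv_arr S comparison \<in> hom S (prod_obj S (ob {c}) (ob {c})) (ob {u, v})"
  using inv_comparison comparison_hom by (simp add: inverse_pair_def homD[OF comparison_hom])

lemma \<mu>_hom: "\<mu> \<in> hom S (prod_obj S (ob {c}) (ob {c})) (ob {c})"
  unfolding \<mu>_def by (rule Comp_hom[OF inv_comparison_hom sum_hom]) simp

lemma \<eta>_hom: "\<eta> \<in> hom S (one S) (ob {c})"
  unfolding \<eta>_def by (rule Comp_hom[OF terminal_bang_hom[OF terminal_empty one_Obj] sum_hom]) simp

lemma \<mu>_comparison: "Comp S \<mu> comparison = sh (const_map {u, v} c {c})"
proof -
  have s: "sh (const_map {u, v} c {c}) \<in> hom S (ob {u, v}) (ob {c})" by (rule sum_hom) simp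
  have "Comp S (inv_arr S comparison) comparison = Ident S (ob {u, v})"
    using inv_comparison by (simp add: inverse_pair_def homD[OF comparison_hom])
  then show ?thesis
    unfolding \<mu>_def using Comp_assoc[OF comparison_hom inv_comparison_hom s] Comp_Ident[OF s] by simp
qed

text \<open>The two mappings are mutually inverse bijections, so they form a pullback square whose
  other two sides are identities; Beck-Chevalley there says that F_! of a bijection is F^* of its
  inverse.\<close>

lemma sh_singleton: "sh (const_map {d} c {c}) = st (const_map {c} d {d})"
proof -
  have h: "const_map {d} c {c} \<in> hom Setf {d} {c}" "Ident Setf {d} \<in> hom Setf {d} {d}"
    "const_map {c} d {d} \<in> hom Setf {c} {d}"
    by (auto intro: const_map_hom Setf_Ident_hom)
  have "pullback_square Setf (const_map {d} c {c}, Ident Setf {d}, const_map {c} d {d}, Ident Setf {d})"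
  proof (subst pullback_square_Setf_iff[OF h(1,2,2,3)], intro conjI ballI)
    show "Comp Setf (Ident Setf {d}) (Ident Setf {d}) = Comp Setf (const_map {c} d {d}) (const_map {d} c {c})"
      by (rule Setf_ext[OF Setf_Comp_hom[OF h(2,2)] Setf_Comp_hom[OF h(1,3)]])
        (simp add: fn_Comp[OF h(2)] fn_Comp[OF h(1)] fn_const_map fn_Ident)
    fix j assume "j \<in> {c}"
    then have "{i \<in> {d}. fn (const_map {d} c {c}) i = j} = {d}"
      "{x \<in> {d}. fn (Ident Setf {d}) x = fn (const_map {c} d {d}) j} = {d}"
      by (auto simp: fn_const_map fn_Ident)
    then show "bij_betw (fn (Ident Setf {d})) {i \<in> {d}. fn (const_map {d} c {c}) i = j}
        {x \<in> {d}. fn (Ident Setf {d}) x = fn (const_map {c} d {d}) j}"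
      by (simp add: bij_betw_def fn_Ident)
  qed
  from Beck_Chevalley[OF this] show ?thesis
    using Comp_Ident[OF sh_hom[OF h(1)]] Comp_Ident[OF st_hom[OF h(3)]]
    by (simp add: st_Ident sh_Ident)
qed

text \<open>A fibre is the pullback of \<open>q\<close> along a point. With Beck-Chevalley, the
  component of \<open>sh q\<close> at \<open>e\<close> becomes the sum over the fibre above
  \<open>e\<close>.\<close>

lemma pullback_square_fibre:
  assumes q: "q \<in> hom Setf D E" and e: "e \<in> E" and D': "D' = {x \<in> D. fn q x = e}"
  shows "pullback_square Setf (const_map D' c {c}, incl D' D, const_map {c} e E, q)"
proof -
  note f = Setf_finite[OF q]
  have D'D: "D' \<subseteq> D" using D' by auto
  have f': "finite D'" using D'D f(1) by (rule finite_subset)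
  have h: "const_map D' c {c} \<in> hom Setf D' {c}" "incl D' D \<in> hom Setf D' D"
    "const_map {c} e E \<in> hom Setf {c} E"
    using f f' e D'D by (auto intro: const_map_hom incl_hom)
  show ?thesis
  proof (subst pullback_square_Setf_iff[OF h(1) q h(2,3)], intro conjI ballI)
    show "Comp Setf q (incl D' D) = Comp Setf (const_map {c} e E) (const_map D' c {c})"
      by (rule Setf_ext[OF Setf_Comp_hom[OF h(2) q] Setf_Comp_hom[OF h(1,3)]])
        (simp add: fn_Comp[OF h(2)] fn_Comp[OF h(1)] fn_const_map fn_incl, simp add: D')
    fix j assume "j \<in> {c}"
    then have "{i \<in> D'. fn (const_map D' c {c}) i = j} = D'"
      "{x \<in> D. fn q x = fn (const_map {c} e E) j} = D'"
      by (auto simp: fn_const_map D')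
    moreover have "bij_betw (fn (incl D' D)) D' D'"
      by (rule bij_betw_imageI) (auto simp: inj_on_def fn_incl)
    ultimately show "bij_betw (fn (incl D' D)) {i \<in> D'. fn (const_map D' c {c}) i = j}
        {x \<in> D. fn q x = fn (const_map {c} e E) j}"
      by simp
  qed
qed

text \<open>\<open>q\<close> sends \<open>D1\<close> to \<open>u\<close> and \<open>D2\<close> to
  \<open>v\<close>. Summing over \<open>D\<close> is applying \<open>sh q\<close> and then summing
  over \<open>{u, v}\<close>; the two components of \<open>sh q\<close> are the sums over its fibres
  \<open>D1\<close> and \<open>D2\<close>.\<close>

lemma sh_union:
  assumes D: "finite D" "D = D1 \<union> D2" "D1 \<inter> D2 = {}"
  shows "sh (const_map D c {c}) = Comp S \<mu> (pairing S
    (Comp S (sh (const_map D1 c {c})) (st (incl D1 D)))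
    (Comp S (sh (const_map D2 c {c})) (st (incl D2 D))))"
proof -
  define q where "q = mk_fmap D (\<lambda>x. if x \<in> D1 then u else v) {u, v}"
  have q: "q \<in> hom Setf D {u, v}" unfolding q_def using D by (intro mk_fmap_hom) auto
  have "fn q x = u \<longleftrightarrow> x \<in> D1" "fn q x = v \<longleftrightarrow> x \<notin> D1" if "x \<in> D" for x
    using that u_neq_v by (simp_all add: q_def)
  then have D1: "D1 = {x \<in> D. fn q x = u}" and D2: "D2 = {x \<in> D. fn q x = v}"
    using D(2,3) by blast+
  have "pullback_square Setf (const_map D1 c {c}, incl D1 D, const_map {c} u {u, v}, q)"
    "pullback_square Setf (const_map D2 c {c}, incl D2 D, const_map {c} v {u, v}, q)"
    by (rule pullback_square_fibre[OF q _ D1], simp, rule pullback_square_fibre[OF q _ D2], simp)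
  note BC = this[THEN Beck_Chevalley]
  note p = point_hom[of "{u, v}" u, simplified] point_hom[of "{u, v}" v, simplified]
  have "sh (const_map D c {c}) = Comp S (sh (const_map {u, v} c {c})) (sh q)"
    using sh_Comp[OF q const_map_hom, of "{c}" c] Comp_const_map[OF q, of c "{c}"] by simp
  also have "\<dots> = Comp S \<mu> (Comp S comparison (sh q))"
    using \<mu>_comparison Comp_assoc[OF sh_hom[OF q] comparison_hom \<mu>_hom] by simp
  also have "Comp S comparison (sh q) = pairing S
    (Comp S (sh (const_map D1 c {c})) (st (incl D1 D)))
    (Comp S (sh (const_map D2 c {c})) (st (incl D2 D)))"
    unfolding comparison_def pairing_Comp[OF p sh_hom[OF q]] BC ..
  finally show ?thesis .
qed

text \<open>The sum over \<open>A \<subseteq> D\<close> of the components of a generalized element \<open>t\<close> of \<open>F D\<close>.\<close>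

definition partial_sum :: "'a set \<Rightarrow> 'n \<Rightarrow> 'a set \<Rightarrow> 'n" where
  "partial_sum D t A = Comp S (sh (const_map A c {c})) (Comp S (st (incl A D)) t)"

context
  fixes D X t
  assumes D: "finite D" and t: "t \<in> hom S X (ob D)"
begin

lemma restrict_hom: "A \<subseteq> D \<Longrightarrow> Comp S (st (incl A D)) t \<in> hom S X (ob A)"
  using Comp_hom[OF t st_hom[OF incl_hom[OF D]]] .

text \<open>F of the empty set is terminal, so the restriction of \<open>t\<close> to it carries no
  information and factors through the chosen terminal object.\<close>

lemma partial_sum_empty: "partial_sum D t {} = Comp S \<eta> (bang S X (one S))"
proof -
  note b = bang_hom[OF hom_Obj(1)[OF t]] and e = terminal_bang_hom[OF terminal_empty one_Obj]
  have "Comp S (st (incl {} D)) t = Comp S (bang S (one S) (ob {})) (bang S X (one S))"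
    by (rule terminal_ext[OF terminal_empty restrict_hom Comp_hom[OF b e]]) simp
  then show ?thesis
    unfolding partial_sum_def \<eta>_def using Comp_assoc[OF b e sum_hom] by simp
qed

lemma partial_sum_singleton:
  assumes d: "d \<in> D"
  shows "partial_sum D t {d} = Comp S (st (const_map {c} d D)) t"
proof -
  have h: "const_map {c} d {d} \<in> hom Setf {c} {d}" "incl {d} D \<in> hom Setf {d} D"
    using D d by (auto intro: const_map_hom incl_hom)
  show ?thesis
    unfolding partial_sum_def sh_singleton
    using Comp_assoc[OF t st_hom[OF h(2)] st_hom[OF h(1)]] st_Comp[OF h] Comp_incl_const_map[OF D d]
    by simp
qed

text \<open>\<open>sh_union\<close> for the set \<open>A \<union> B\<close>, evaluated at the
  restriction of \<open>t\<close> to that set.\<close>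

lemma partial_sum_union:
  assumes A: "A \<subseteq> D" and B: "B \<subseteq> D" and AB: "A \<inter> B = {}"
  shows "partial_sum D t (A \<union> B) = Comp S \<mu> (pairing S (partial_sum D t A) (partial_sum D t B))"
proof -
  have U: "A \<union> B \<subseteq> D" using A B by simp
  note fin = finite_subset[OF U D] finite_subset[OF A D] finite_subset[OF B D]
  have iA: "incl A (A \<union> B) \<in> hom Setf A (A \<union> B)" and iB: "incl B (A \<union> B) \<in> hom Setf B (A \<union> B)"
    using fin by (auto intro: incl_hom)
  note iU = incl_hom[OF D U]
  let ?r = "Comp S (st (incl (A \<union> B) D)) t"
  \<comment> \<open>Restricting from \<open>D\<close> to \<open>A \<union> B\<close> and then to
    \<open>E\<close> is restricting to \<open>E\<close> directly.\<close>
  have part: "Comp S (Comp S (sh (const_map E c {c})) (st (incl E (A \<union> B)))) ?r = partial_sum D t E"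
    if E: "finite E" "E \<subseteq> A \<union> B" "incl E (A \<union> B) \<in> hom Setf E (A \<union> B)" for E
    unfolding partial_sum_def
    using Comp_assoc[OF restrict_hom[OF U] st_hom[OF E(3)] sum_hom[OF E(1)]]
      Comp_assoc[OF t st_hom[OF iU] st_hom[OF E(3)]] st_Comp[OF E(3) iU] Comp_incl[OF D E(2) U]
    by simp
  note hA = Comp_hom[OF st_hom[OF iA] sum_hom[OF fin(2)]]
    and hB = Comp_hom[OF st_hom[OF iB] sum_hom[OF fin(3)]]
  have "partial_sum D t (A \<union> B) = Comp S (Comp S \<mu> (pairing S
      (Comp S (sh (const_map A c {c})) (st (incl A (A \<union> B))))
      (Comp S (sh (const_map B c {c})) (st (incl B (A \<union> B)))))) ?r"
    unfolding partial_sum_def using sh_union[OF fin(1) refl AB] by simp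
  also have "\<dots> = Comp S \<mu> (pairing S (partial_sum D t A) (partial_sum D t B))"
    using hom_monoid_precompose[OF \<mu>_hom hA hB restrict_hom[OF U]] part[OF fin(2) _ iA]
      part[OF fin(3) _ iB] by simp
  finally show ?thesis .
qed

end

text \<open>Since F D is a power of F1, every family of generalized elements of F1 consists of the
  components of one \<open>t\<close>. Laws for arbitrary elements can therefore be read off from
  partial sums of a single \<open>t\<close>.\<close>

lemma elements_of_product:
  assumes "finite D" "X \<in> Obj S" "\<And>d. d \<in> D \<Longrightarrow> f d \<in> hom S X (ob {c})"
  obtains t where "t \<in> hom S X (ob D)" "\<And>d. d \<in> D \<Longrightarrow> partial_sum D t {d} = f d"
proof -
  define t where "t = tuple S D (\<lambda>x. st (const_map {c} x D)) X (ob D) f"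
  note t = tuple[OF product_cone_points[OF assms(1)] assms(2), of f, OF assms(3), folded t_def]
  show ?thesis
    using that[of t] t partial_sum_singleton[OF assms(1)] by simp
qed

text \<open>
  The laws are obtained by splitting a sum over three, two or one elements in two ways.
\<close>

theorem comm_monoid_object_base: "comm_monoid_object S (ob {c}) \<mu> \<eta>"
proof (rule comm_monoid_objectI[OF base_Obj \<mu>_hom \<eta>_hom])
  fix X f g assume f: "f \<in> hom S X (ob {c})" and g: "g \<in> hom S X (ob {c})"
  have fin: "finite {u, v}" by simp
  obtain t where t: "t \<in> hom S X (ob {u, v})"
    and "\<And>d. d \<in> {u, v} \<Longrightarrow> partial_sum {u, v} t {d} = two f g (d = u)"
    by (rule elements_of_product[OF fin hom_Obj(1)[OF f], of "\<lambda>d. two f g (d = u)"]) (use f g in auto)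
  then have e: "partial_sum {u, v} t {u} = f" "partial_sum {u, v} t {v} = g"
    using u_neq_v by auto
  have "{u} \<union> {v} = {u, v}" "{v} \<union> {u} = {u, v}" by auto
  then show "Comp S \<mu> (pairing S f g) = Comp S \<mu> (pairing S g f)"
    using partial_sum_union[OF fin t, of "{u}" "{v}"] partial_sum_union[OF fin t, of "{v}" "{u}"]
      u_neq_v by (simp add: e)
  fix h assume h: "h \<in> hom S X (ob {c})"
  \<comment> \<open>Associativity needs a set of three elements; \<open>E\<close> is split as
    \<open>{u, v} \<union> {w}\<close> and as \<open>{u} \<union> {v, w}\<close>.\<close>
  obtain w where w: "w \<notin> {u, v}" using ex_new_if_finite[OF infinite_UNIV, of "{u, v}"] by auto
  define E where "E = {u, v, w}"
  have fin: "finite E" by (simp add: E_def)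
  obtain s where s: "s \<in> hom S X (ob E)"
    and "\<And>d. d \<in> E \<Longrightarrow> partial_sum E s {d} = two f (two g h (d = v)) (d = u)"
    by (rule elements_of_product[OF fin hom_Obj(1)[OF f], of "\<lambda>d. two f (two g h (d = v)) (d = u)"])
      (use f g h in auto)
  then have e: "partial_sum E s {u} = f" "partial_sum E s {v} = g" "partial_sum E s {w} = h"
    using u_neq_v w by (auto simp: E_def)
  have U: "{u} \<union> {v} = {u, v}" "{v} \<union> {w} = {v, w}" "{u, v} \<union> {w} = E" "{u} \<union> {v, w} = E"
    and sub: "{u} \<subseteq> E" "{v} \<subseteq> E" "{w} \<subseteq> E" "{u, v} \<subseteq> E" "{v, w} \<subseteq> E"
    and disj: "{u} \<inter> {v} = {}" "{v} \<inter> {w} = {}" "{u, v} \<inter> {w} = {}" "{u} \<inter> {v, w} = {}"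
    using u_neq_v w by (auto simp: E_def)
  show "Comp S \<mu> (pairing S (Comp S \<mu> (pairing S f g)) h) =
      Comp S \<mu> (pairing S f (Comp S \<mu> (pairing S g h)))"
    using partial_sum_union[OF fin s sub(1,2) disj(1)] partial_sum_union[OF fin s sub(2,3) disj(2)]
      partial_sum_union[OF fin s sub(4,3) disj(3)] partial_sum_union[OF fin s sub(1,5) disj(4)]
    unfolding U e by simp
next
  fix X f assume f: "f \<in> hom S X (ob {c})"
  have fin: "finite {u}" by simp
  obtain t where t: "t \<in> hom S X (ob {u})" and "\<And>d. d \<in> {u} \<Longrightarrow> partial_sum {u} t {d} = f"
    by (rule elements_of_product[OF fin hom_Obj(1)[OF f], of "\<lambda>_. f"]) (use f in auto)
  then show "Comp S \<mu> (pairing S f (Comp S \<eta> (bang S X (one S)))) = f"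
    \<comment> \<open>The unit law is the decomposition of \<open>{u}\<close> as its union with the
      empty set.\<close>
    using partial_sum_union[OF fin t, of "{u}" "{}"] partial_sum_empty[OF fin t] by simp
qed

text \<open>The empty and union rules give the recursion of \<open>finprod\<close> over inserted
  elements. From here on F_! is an ordinary finite sum.\<close>

lemma partial_sum_finprod:
  assumes D: "finite D" and t: "t \<in> hom S X (ob D)" and A: "A \<subseteq> D"
  shows "partial_sum D t A =
    finprod (hom_monoid (ob {c}) \<mu> \<eta> X) (\<lambda>d. Comp S (st (const_map {c} d D)) t) A"
proof -
  interpret X: comm_monoid "hom_monoid (ob {c}) \<mu> \<eta> X"
    by (rule comm_monoid_hom_monoid[OF comm_monoid_object_base hom_Obj(1)[OF t]])
  have "finite A" using finite_subset[OF A D] .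
  then show ?thesis using A
  proof (induction A rule: finite_induct)
    case empty
    then show ?case using partial_sum_empty[OF D t] by simp
  next
    case (insert d A)
    have "Comp S (st (const_map {c} e D)) t \<in> hom S X (ob {c})" if "e \<in> D" for e
      using Comp_hom[OF t point_hom[OF D that]] .
    then show ?case
      using insert partial_sum_union[OF D t, of "{d}" A] partial_sum_singleton[OF D t, of d]
      by (subst X.finprod_insert) auto
  qed
qed

end

section \<open>Presentations by powers of a commutative monoid\<close>

lemma (in category) product_cone_compose_iso:
  assumes p: "product_cone C I X p \<pi>"
    and \<phi>: "\<And>i. i \<in> I \<Longrightarrow> \<phi> i \<in> hom C (X i) (Y i)" "\<And>i. i \<in> I \<Longrightarrow> iso C (\<phi> i)"
  shows "product_cone C I Y p (\<lambda>i. Comp C (\<phi> i) (\<pi> i))"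
proof (rule product_coneI)
  note pd = product_coneD[OF p]
  have "\<exists>g. g \<in> hom C (Y i) (X i) \<and> Comp C g (\<phi> i) = Ident C (X i) \<and> Comp C (\<phi> i) g = Ident C (Y i)"
    if "i \<in> I" for i
    using \<phi>(2)[OF that] homD[OF \<phi>(1)[OF that]] by (auto simp: iso_def inverse_pair_def)
  then obtain \<psi> where \<psi>: "\<And>i. i \<in> I \<Longrightarrow> \<psi> i \<in> hom C (Y i) (X i)"
    "\<And>i. i \<in> I \<Longrightarrow> Comp C (\<psi> i) (\<phi> i) = Ident C (X i)"
    "\<And>i. i \<in> I \<Longrightarrow> Comp C (\<phi> i) (\<psi> i) = Ident C (Y i)"
    by metis
  show "p \<in> Obj C" by (rule pd)
  show "Comp C (\<phi> i) (\<pi> i) \<in> hom C p (Y i)" if "i \<in> I" for i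
    by (rule Comp_hom[OF pd(2)[OF that] \<phi>(1)[OF that]])
  show "\<exists>h. h \<in> hom C a p \<and> (\<forall>i\<in>I. Comp C (Comp C (\<phi> i) (\<pi> i)) h = f i)"
    if a: "a \<in> Obj C" and f: "\<And>i. i \<in> I \<Longrightarrow> f i \<in> hom C a (Y i)" for a f
  proof -
    define h where "h = tuple C I \<pi> a p (\<lambda>i. Comp C (\<psi> i) (f i))"
    have h: "h \<in> hom C a p" "\<And>i. i \<in> I \<Longrightarrow> Comp C (\<pi> i) h = Comp C (\<psi> i) (f i)"
      using tuple[OF p a, of "\<lambda>i. Comp C (\<psi> i) (f i)"] Comp_hom[OF f \<psi>(1)] by (auto simp: h_def)
    have "Comp C (Comp C (\<phi> i) (\<pi> i)) h = f i" if i: "i \<in> I" for i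
      using Comp_assoc[OF h(1) pd(2)[OF i] \<phi>(1)[OF i]] h(2)[OF i] \<psi>(3)[OF i]
        Comp_assoc[OF f[OF i] \<psi>(1)[OF i] \<phi>(1)[OF i]] Ident_Comp[OF f[OF i]] by simp
    then show ?thesis using h(1) by blast
  qed
  show "h = k" if h: "h \<in> hom C a p" and k: "k \<in> hom C a p"
    and eq: "\<And>i. i \<in> I \<Longrightarrow> Comp C (Comp C (\<phi> i) (\<pi> i)) h = Comp C (Comp C (\<phi> i) (\<pi> i)) k" for a h k
  proof (rule product_cone_ext[OF p category_axioms h k])
    fix i assume i: "i \<in> I"
    have "Comp C (\<psi> i) (Comp C (Comp C (\<phi> i) (\<pi> i)) l) = Comp C (\<pi> i) l" if l: "l \<in> hom C a p" for l
      using Comp_assoc[OF l pd(2)[OF i] \<phi>(1)[OF i]] \<psi>(2)[OF i]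
        Comp_assoc[OF Comp_hom[OF l pd(2)[OF i]] \<phi>(1)[OF i] \<psi>(1)[OF i]]
        Ident_Comp[OF Comp_hom[OF l pd(2)[OF i]]] by simp
    then show "Comp C (\<pi> i) h = Comp C (\<pi> i) k" using eq[OF i] h k by metis
  qed
qed

text \<open>A morphism of monoid objects induces homomorphisms between the monoids of generalized
  elements. As before, an infinite index set yields units on both sides.\<close>

lemma (in finite_product_category) finprod_postcompose:
  assumes M: "comm_monoid_object C a \<mu> \<eta>" and N: "comm_monoid_object C b \<mu>' \<eta>'"
    and \<phi>: "\<phi> \<in> hom C a b" and mult: "Comp C \<phi> \<mu> = Comp C \<mu>' (prod_arr C \<phi> \<phi>)"
    and unit: "Comp C \<phi> \<eta> = \<eta>'" and X: "X \<in> Obj C"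
    and f: "\<And>x. x \<in> A \<Longrightarrow> f x \<in> hom C X a"
  shows "Comp C \<phi> (finprod (hom_monoid a \<mu> \<eta> X) f A) =
    finprod (hom_monoid b \<mu>' \<eta>' X) (\<lambda>x. Comp C \<phi> (f x)) A"
proof -
  have \<mu>: "\<mu> \<in> hom C (prod_obj C a a) a" and \<eta>: "\<eta> \<in> hom C (one C) a"
    and \<mu>': "\<mu>' \<in> hom C (prod_obj C b b) b"
    using M N by (auto simp: comm_monoid_object_def)
  interpret M: comm_monoid "hom_monoid a \<mu> \<eta> X" by (rule comm_monoid_hom_monoid[OF M X])
  interpret N: comm_monoid "hom_monoid b \<mu>' \<eta>' X" by (rule comm_monoid_hom_monoid[OF N X])
  have e: "Comp C \<phi> (Comp C \<eta> (bang C X (one C))) = Comp C \<eta>' (bang C X (one C))"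
    using Comp_assoc[OF bang_hom[OF X] \<eta> \<phi>] unit by simp
  show ?thesis using f
  proof (induction A rule: infinite_finite_induct)
    case (insert x A)
    have fin: "finprod (hom_monoid a \<mu> \<eta> X) f A \<in> hom C X a"
      using M.finprod_closed[of f A] insert.prems by auto
    have fx: "f x \<in> hom C X a" using insert.prems by simp
    have "Comp C \<phi> (finprod (hom_monoid a \<mu> \<eta> X) f (insert x A)) =
        Comp C \<phi> (Comp C \<mu> (pairing C (f x) (finprod (hom_monoid a \<mu> \<eta> X) f A)))"
      using insert by (simp add: Pi_def)
    also have "\<dots> = Comp C \<mu>' (pairing C (Comp C \<phi> (f x)) (Comp C \<phi> (finprod (hom_monoid a \<mu> \<eta> X) f A)))"
      using Comp_assoc[OF pairing(1)[OF fx fin] \<mu> \<phi>] mult prod_arr(2)[OF \<phi> \<phi> fx fin]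
        Comp_assoc[OF pairing(1)[OF fx fin] prod_arr(1)[OF \<phi> \<phi>] \<mu>'] by simp
    also have "\<dots> = finprod (hom_monoid b \<mu>' \<eta>' X) (\<lambda>x. Comp C \<phi> (f x)) (insert x A)"
      using insert Comp_hom[OF _ \<phi>] by (subst N.finprod_insert) auto
    finally show ?case .
  qed (simp_all add: e)
qed

text \<open>
  The object \<open>ob A\<close> is the \<open>A\<close>-fold power of a commutative monoid \<open>a\<close>, with projections \<open>p A\<close>;
  reindexing acts by \<open>st\<close> and summation over fibres by \<open>sh\<close>.
\<close>

definition (in finite_product_category) presentation ::
  "'a \<Rightarrow> 'b \<Rightarrow> 'b \<Rightarrow> ('x set \<Rightarrow> 'a) \<Rightarrow> ('x fmap \<Rightarrow> 'b) \<Rightarrow> ('x fmap \<Rightarrow> 'b) \<Rightarrow> ('x set \<Rightarrow> 'x \<Rightarrow> 'b) \<Rightarrow> bool"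
  where "presentation a \<mu> \<eta> ob st sh p \<longleftrightarrow> comm_monoid_object C a \<mu> \<eta> \<and>
    (\<forall>A. finite A \<longrightarrow> product_cone C A (\<lambda>_. a) (ob A) (p A)) \<and>
    (\<forall>A B. \<forall>f\<in>hom Setf A B. st f \<in> hom C (ob B) (ob A) \<and> sh f \<in> hom C (ob A) (ob B) \<and>
      (\<forall>x\<in>A. Comp C (p A x) (st f) = p B (fn f x)) \<and>
      (\<forall>y\<in>B. Comp C (p B y) (sh f) =
        finprod (hom_monoid a \<mu> \<eta> (ob A)) (p A) {x \<in> A. fn f x = y}))"

lemma (in finite_product_category) presentationD:
  assumes "presentation a \<mu> \<eta> ob st sh p"
  shows "comm_monoid_object C a \<mu> \<eta>"
    and "finite A \<Longrightarrow> product_cone C A (\<lambda>_. a) (ob A) (p A)"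
    and "f \<in> hom Setf A B \<Longrightarrow> st f \<in> hom C (ob B) (ob A)"
    and "f \<in> hom Setf A B \<Longrightarrow> sh f \<in> hom C (ob A) (ob B)"
    and "f \<in> hom Setf A B \<Longrightarrow> x \<in> A \<Longrightarrow> Comp C (p A x) (st f) = p B (fn f x)"
    and "f \<in> hom Setf A B \<Longrightarrow> y \<in> B \<Longrightarrow> Comp C (p B y) (sh f) =
      finprod (hom_monoid a \<mu> \<eta> (ob A)) (p A) {x \<in> A. fn f x = y}"
  using assms unfolding presentation_def by simp_all

text \<open>The projections of F A are its points followed by \<phi>, which makes F A a power of
  \<open>a\<close> itself; \<phi> being a homomorphism, sums in F1 turn into sums in
  \<open>a\<close>.\<close>

lemma (in pointed_finite_set_DF) presentation_of_monoid_iso: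
  assumes M: "comm_monoid_object S a m e" and \<phi>: "\<phi> \<in> hom S (ob {c}) a" "iso S \<phi>"
    and mult: "Comp S \<phi> \<mu> = Comp S m (prod_arr S \<phi> \<phi>)" and unit: "Comp S \<phi> \<eta> = e"
  shows "presentation a m e ob st sh (\<lambda>A x. Comp S \<phi> (st (const_map {c} x A)))"
  unfolding presentation_def
proof (intro conjI allI ballI impI M)
  show "product_cone S A (\<lambda>_. a) (ob A) (\<lambda>x. Comp S \<phi> (st (const_map {c} x A)))" if "finite A" for A
    by (rule product_cone_compose_iso[OF product_cone_points[OF that] \<phi>])
  fix A B and f :: "'a fmap" assume f: "f \<in> hom Setf A B"
  note fin = Setf_finite[OF f]
  show "st f \<in> hom S (ob B) (ob A)" "sh f \<in> hom S (ob A) (ob B)"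
    using st_hom[OF f] sh_hom[OF f] .
  show "Comp S (Comp S \<phi> (st (const_map {c} x A))) (st f) = Comp S \<phi> (st (const_map {c} (fn f x) B))"
    if x: "x \<in> A" for x
  proof -
    have h: "const_map {c} x A \<in> hom Setf {c} A" using fin x by (intro const_map_hom) auto
    have "Comp Setf f (const_map {c} x A) = const_map {c} (fn f x) B"
      by (rule Setf_ext[OF Setf_Comp_hom[OF h f] const_map_hom])
        (use fin fn_in[OF f x] in \<open>auto simp: fn_Comp[OF h] fn_const_map\<close>)
    then show ?thesis
      using st_Comp[OF h f] Comp_assoc[OF st_hom[OF f] st_hom[OF h] \<phi>(1)] by simp
  qed
  fix y assume y: "y \<in> B"
  define D where "D = {x \<in> A. fn f x = y}"
  have DA: "D \<subseteq> A" by (auto simp: D_def)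
  note i = Ident_hom[OF ob_Obj[OF fin(1)]]
  have st_i: "st (incl D A) \<in> hom S (ob A) (ob D)" using st_hom[OF incl_hom[OF fin(1) DA]] .
  have pt: "st (const_map {c} x A) \<in> hom S (ob A) (ob {c})" if "x \<in> D" for x
    using point_hom[OF fin(1)] that DA by auto
  have "Comp S (Comp S \<phi> (st (const_map {c} y B))) (sh f) =
      Comp S \<phi> (Comp S (st (const_map {c} y B)) (sh f))"
    using Comp_assoc[OF sh_hom[OF f] point_hom[OF fin(2) y] \<phi>(1)] by simp
  \<comment> \<open>Beck-Chevalley at the fibre over \<open>y\<close>. The identity of F A is the
    universal generalized element, whose components are the projections.\<close>
  also have "Comp S (st (const_map {c} y B)) (sh f) = partial_sum A (Ident S (ob A)) D"
    unfolding partial_sum_def Beck_Chevalley[OF pullback_square_fibre[OF f y D_def], symmetric]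
    using Comp_Ident[OF st_i] by simp
  also have "\<dots> = finprod (hom_monoid (ob {c}) \<mu> \<eta> (ob A))
      (\<lambda>d. Comp S (st (const_map {c} d A)) (Ident S (ob A))) D"
    by (rule partial_sum_finprod[OF fin(1) i DA])
  also have "Comp S \<phi> \<dots> = finprod (hom_monoid a m e (ob A))
      (\<lambda>d. Comp S \<phi> (Comp S (st (const_map {c} d A)) (Ident S (ob A)))) D"
    by (rule finprod_postcompose[OF comm_monoid_object_base M \<phi>(1) mult unit ob_Obj[OF fin(1)]])
      (rule Comp_hom[OF i pt])
  also have "\<dots> = finprod (hom_monoid a m e (ob A)) (\<lambda>x. Comp S \<phi> (st (const_map {c} x A))) D"
  proof (rule comm_monoid.finprod_cong'[OF comm_monoid_hom_monoid[OF M ob_Obj[OF fin(1)]] refl])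
    show "(\<lambda>x. Comp S \<phi> (st (const_map {c} x A))) \<in> D \<rightarrow> carrier (hom_monoid a m e (ob A))"
      using Comp_hom[OF pt \<phi>(1)] by auto
    show "Comp S \<phi> (Comp S (st (const_map {c} d A)) (Ident S (ob A))) = Comp S \<phi> (st (const_map {c} d A))"
      if "d \<in> D" for d using Comp_Ident[OF pt[OF that]] by simp
  qed
  finally show "Comp S (Comp S \<phi> (st (const_map {c} y B))) (sh f) =
    finprod (hom_monoid a m e (ob A)) (\<lambda>x. Comp S \<phi> (st (const_map {c} x A))) {x \<in> A. fn f x = y}"
    unfolding D_def .
qed

section \<open>Presentations: uniqueness, the DF monoid axioms, and existence\<close>

context finite_product_category
begin

text \<open>The projections determine both actions, so the isomorphism of powers compatible with the
  projections is natural for both.\<close>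

lemma presentation_iso:
  assumes P: "presentation a \<mu> \<eta> ob st sh p" and Q: "presentation a \<mu> \<eta> ob' st' sh' q"
  obtains \<tau> where "\<And>A. finite A \<Longrightarrow> \<tau> A \<in> hom C (ob A) (ob' A)" "\<And>A. finite A \<Longrightarrow> iso C (\<tau> A)"
    "\<And>A B f. f \<in> hom Setf A B \<Longrightarrow> Comp C (\<tau> B) (sh f) = Comp C (sh' f) (\<tau> A)"
    "\<And>A B f. f \<in> hom Setf A B \<Longrightarrow> Comp C (\<tau> A) (st f) = Comp C (st' f) (\<tau> B)"
proof -
  note pd = presentationD[OF P] and qd = presentationD[OF Q]
  have "\<exists>h. h \<in> hom C (ob A) (ob' A) \<and> iso C h \<and> (\<forall>x\<in>A. Comp C (q A x) h = p A x)"
    if A: "finite A" for A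
    using product_cones_iso[OF pd(2)[OF A] qd(2)[OF A]] by metis
  then obtain \<tau> where \<tau>: "\<And>A. finite A \<Longrightarrow> \<tau> A \<in> hom C (ob A) (ob' A)" "\<And>A. finite A \<Longrightarrow> iso C (\<tau> A)"
    "\<And>A x. finite A \<Longrightarrow> x \<in> A \<Longrightarrow> Comp C (q A x) (\<tau> A) = p A x"
    by metis
  have "Comp C (\<tau> B) (sh f) = Comp C (sh' f) (\<tau> A) \<and> Comp C (\<tau> A) (st f) = Comp C (st' f) (\<tau> B)"
    if f: "f \<in> hom Setf A B" for A B f
  proof
    note fin = Setf_finite[OF f]
    note cA = qd(2)[OF fin(1)] and cB = qd(2)[OF fin(2)]
    note \<tau>A = \<tau>(1)[OF fin(1)] and \<tau>B = \<tau>(1)[OF fin(2)]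
    show "Comp C (\<tau> B) (sh f) = Comp C (sh' f) (\<tau> A)"
    proof (rule product_cone_ext[OF cB category_axioms Comp_hom[OF pd(4)[OF f] \<tau>B]
          Comp_hom[OF \<tau>A qd(4)[OF f]]])
      fix y assume y: "y \<in> B"
      have q: "q A x \<in> hom C (ob' A) a" if "x \<in> {x \<in> A. fn f x = y}" for x
        using product_coneD(2)[OF cA] that by simp
      have p: "p A x \<in> hom C (ob A) a" if "x \<in> {x \<in> A. fn f x = y}" for x
        using product_coneD(2)[OF pd(2)[OF fin(1)]] that by simp
      \<comment> \<open>After projection to \<open>y\<close> both sides are sums over the fibre;
        \<tau> passes inside the sum by precomposition and turns the projections \<open>q A\<close>
        into \<open>p A\<close>.\<close>
      have "Comp C (q B y) (Comp C (sh' f) (\<tau> A)) =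
          Comp C (finprod (hom_monoid a \<mu> \<eta> (ob' A)) (q A) {x \<in> A. fn f x = y}) (\<tau> A)"
        using Comp_assoc[OF \<tau>A qd(4)[OF f] product_coneD(2)[OF cB y]] qd(6)[OF f y] by simp
      also have "\<dots> = finprod (hom_monoid a \<mu> \<eta> (ob A)) (\<lambda>x. Comp C (q A x) (\<tau> A)) {x \<in> A. fn f x = y}"
        by (rule finprod_precompose[OF pd(1) \<tau>A q])
      also have "\<dots> = finprod (hom_monoid a \<mu> \<eta> (ob A)) (p A) {x \<in> A. fn f x = y}"
        by (rule comm_monoid.finprod_cong'[OF comm_monoid_hom_monoid[OF pd(1) hom_Obj(1)[OF \<tau>A]] refl])
          (use p \<tau>(3)[OF fin(1)] in auto)
      also have "\<dots> = Comp C (q B y) (Comp C (\<tau> B) (sh f))"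
        using Comp_assoc[OF pd(4)[OF f] \<tau>B product_coneD(2)[OF cB y]] \<tau>(3)[OF fin(2) y] pd(6)[OF f y]
        by simp
      finally show "Comp C (q B y) (Comp C (\<tau> B) (sh f)) = Comp C (q B y) (Comp C (sh' f) (\<tau> A))" ..
    qed
    show "Comp C (\<tau> A) (st f) = Comp C (st' f) (\<tau> B)"
    proof (rule product_cone_ext[OF cA category_axioms Comp_hom[OF pd(3)[OF f] \<tau>A]
          Comp_hom[OF \<tau>B qd(3)[OF f]]])
      fix x assume x: "x \<in> A"
      note qx = product_coneD(2)[OF cA x]
      show "Comp C (q A x) (Comp C (\<tau> A) (st f)) = Comp C (q A x) (Comp C (st' f) (\<tau> B))"
        using Comp_assoc[OF pd(3)[OF f] \<tau>A qx] \<tau>(3)[OF fin(1) x] pd(5)[OF f x]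
          Comp_assoc[OF \<tau>B qd(3)[OF f] qx] qd(5)[OF f x] \<tau>(3)[OF fin(2) fn_in[OF f x]] by simp
    qed
  qed
  then show ?thesis using that[of \<tau>] \<tau>(1,2) by simp
qed

text \<open>All arrows compared end in a power of \<open>a\<close>, so every equation is checked on
  projections, where it becomes an identity between finite sums of projections.\<close>

lemma finite_set_DF_of_presentation:
  fixes ob :: "'x set \<Rightarrow> 'a"
  assumes P: "presentation a \<mu> \<eta> ob st sh p" and inf: "infinite (UNIV :: 'x set)"
  shows "finite_set_DF C ob st sh"
proof (unfold_locales)
  note pd = presentationD[OF P]
  note ph = product_coneD(2)[OF pd(2)]
  have ob: "ob A \<in> Obj C" if "finite A" for A using product_coneD(1)[OF pd(2)[OF that]] .
  note M = comm_monoid_hom_monoid[OF pd(1) ob]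
  show "infinite (UNIV :: 'x set)" by fact
  fix A :: "'x set" assume A: "finite A"
  show "ob A \<in> Obj C" by (rule ob[OF A])
  note iA = Setf_Ident_hom[OF A] and oA = Ident_hom[OF ob[OF A]]
  show "st (Ident Setf A) = Ident C (ob A)"
    by (rule product_cone_ext[OF pd(2)[OF A] category_axioms pd(3)[OF iA] oA])
      (simp add: pd(5)[OF iA] fn_Ident Comp_Ident[OF ph[OF A]])
  show "sh (Ident Setf A) = Ident C (ob A)"
  proof (rule product_cone_ext[OF pd(2)[OF A] category_axioms pd(4)[OF iA] oA])
    interpret M: comm_monoid "hom_monoid a \<mu> \<eta> (ob A)" by (rule M[OF A])
    fix x assume x: "x \<in> A"
    have "{y \<in> A. fn (Ident Setf A) y = x} = {x}" using x by (auto simp: fn_Ident)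
    then have "Comp C (p A x) (sh (Ident Setf A)) = finprod (hom_monoid a \<mu> \<eta> (ob A)) (p A) {x}"
      using pd(6)[OF iA x] by simp
    also have "\<dots> = p A x"
      using ph[OF A x] M.r_one[of "p A x"] by (subst M.finprod_insert) auto
    finally show "Comp C (p A x) (sh (Ident Setf A)) = Comp C (p A x) (Ident C (ob A))"
      using Comp_Ident[OF ph[OF A x]] by simp
  qed
next
  note pd = presentationD[OF P]
  note ph = product_coneD(2)[OF pd(2)]
  have ob: "ob A \<in> Obj C" if "finite A" for A using product_coneD(1)[OF pd(2)[OF that]] .
  note M = comm_monoid_hom_monoid[OF pd(1) ob]
  fix f :: "'x fmap" and A B assume f: "f \<in> hom Setf A B"
  note fin = Setf_finite[OF f]
  show "st f \<in> hom C (ob B) (ob A)" "sh f \<in> hom C (ob A) (ob B)" by (rule pd(3,4)[OF f])+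
  fix g :: "'x fmap" and D assume g: "g \<in> hom Setf B D"
  note fin' = Setf_finite(2)[OF g]
  note gf = Setf_Comp_hom[OF f g]
  show "st (Comp Setf g f) = Comp C (st f) (st g)"
  proof (rule product_cone_ext[OF pd(2)[OF fin(1)] category_axioms pd(3)[OF gf]
        Comp_hom[OF pd(3)[OF g] pd(3)[OF f]]])
    fix x assume x: "x \<in> A"
    show "Comp C (p A x) (st (Comp Setf g f)) = Comp C (p A x) (Comp C (st f) (st g))"
      using Comp_assoc[OF pd(3)[OF g] pd(3)[OF f] ph[OF fin(1) x]] pd(5)[OF f x]
        pd(5)[OF g fn_in[OF f x]] pd(5)[OF gf x] fn_Comp[OF f x] by simp
  qed
  show "sh (Comp Setf g f) = Comp C (sh g) (sh f)"
  proof (rule product_cone_ext[OF pd(2)[OF fin'] category_axioms pd(4)[OF gf]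
        Comp_hom[OF pd(4)[OF f] pd(4)[OF g]]])
    interpret M: comm_monoid "hom_monoid a \<mu> \<eta> (ob A)" by (rule M[OF fin(1)])
    fix z assume z: "z \<in> D"
    have pA: "p A x \<in> hom C (ob A) a" if "x \<in> A" for x by (rule ph[OF fin(1) that])
    have pB: "p B y \<in> hom C (ob B) a" if "y \<in> {y \<in> B. fn g y = z}" for y
      using ph[OF fin(2)] that by simp
    have "Comp C (p D z) (Comp C (sh g) (sh f)) =
        Comp C (finprod (hom_monoid a \<mu> \<eta> (ob B)) (p B) {y \<in> B. fn g y = z}) (sh f)"
      using Comp_assoc[OF pd(4)[OF f] pd(4)[OF g] ph[OF fin' z]] pd(6)[OF g z] by simp
    also have "\<dots> = finprod (hom_monoid a \<mu> \<eta> (ob A)) (\<lambda>y. Comp C (p B y) (sh f)) {y \<in> B. fn g y = z}"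
      by (rule finprod_precompose[OF pd(1) pd(4)[OF f] pB])
    also have "\<dots> = finprod (hom_monoid a \<mu> \<eta> (ob A))
        (\<lambda>y. finprod (hom_monoid a \<mu> \<eta> (ob A)) (p A) {x \<in> A. fn f x = y}) {y \<in> B. fn g y = z}"
    proof (rule M.finprod_cong'[OF refl])
      show "(\<lambda>y. finprod (hom_monoid a \<mu> \<eta> (ob A)) (p A) {x \<in> A. fn f x = y}) \<in>
          {y \<in> B. fn g y = z} \<rightarrow> carrier (hom_monoid a \<mu> \<eta> (ob A))"
        using pA by (intro Pi_I M.finprod_closed) auto
    qed (use pd(6)[OF f] in simp)
    \<comment> \<open>The Fubini rule: the fibre of the composite over \<open>z\<close> is the
      disjoint union of the fibres of \<open>f\<close> over the elements of the fibre of
      \<open>g\<close>.\<close>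
    also have "\<dots> = finprod (hom_monoid a \<mu> \<eta> (ob A)) (p A)
        (\<Union>y\<in>{y \<in> B. fn g y = z}. {x \<in> A. fn f x = y})"
      using fin pA by (intro M.finprod_UN_disjoint[symmetric]) (auto simp: pairwise_def disjnt_def)
    also have "(\<Union>y\<in>{y \<in> B. fn g y = z}. {x \<in> A. fn f x = y}) = {x \<in> A. fn (Comp Setf g f) x = z}"
      using fn_in[OF f] by (auto simp: fn_Comp[OF f])
    finally show "Comp C (p D z) (sh (Comp Setf g f)) = Comp C (p D z) (Comp C (sh g) (sh f))"
      using pd(6)[OF gf z] by simp
  qed
next
  note pd = presentationD[OF P]
  note ph = product_coneD(2)[OF pd(2)]
  have ob: "ob A \<in> Obj C" if "finite A" for A using product_coneD(1)[OF pd(2)[OF that]] .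
  note M = comm_monoid_hom_monoid[OF pd(1) ob]
  fix f k l g :: "'x fmap" assume pb: "pullback_square Setf (f, k, l, g)"
  define I J L K where "I = Dom Setf f" and "J = Cod Setf f" and "L = Dom Setf g" and "K = Cod Setf g"
  note sq = Setf.pullback_squareD[OF pb, folded I_def J_def L_def K_def]
  note fin = Setf_finite[OF sq(1)] Setf_finite[OF sq(2)]
  show "Comp C (sh f) (st k) = Comp C (st l) (sh g)"
  proof (rule product_cone_ext[OF pd(2)[OF fin(2)] category_axioms
        Comp_hom[OF pd(3)[OF sq(3)] pd(4)[OF sq(1)]] Comp_hom[OF pd(4)[OF sq(2)] pd(3)[OF sq(4)]]])
    interpret M: comm_monoid "hom_monoid a \<mu> \<eta> (ob L)" by (rule M[OF fin(3)])
    fix j assume j: "j \<in> J"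
    let ?F = "{i \<in> I. fn f i = j}" and ?G = "{x \<in> L. fn g x = fn l j}"
    have bij: "bij_betw (fn k) ?F ?G"
      using iffD1[OF pullback_square_Setf_iff[OF sq(1-4)] pb] j by simp
    have pI: "p I i \<in> hom C (ob I) a" if "i \<in> ?F" for i using ph[OF fin(1)] that by simp
    have pL: "p L x \<in> hom C (ob L) a" if "x \<in> L" for x by (rule ph[OF fin(3) that])
    have "Comp C (p J j) (Comp C (sh f) (st k)) =
        Comp C (finprod (hom_monoid a \<mu> \<eta> (ob I)) (p I) ?F) (st k)"
      using Comp_assoc[OF pd(3)[OF sq(3)] pd(4)[OF sq(1)] ph[OF fin(2) j]] pd(6)[OF sq(1) j] by simp
    also have "\<dots> = finprod (hom_monoid a \<mu> \<eta> (ob L)) (\<lambda>i. Comp C (p I i) (st k)) ?F"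
      by (rule finprod_precompose[OF pd(1) pd(3)[OF sq(3)] pI])
    also have "\<dots> = finprod (hom_monoid a \<mu> \<eta> (ob L)) (\<lambda>i. p L (fn k i)) ?F"
      by (rule M.finprod_cong'[OF refl]) (use pd(5)[OF sq(3)] pL fn_in[OF sq(3)] in auto)
    \<comment> \<open>In a pullback square \<open>k\<close> maps the fibre of \<open>f\<close> over
      \<open>j\<close> bijectively onto the fibre of \<open>g\<close> over \<open>fn l j\<close>, so
      it only reindexes the sum.\<close>
    also have "\<dots> = finprod (hom_monoid a \<mu> \<eta> (ob L)) (p L) (fn k ` ?F)"
      by (rule M.finprod_reindex[symmetric])
        (use pL fn_in[OF sq(3)] bij in \<open>auto simp: bij_betw_def\<close>)
    also have "fn k ` ?F = ?G" using bij by (simp add: bij_betw_def)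
    also have "finprod (hom_monoid a \<mu> \<eta> (ob L)) (p L) ?G = Comp C (p J j) (Comp C (st l) (sh g))"
      using Comp_assoc[OF pd(4)[OF sq(2)] pd(3)[OF sq(4)] ph[OF fin(2) j]] pd(5)[OF sq(4) j]
        pd(6)[OF sq(2) fn_in[OF sq(4) j]] by simp
    finally show "Comp C (p J j) (Comp C (sh f) (st k)) = Comp C (p J j) (Comp C (st l) (sh g))" .
  qed
next
  note pd = presentationD[OF P]
  note ph = product_coneD(2)[OF pd(2)]
  fix I :: "nat set" and X R and \<iota> :: "nat \<Rightarrow> 'x fmap"
  assume I: "finite I" and X: "\<And>i. i \<in> I \<Longrightarrow> finite (X i)" and d: "disjoint_union I X R \<iota>"
  note dd = disjoint_unionD[OF d]
  have \<iota>: "st (\<iota> i) \<in> hom C (ob R) (ob (X i))" if "i \<in> I" for i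
    by (rule pd(3)[OF dd(2)[OF that]])
  show "product_cone C I (\<lambda>i. ob (X i)) (ob R) (\<lambda>i. st (\<iota> i))"
  proof (rule product_coneI)
    show "ob R \<in> Obj C" by (rule product_coneD(1)[OF pd(2)[OF dd(1)]])
    show "st (\<iota> i) \<in> hom C (ob R) (ob (X i))" if "i \<in> I" for i by (rule \<iota>[OF that])
    show "\<exists>h. h \<in> hom C Z (ob R) \<and> (\<forall>i\<in>I. Comp C (st (\<iota> i)) h = f i)"
      if Z: "Z \<in> Obj C" and f: "\<And>i. i \<in> I \<Longrightarrow> f i \<in> hom C Z (ob (X i))" for Z f
    proof -
      \<comment> \<open>A power over a disjoint union is the product of the powers over the
        summands: the component at \<open>r\<close> is taken from the summand to which
        \<open>r\<close> belongs.\<close>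
      define w where "w r = (SOME y. \<exists>i\<in>I. \<exists>x\<in>X i. r = fn (\<iota> i) x \<and> y = Comp C (p (X i) x) (f i))" for r
      have w: "w (fn (\<iota> i) x) = Comp C (p (X i) x) (f i)" if "i \<in> I" "x \<in> X i" for i x
        unfolding w_def by (rule some_equality) (use that dd(3) in blast)+
      have wh: "w r \<in> hom C Z a" if r: "r \<in> R" for r
      proof -
        obtain i x where "i \<in> I" "x \<in> X i" "r = fn (\<iota> i) x" using dd(4)[OF r] by blast
        then show ?thesis using w Comp_hom[OF f ph[OF X]] by simp
      qed
      define h where "h = tuple C R (p R) Z (ob R) w"
      have h: "h \<in> hom C Z (ob R)" "\<And>r. r \<in> R \<Longrightarrow> Comp C (p R r) h = w r"
        using tuple[OF pd(2)[OF dd(1)] Z, of w] wh by (auto simp: h_def)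
      have "Comp C (st (\<iota> i)) h = f i" if i: "i \<in> I" for i
      proof (rule product_cone_ext[OF pd(2)[OF X[OF i]] category_axioms Comp_hom[OF h(1) \<iota>[OF i]] f[OF i]])
        fix x assume x: "x \<in> X i"
        show "Comp C (p (X i) x) (Comp C (st (\<iota> i)) h) = Comp C (p (X i) x) (f i)"
          using Comp_assoc[OF h(1) \<iota>[OF i] ph[OF X[OF i] x]] pd(5)[OF dd(2)[OF i] x]
            h(2)[OF fn_in[OF dd(2)[OF i] x]] w[OF i x] by simp
      qed
      then show ?thesis using h(1) by blast
    qed
    show "h = k" if h: "h \<in> hom C Z (ob R)" and k: "k \<in> hom C Z (ob R)"
      and eq: "\<And>i. i \<in> I \<Longrightarrow> Comp C (st (\<iota> i)) h = Comp C (st (\<iota> i)) k" for Z h k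
    proof (rule product_cone_ext[OF pd(2)[OF dd(1)] category_axioms h k])
      fix r assume r: "r \<in> R"
      obtain i x where ix: "i \<in> I" "x \<in> X i" "r = fn (\<iota> i) x" using dd(4)[OF r] by blast
      note px = ph[OF X[OF ix(1)] ix(2)]
      show "Comp C (p R r) h = Comp C (p R r) k"
        using Comp_assoc[OF h \<iota>[OF ix(1)] px] Comp_assoc[OF k \<iota>[OF ix(1)] px] eq[OF ix(1)]
          pd(5)[OF dd(2)[OF ix(1)] ix(2)] ix(3) by simp
    qed
  qed
qed

text \<open>The powers are chosen so that the one over \<open>{c}\<close> is \<open>a\<close> itself
  with the identity as projection. This yields the given monoid on the nose and not merely up to
  isomorphism.\<close>

lemma presentation_exists:
  fixes c :: 'x
  assumes M: "comm_monoid_object C a \<mu> \<eta>"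
  obtains ob st sh p where "presentation a \<mu> \<eta> ob st sh p" "ob {c} = a" "p {c} c = Ident C a"
proof -
  have a: "a \<in> Obj C" using M by (simp add: comm_monoid_object_def)
  \<comment> \<open>Both conditions are implications so that a choice function can be extracted over
    all sets, including infinite ones, where nothing is demanded.\<close>
  have "\<exists>P \<pi>. (finite A \<longrightarrow> product_cone C A (\<lambda>_. a) P \<pi>) \<and> (A = {c} \<longrightarrow> P = a \<and> \<pi> c = Ident C a)"
    for A :: "'x set"
  proof (cases "A = {c}")
    case True
    have "product_cone C {c} (\<lambda>_. a) a (\<lambda>_. Ident C a)"
      by (rule product_coneI) (use a Ident_hom Ident_Comp in auto)
    then show ?thesis using True by blast
  next
    case False
    show ?thesis
    proof (cases "finite A")
      case True
      obtain P \<pi> where "product_cone C A (\<lambda>_. a) P \<pi>"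
        using finite_product_exists[OF True, of "\<lambda>_. a"] a by blast
      then show ?thesis using False by blast
    qed (use False in simp)
  qed
  then obtain ob p where p: "\<And>A :: 'x set. finite A \<Longrightarrow> product_cone C A (\<lambda>_. a) (ob A) (p A)"
    and c: "ob {c} = a" "p {c} c = Ident C a"
    by metis
  note ph = product_coneD(2)[OF p]
  have ob: "ob A \<in> Obj C" if "finite A" for A using product_coneD(1)[OF p[OF that]] .
  define st where "st f = tuple C (Dom Setf f) (p (Dom Setf f)) (ob (Cod Setf f)) (ob (Dom Setf f))
    (\<lambda>x. p (Cod Setf f) (fn f x))" for f
  define sh where "sh f = tuple C (Cod Setf f) (p (Cod Setf f)) (ob (Dom Setf f)) (ob (Cod Setf f))
    (\<lambda>y. finprod (hom_monoid a \<mu> \<eta> (ob (Dom Setf f))) (p (Dom Setf f)) {x \<in> Dom Setf f. fn f x = y})" for f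
  have "presentation a \<mu> \<eta> ob st sh p"
    unfolding presentation_def
  proof (intro conjI allI ballI impI M p; assumption?)
    fix A B and f :: "'x fmap" assume f: "f \<in> hom Setf A B"
    note fin = Setf_finite[OF f] and dc = homD(2,3)[OF f]
    interpret M: comm_monoid "hom_monoid a \<mu> \<eta> (ob A)" by (rule comm_monoid_hom_monoid[OF M ob[OF fin(1)]])
    have 1: "p B (fn f x) \<in> hom C (ob B) a" if "x \<in> A" for x
      by (rule ph[OF fin(2) fn_in[OF f that]])
    have "finprod (hom_monoid a \<mu> \<eta> (ob A)) (p A) {x \<in> A. fn f x = y} \<in>
        carrier (hom_monoid a \<mu> \<eta> (ob A))" for y
      using ph[OF fin(1)] by (intro M.finprod_closed) auto
    then have 2: "finprod (hom_monoid a \<mu> \<eta> (ob A)) (p A) {x \<in> A. fn f x = y} \<in> hom C (ob A) a" for y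
      by simp
    note t1 = tuple[OF p[OF fin(1)] ob[OF fin(2)], of "\<lambda>x. p B (fn f x)", OF 1]
    note t2 = tuple[OF p[OF fin(2)] ob[OF fin(1)],
        of "\<lambda>y. finprod (hom_monoid a \<mu> \<eta> (ob A)) (p A) {x \<in> A. fn f x = y}", OF 2]
    show "st f \<in> hom C (ob B) (ob A)" "\<And>x. x \<in> A \<Longrightarrow> Comp C (p A x) (st f) = p B (fn f x)"
      unfolding st_def dc using t1 by auto
    show "sh f \<in> hom C (ob A) (ob B)" "\<And>y. y \<in> B \<Longrightarrow> Comp C (p B y) (sh f) =
        finprod (hom_monoid a \<mu> \<eta> (ob A)) (p A) {x \<in> A. fn f x = y}"
      unfolding sh_def dc using t2 by auto
  qed
  then show ?thesis using c by (rule that)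
qed

end

text \<open>With the identity as projection of F1, the points of F A are its projections and F_! of
  the mapping to 1 is the sum of all of them. The structure recovered at 2 and at 0 is then the
  binary and the empty sum of the given monoid.\<close>

lemma (in pointed_finite_set_DF) structure_of_presentation:
  assumes P: "presentation a m e ob st sh p" and c: "ob {c} = a" "p {c} c = Ident S a"
  shows "\<mu> = m" "\<eta> = e"
proof -
  note pd = presentationD[OF P]
  have m: "m \<in> hom S (prod_obj S a a) a" and e: "e \<in> hom S (one S) a"
    using pd(1) by (auto simp: comm_monoid_object_def)
  have st: "st (const_map {c} x A) = p A x" if A: "finite A" "x \<in> A" for A x
  proof -
    have h: "const_map {c} x A \<in> hom Setf {c} A" using A by (intro const_map_hom) auto
    show ?thesis
      using pd(5)[OF h, of c] Ident_Comp[OF st_hom[OF h]] c by (simp add: fn_const_map)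
  qed
  have sh: "sh (const_map A c {c}) = finprod (hom_monoid a m e (ob A)) (p A) A" if A: "finite A" for A
  proof -
    have h: "const_map A c {c} \<in> hom Setf A {c}" using A by (intro const_map_hom) auto
    have "{x \<in> A. fn (const_map A c {c}) x = c} = A" by (auto simp: fn_const_map)
    then show ?thesis
      using pd(6)[OF h, of c] Ident_Comp[OF sh_hom[OF h]] c by simp
  qed
  have uv: "p {u, v} u \<in> hom S (ob {u, v}) a" "p {u, v} v \<in> hom S (ob {u, v}) a"
    using product_coneD(2)[OF pd(2)] by auto
  interpret M: comm_monoid "hom_monoid a m e (ob {u, v})"
    by (rule comm_monoid_hom_monoid[OF pd(1) hom_Obj(1)[OF uv(1)]])
  \<comment> \<open>Unfolding \<open>finprod\<close> leaves a trailing unit, which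
    \<open>r_one\<close> removes; the pairing of the two projections is
    \<open>comparison\<close>.\<close>
  have "finprod (hom_monoid a m e (ob {u, v})) (p {u, v}) {u, v} = Comp S m comparison"
    using uv u_neq_v M.r_one[of "p {u, v} v"] by (simp add: comparison_def st)
  then have s: "sh (const_map {u, v} c {c}) = Comp S m comparison"
    using sh[of "{u, v}"] by simp
  have "Comp S comparison (inv_arr S comparison) = Ident S (prod_obj S a a)"
    using inv_comparison c by (simp add: inverse_pair_def homD[OF comparison_hom])
  then show "\<mu> = m"
    unfolding \<mu>_def s
    using Comp_assoc[OF inv_comparison_hom comparison_hom, of m] m Comp_Ident[OF m] c by simp
  note b = terminal_bang_hom[OF terminal_empty one_Obj]
  note b' = bang_hom[OF hom_Obj(2)[OF b]]
  \<comment> \<open>F of the empty set and the chosen terminal object are both terminal; this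
    cancels the comparison built into \<eta>.\<close>
  have "Comp S (bang S (ob {}) (one S)) (bang S (one S) (ob {})) = Ident S (one S)"
    by (rule terminal_ext[OF terminal_one Comp_hom[OF b b'] Ident_hom[OF one_Obj]])
  moreover interpret N: comm_monoid "hom_monoid a m e (ob {})"
    by (rule comm_monoid_hom_monoid[OF pd(1) hom_Obj(2)[OF b]])
  have "sh (const_map {} c {c}) = Comp S e (bang S (ob {}) (one S))"
    using sh[of "{}"] by simp
  ultimately show "\<eta> = e"
    unfolding \<eta>_def using Comp_assoc[OF b b' e] Comp_Ident[OF e] by simp
qed

text \<open>The uniqueness clause admits every \<open>G\<close> whose monoid is merely isomorphic to
  the given one, so that any two DF monoids with isomorphic monoids are both isomorphic to the same
  \<open>F\<close>.\<close>

theorem proposition6: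
  fixes S :: "('p, 'n) cat" and c u v :: 'a
  assumes "category S" and "has_finite_products S"
    and "infinite (UNIV :: 'a set)" and "u \<noteq> v"
  shows
    "(\<forall>F :: ('a set, 'a fmap, 'p, 'n) df. DF_monoid Setf S F \<longrightarrow>
        terminal S (DF_obj F {}) \<and>
        product_cone S UNIV (two (DF_obj F {c}) (DF_obj F {c})) (DF_obj F {u, v})
          (two (DF_star F (const_map {c} u {u, v})) (DF_star F (const_map {c} v {u, v}))) \<and>
        comm_monoid_object S (DF_obj F {c}) (DF_mult S F c u v) (DF_unit S F c)) \<and>
     (\<forall>a \<mu> \<eta>. comm_monoid_object S a \<mu> \<eta> \<longrightarrow>
        (\<exists>F :: ('a set, 'a fmap, 'p, 'n) df. DF_monoid Setf S F \<and>
           (DF_obj F {c}, DF_mult S F c u v, DF_unit S F c) = (a, \<mu>, \<eta>) \<and>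
           (\<forall>G :: ('a set, 'a fmap, 'p, 'n) df. DF_monoid Setf S G \<and>
              monoid_object_iso S (DF_obj G {c}, DF_mult S G c u v, DF_unit S G c) (a, \<mu>, \<eta>) \<longrightarrow>
              DF_iso Setf S F G)))"
proof -
  interpret finite_product_category S
    using assms by (simp add: finite_product_category_def finite_product_category_axioms_def)
  have pointed: "pointed_finite_set_DF S (DF_obj F) (DF_star F) (DF_shriek F) u v"
    if "DF_monoid Setf S F" for F :: "('a set, 'a fmap, 'p, 'n) df"
    using finite_set_DF_of_DF_monoid[OF assms(1,2) that assms(3)] assms(4)
    by (simp add: pointed_finite_set_DF_def pointed_finite_set_DF_axioms_def)
  have mult: "DF_mult S F c u v = pointed_finite_set_DF.\<mu> S (DF_star F) (DF_shriek F) c u v"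
    and unit: "DF_unit S F c = pointed_finite_set_DF.\<eta> S (DF_obj F) (DF_shriek F) c"
    if F: "DF_monoid Setf S F" for F :: "('a set, 'a fmap, 'p, 'n) df"
  proof -
    interpret F: pointed_finite_set_DF S "DF_obj F" "DF_star F" "DF_shriek F" c u v
      by (rule pointed[OF F])
    show "DF_mult S F c u v = F.\<mu>" "DF_unit S F c = F.\<eta>"
      by (simp_all add: DF_mult_def F.\<mu>_def F.comparison_def DF_unit_def F.\<eta>_def)
  qed
  show ?thesis
  proof (intro conjI allI impI)
    fix F :: "('a set, 'a fmap, 'p, 'n) df" assume F: "DF_monoid Setf S F"
    interpret F: pointed_finite_set_DF S "DF_obj F" "DF_star F" "DF_shriek F" c u v
      by (rule pointed[OF F])
    show "terminal S (DF_obj F {})"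
      "product_cone S UNIV (two (DF_obj F {c}) (DF_obj F {c})) (DF_obj F {u, v})
        (two (DF_star F (const_map {c} u {u, v})) (DF_star F (const_map {c} v {u, v})))"
      "comm_monoid_object S (DF_obj F {c}) (DF_mult S F c u v) (DF_unit S F c)"
      unfolding mult[OF F] unit[OF F]
      by (rule F.terminal_empty F.product_cone_two F.comm_monoid_object_base)+
  next
    fix a \<mu> \<eta> assume M: "comm_monoid_object S a \<mu> \<eta>"
    obtain ob and st sh :: "'a fmap \<Rightarrow> 'n" and p
      where P: "presentation a \<mu> \<eta> ob st sh p" and c: "ob {c} = a" "p {c} c = Ident S a"
      by (rule presentation_exists[OF M])
    interpret F: finite_set_DF S ob st sh
      by (rule finite_set_DF_of_presentation[OF P assms(3)])
    interpret F: pointed_finite_set_DF S ob st sh c u v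
      by unfold_locales (rule assms(4))
    have F: "DF_monoid Setf S F.DF" by (rule F.DF_monoid_DF)
    show "\<exists>F :: ('a set, 'a fmap, 'p, 'n) df. DF_monoid Setf S F \<and>
        (DF_obj F {c}, DF_mult S F c u v, DF_unit S F c) = (a, \<mu>, \<eta>) \<and>
        (\<forall>G :: ('a set, 'a fmap, 'p, 'n) df. DF_monoid Setf S G \<and>
          monoid_object_iso S (DF_obj G {c}, DF_mult S G c u v, DF_unit S G c) (a, \<mu>, \<eta>) \<longrightarrow>
          DF_iso Setf S F G)"
    proof (intro exI[of _ F.DF] conjI allI impI F)
      show "(DF_obj F.DF {c}, DF_mult S F.DF c u v, DF_unit S F.DF c) = (a, \<mu>, \<eta>)"
        using F.structure_of_presentation[OF P c] c by (simp add: mult[OF F] unit[OF F])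
      fix G :: "('a set, 'a fmap, 'p, 'n) df"
      assume "DF_monoid Setf S G \<and>
        monoid_object_iso S (DF_obj G {c}, DF_mult S G c u v, DF_unit S G c) (a, \<mu>, \<eta>)"
      then have G: "DF_monoid Setf S G"
        and "monoid_object_iso S (DF_obj G {c}, DF_mult S G c u v, DF_unit S G c) (a, \<mu>, \<eta>)" by auto
      then obtain \<phi> where \<phi>: "\<phi> \<in> hom S (DF_obj G {c}) a" "iso S \<phi>"
        "Comp S \<phi> (DF_mult S G c u v) = Comp S \<mu> (prod_arr S \<phi> \<phi>)" "Comp S \<phi> (DF_unit S G c) = \<eta>"
        by (auto simp: monoid_object_iso_def)
      interpret G: pointed_finite_set_DF S "DF_obj G" "DF_star G" "DF_shriek G" c u v
        by (rule pointed[OF G])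
      \<comment> \<open>Transport along \<phi> presents \<open>G\<close> by powers of
        \<open>a\<close> rather than of its own monoid, so it can be compared directly with the
        presentation of \<open>F\<close>.\<close>
      note Q = G.presentation_of_monoid_iso[OF M \<phi>(1,2) \<phi>(3)[unfolded mult[OF G]] \<phi>(4)[unfolded unit[OF G]]]
      obtain \<tau> where "\<And>A. finite A \<Longrightarrow> \<tau> A \<in> hom S (ob A) (DF_obj G A)"
        "\<And>A. finite A \<Longrightarrow> iso S (\<tau> A)"
        "\<And>A B f. f \<in> hom Setf A B \<Longrightarrow> Comp S (\<tau> B) (sh f) = Comp S (DF_shriek G f) (\<tau> A)"
        "\<And>A B f. f \<in> hom Setf A B \<Longrightarrow> Comp S (\<tau> A) (st f) = Comp S (DF_star G f) (\<tau> B)"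
        using presentation_iso[OF P Q] by blast
      then show "DF_iso Setf S F.DF G"
        unfolding DF_iso_def F.DF_simps by (intro exI[of _ \<tau>]) simp
    qed
  qed
qed

end
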